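(* Let $A(t)$ be a self-adjoint holomorphic family of type (B) on a complex Hilbert space $\mathcal{H}$, defined for real $t$ in a neighborhood of $0$. Let $\Sigma(t) = \min \sigma_e(A(t))$ and assume that $\Sigma(0)=0$. Suppose that $\lambda(t) < \Sigma(t)$ is an eigenvalue of $A(t)$ that depends continuously on $t$ when $0<t<\epsilon$ (for some $\epsilon>0$), that $\lim_{t\to 0^+}\lambda(t)=0$, and that $\liminf_{t\to 0^+} (\lambda(t)-\Sigma(t))/t < 0$. Then $0$ is an eigenvalue of $A(0)$. Furthermore, $\lim_{t\to 0^+}\lambda(t)/t$ exists and is equal to an eigenvalue of the bounded self-adjoint operator $B_0$ on $\mathcal{H}$ defined by $\langle B_0 x,y\rangle = \mathfrak{a}_1[Px,Py]$ for all $x,y\in\mathcal{H}$, where $P$ is the orthogonal projection onto the kernel of $A(0)$ and $\mathfrak{a}_1$ is the first-order coefficient in the power series expansion at $t=0$ of the family of sesquilinear forms $\mathfrak{a}(t)$ corresponding to $A(t)$.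
   Context: For a sesquilinear form $\mathfrak{t}$ on $\mathcal{H}$ with domain $\mathcal{D}(\mathfrak{t})$, write $\mathfrak{t}[x]=\mathfrak{t}[x,x]$, and $W(\mathfrak{t})=\{\mathfrak{t}[x] : x\in\mathcal{D}(\mathfrak{t}),\ \|x\|=1\}$. The form is symmetric if $\mathfrak{t}[x,y]=\overline{\mathfrak{t}[y,x]}$. It is sectorial if there are $v\in\mathbb{C}$ and $\theta<\pi/2$ with $|\arg(z-v)|\le\theta$ for all $z\in W(\mathfrak{t})$. A sectorial form is closed if whenever $x_n\in\mathcal{D}(\mathfrak{t})$, $x_n\to x$ in $\mathcal{H}$ and $\mathfrak{t}[x_n-x_m]\to 0$ as $n,m\to\infty$, then $x\in\mathcal{D}(\mathfrak{t})$ (and $\mathfrak{t}[x_n-x]\to0$). A subspace $V\subseteq\mathcal{D}(\mathfrak{t})$ is a core of a closed form $\mathfrak{t}$ if the closure (smallest closed extension) of $\mathfrak{t}|_V$ is $\mathfrak{t}$. A family $\mathfrak{a}(t)$ of sesquilinear forms, defined for complex $t$ in a neighborhood of $0$, is holomorphic of type (a) if each $\mathfrak{a}(t)$ is closed and sectorial, the domain $\mathcal{D}(\mathfrak{a}(t))=:\mathcal{D}(\mathfrak{a})$ is independent of $t$ and dense in $\mathcal{H}$, and $t\mapsto\mathfrak{a}(t)[x,y]$ is holomorphic near $0$ for all $x,y\in\mathcal{D}(\mathfrak{a})$. If in addition $\mathfrak{a}(t)$ is symmetric for real $t$, then for each real $t$ near $0$ there is a unique self-adjoint operator $A(t)$,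 with $\mathcal{D}(A(t))$ a core of $\mathfrak{a}(t)$ and $\langle A(t)x,y\rangle=\mathfrak{a}(t)[x,y]$ for $x,y\in\mathcal{D}(A(t))$; each $A(t)$ is bounded below. Such a family $A(t)$ is called a self-adjoint holomorphic family of type (B), and $\mathfrak{a}(t)$ is the corresponding family of forms. For such a family there is $R>0$ and there are symmetric sesquilinear forms $\mathfrak{a}_k$, defined on $\mathcal{D}(\mathfrak{a})$, with $\mathfrak{a}(t)[x,y]=\sum_{k\ge0}t^k\mathfrak{a}_k[x,y]$ for all $x,y\in\mathcal{D}(\mathfrak{a})$ and $|t|<R$. The form $(x,y)\mapsto\mathfrak{a}_1[Px,Py]$ is bounded and symmetric on $\mathcal{H}$, so $B_0$ is well defined. The essential spectrum of an operator $T$ is $\sigma_e(T)=\{\lambda\in\mathbb{C} : \exists\, x_n\in\mathcal{D}(T),\ \|x_n\|=1,\ x_n\to0 \text{ weakly},\ \|(T-\lambda)x_n\|\to0\}$. *)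

theory Defs
  imports "HOL-Complex_Analysis.Complex_Analysis"
begin

text \<open>
  The inner product is linear in the first argument. Positivity and definiteness
  are contained in the last axiom, since the norm is that of a Banach space.
\<close>

class complex_hilbert_space = banach +
  fixes scaleC :: "complex \<Rightarrow> 'a \<Rightarrow> 'a"  (infixr \<open>*\<^sub>C\<close> 75)
    and cinner :: "'a \<Rightarrow> 'a \<Rightarrow> complex"
  assumes scaleC_of_real: "complex_of_real r *\<^sub>C x = r *\<^sub>R x"
    and scaleC_scaleC: "c *\<^sub>C d *\<^sub>C x = (c * d) *\<^sub>C x"
    and scaleC_add_right: "c *\<^sub>C (x + y) = c *\<^sub>C x + c *\<^sub>C y"
    and scaleC_add_left: "(c + d) *\<^sub>C x = c *\<^sub>C x + d *\<^sub>C x"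
    and cinner_commute: "cinner x y = cnj (cinner y x)"
    and cinner_add_left: "cinner (x + y) z = cinner x z + cinner y z"
    and cinner_scaleC_left: "cinner (c *\<^sub>C x) y = c * cinner x y"
    and cinner_self: "cinner x x = complex_of_real ((norm x)\<^sup>2)"

definition csubspace :: "'a::complex_hilbert_space set \<Rightarrow> bool" where
  "csubspace V \<longleftrightarrow>
     0 \<in> V \<and> (\<forall>x\<in>V. \<forall>y\<in>V. x + y \<in> V) \<and> (\<forall>c. \<forall>x\<in>V. c *\<^sub>C x \<in> V)"

definition weakly_tendsto_0 :: "(nat \<Rightarrow> 'a::complex_hilbert_space) \<Rightarrow> bool" where
  "weakly_tendsto_0 x \<longleftrightarrow> (\<forall>y. (\<lambda>n. cinner (x n) y) \<longlonglongrightarrow> 0)"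

definition orth_proj :: "'a::complex_hilbert_space set \<Rightarrow> 'a \<Rightarrow> 'a" where
  "orth_proj V x = (THE p. p \<in> V \<and> (\<forall>v\<in>V. cinner (x - p) v = 0))"


section \<open>Sesquilinear forms\<close>

text \<open>
  A form is given by its domain \<open>D\<close> and a function \<open>t\<close>; the values of \<open>t\<close>
  outside \<open>D \<times> D\<close> are irrelevant. So \<open>t\<close> with a smaller domain
  denotes the restriction of the form.
\<close>

definition sesquilinear_on :: "'a::complex_hilbert_space set \<Rightarrow> ('a \<Rightarrow> 'a \<Rightarrow> complex) \<Rightarrow> bool" where
  "sesquilinear_on D t \<longleftrightarrow> csubspace D \<and>
     (\<forall>x\<in>D. \<forall>y\<in>D. \<forall>z\<in>D. t (x + y) z = t x z + t y z \<and> t z (x + y) = t z x + t z y) \<and>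
     (\<forall>c. \<forall>x\<in>D. \<forall>y\<in>D. t (c *\<^sub>C x) y = c * t x y \<and> t x (c *\<^sub>C y) = cnj c * t x y)"

definition numerical_range :: "'a::complex_hilbert_space set \<Rightarrow> ('a \<Rightarrow> 'a \<Rightarrow> complex) \<Rightarrow> complex set" where
  "numerical_range D t = {t x x | x. x \<in> D \<and> norm x = 1}"

definition symmetric_form :: "'a::complex_hilbert_space set \<Rightarrow> ('a \<Rightarrow> 'a \<Rightarrow> complex) \<Rightarrow> bool" where
  "symmetric_form D t \<longleftrightarrow> (\<forall>x\<in>D. \<forall>y\<in>D. t x y = cnj (t y x))"

text \<open>As \<open>Arg 0 = 0\<close>, the vertex \<open>v\<close> belongs to the sector.\<close>

definition sectorial :: "'a::complex_hilbert_space set \<Rightarrow> ('a \<Rightarrow> 'a \<Rightarrow> complex) \<Rightarrow> bool" where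
  "sectorial D t \<longleftrightarrow>
     (\<exists>v \<theta>. \<theta> < pi / 2 \<and> (\<forall>z\<in>numerical_range D t. \<bar>Arg (z - v)\<bar> \<le> \<theta>))"

definition closed_sectorial_form :: "'a::complex_hilbert_space set \<Rightarrow> ('a \<Rightarrow> 'a \<Rightarrow> complex) \<Rightarrow> bool" where
  "closed_sectorial_form D t \<longleftrightarrow> sesquilinear_on D t \<and> sectorial D t \<and>
     (\<forall>x l. (\<forall>n. x n \<in> D) \<longrightarrow> x \<longlonglongrightarrow> l \<longrightarrow>
        ((\<lambda>(n, m). t (x n - x m) (x n - x m)) \<longlongrightarrow> 0) (sequentially \<times>\<^sub>F sequentially) \<longrightarrow>
        l \<in> D \<and> (\<lambda>n. t (x n - l) (x n - l)) \<longlonglongrightarrow> 0)"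

definition form_extends ::
  "'a::complex_hilbert_space set \<Rightarrow> ('a \<Rightarrow> 'a \<Rightarrow> complex) \<Rightarrow> 'a set \<Rightarrow> ('a \<Rightarrow> 'a \<Rightarrow> complex) \<Rightarrow> bool" where
  "form_extends D' t' D t \<longleftrightarrow> D \<subseteq> D' \<and> (\<forall>x\<in>D. \<forall>y\<in>D. t' x y = t x y)"

definition is_form_closure ::
  "'a::complex_hilbert_space set \<Rightarrow> ('a \<Rightarrow> 'a \<Rightarrow> complex) \<Rightarrow> 'a set \<Rightarrow> ('a \<Rightarrow> 'a \<Rightarrow> complex) \<Rightarrow> bool" where
  "is_form_closure D' t' D t \<longleftrightarrow>
     closed_sectorial_form D' t' \<and> form_extends D' t' D t \<and>
     (\<forall>D'' t''. closed_sectorial_form D'' t'' \<and> form_extends D'' t'' D t \<longrightarrow>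
        form_extends D'' t'' D' t')"

definition is_core :: "'a::complex_hilbert_space set \<Rightarrow> 'a set \<Rightarrow> ('a \<Rightarrow> 'a \<Rightarrow> complex) \<Rightarrow> bool" where
  "is_core V D t \<longleftrightarrow> csubspace V \<and> V \<subseteq> D \<and> is_form_closure D t V t"


section \<open>Operators\<close>

text \<open>As with forms, an operator is a domain \<open>D\<close> together with a function \<open>T\<close>.\<close>

definition linear_operator :: "'a::complex_hilbert_space set \<Rightarrow> ('a \<Rightarrow> 'a) \<Rightarrow> bool" where
  "linear_operator D T \<longleftrightarrow> csubspace D \<and>
     (\<forall>x\<in>D. \<forall>y\<in>D. T (x + y) = T x + T y) \<and> (\<forall>c. \<forall>x\<in>D. T (c *\<^sub>C x) = c *\<^sub>C T x)"

definition adjoint_graph :: "'a::complex_hilbert_space set \<Rightarrow> ('a \<Rightarrow> 'a) \<Rightarrow> ('a \<times> 'a) set" where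
  "adjoint_graph D T = {(y, z). \<forall>x\<in>D. cinner (T x) y = cinner x z}"

definition self_adjoint :: "'a::complex_hilbert_space set \<Rightarrow> ('a \<Rightarrow> 'a) \<Rightarrow> bool" where
  "self_adjoint D T \<longleftrightarrow>
     linear_operator D T \<and> closure D = UNIV \<and> adjoint_graph D T = {(y, T y) | y. y \<in> D}"

definition bounded_self_adjoint :: "('a::complex_hilbert_space \<Rightarrow> 'a) \<Rightarrow> bool" where
  "bounded_self_adjoint B \<longleftrightarrow> self_adjoint UNIV B \<and> (\<exists>K. \<forall>x. norm (B x) \<le> K * norm x)"

definition op_kernel :: "'a::complex_hilbert_space set \<Rightarrow> ('a \<Rightarrow> 'a) \<Rightarrow> 'a set" where
  "op_kernel D T = {x \<in> D. T x = 0}"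

definition is_eigenvalue :: "'a::complex_hilbert_space set \<Rightarrow> ('a \<Rightarrow> 'a) \<Rightarrow> complex \<Rightarrow> bool" where
  "is_eigenvalue D T \<mu> \<longleftrightarrow> (\<exists>x\<in>D. x \<noteq> 0 \<and> T x = \<mu> *\<^sub>C x)"

definition essential_spectrum :: "'a::complex_hilbert_space set \<Rightarrow> ('a \<Rightarrow> 'a) \<Rightarrow> complex set" where
  "essential_spectrum D T =
     {\<mu>. \<exists>x. (\<forall>n. x n \<in> D \<and> norm (x n) = 1) \<and> weakly_tendsto_0 x \<and>
             (\<lambda>n. norm (T (x n) - \<mu> *\<^sub>C x n)) \<longlonglongrightarrow> 0}"

text \<open>
  The essential spectrum of a self-adjoint operator is real, so its minimum is that of
  the set of real numbers it contains.
\<close>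

definition is_min_essential_spectrum ::
  "'a::complex_hilbert_space set \<Rightarrow> ('a \<Rightarrow> 'a) \<Rightarrow> real \<Rightarrow> bool" where
  "is_min_essential_spectrum D T s \<longleftrightarrow>
     complex_of_real s \<in> essential_spectrum D T \<and>
     (\<forall>r. complex_of_real r \<in> essential_spectrum D T \<longrightarrow> s \<le> r)"


section \<open>Holomorphic families\<close>

text \<open>
  \<open>U\<close> is the neighbourhood of 0 on which the family of forms is defined. The
  common domain \<open>D\<close> does not depend on the parameter.
\<close>

definition holomorphic_type_a ::
  "complex set \<Rightarrow> 'a::complex_hilbert_space set \<Rightarrow> (complex \<Rightarrow> 'a \<Rightarrow> 'a \<Rightarrow> complex) \<Rightarrow> bool" where
  "holomorphic_type_a U D a \<longleftrightarrow>
     open U \<and> 0 \<in> U \<and> closure D = UNIV \<and>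
     (\<forall>t\<in>U. closed_sectorial_form D (a t)) \<and>
     (\<forall>x\<in>D. \<forall>y\<in>D. (\<lambda>t. a t x y) holomorphic_on U)"

definition associated_operator ::
  "'a::complex_hilbert_space set \<Rightarrow> ('a \<Rightarrow> 'a \<Rightarrow> complex) \<Rightarrow> 'a set \<Rightarrow> ('a \<Rightarrow> 'a) \<Rightarrow> bool" where
  "associated_operator D t DT T \<longleftrightarrow>
     self_adjoint DT T \<and> is_core DT D t \<and> (\<forall>x\<in>DT. \<forall>y\<in>DT. cinner (T x) y = t x y)"

text \<open>
  \<open>A t\<close> with domain \<open>DA t\<close> is a self-adjoint holomorphic family of type (B), and
  \<open>a t\<close> with domain \<open>D\<close> is the corresponding family of forms.
\<close>

definition self_adjoint_type_B ::
  "complex set \<Rightarrow> 'a::complex_hilbert_space set \<Rightarrow> (complex \<Rightarrow> 'a \<Rightarrow> 'a \<Rightarrow> complex) \<Rightarrow>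
   (real \<Rightarrow> 'a set) \<Rightarrow> (real \<Rightarrow> 'a \<Rightarrow> 'a) \<Rightarrow> bool" where
  "self_adjoint_type_B U D a DA A \<longleftrightarrow>
     holomorphic_type_a U D a \<and>
     (\<forall>t. complex_of_real t \<in> U \<longrightarrow>
        symmetric_form D (a (complex_of_real t)) \<and>
        associated_operator D (a (complex_of_real t)) (DA t) (A t))"

definition form_coeff ::
  "(complex \<Rightarrow> 'a::complex_hilbert_space \<Rightarrow> 'a \<Rightarrow> complex) \<Rightarrow> nat \<Rightarrow> 'a \<Rightarrow> 'a \<Rightarrow> complex" where
  "form_coeff a k x y = fps_nth (fps_expansion (\<lambda>t. a t x y) 0) k"

end

(*
  Take normalized eigenvectors x(t) of A(t) with eigenvalue ev(t). As t -> 0 a weak limit u of x(t)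
  lies in the kernel of A(0); the mass lost in the limit sees the quadratic form a1 with value at
  least s = lim Sigma(t)/t along a sequence realizing the liminf hypothesis. Since the slope of ev
  at t is a1[x(t)] + O(t), ev(t)/t cannot stay below s while all slopes are at least s; hence some
  u is nonzero, and testing the eigenvalue equation against the kernel shows that ev(t)/t tends to
  an eigenvalue of B_0 along a subsequence. If ev(t)/t oscillated, it would cross every level r of
  an interval below s downwards at arbitrarily small t; the slope is at most r there, no mass is
  lost, and x(t) converges strongly to a unit eigenvector of B_0 for r. Eigenvectors for different r
  are orthogonal, so uncountably many x(t) would be uniformly separated. They accumulate at some
  t > 0, contradicting compactness of eigenvectors below the essential spectrum.
*)

theory Submission
  imports Defs
begin

section \<open>Complete inner products\<close>

text \<open>The lost mass sees \<open>a1\<close> through one fixed time: if z is weakly null with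
  a(0)[z] tending to 0, the essential bound at a small time r gives a(r)[z] >= \<Sigma>(r) |z|^2 -
  o(1). Inserting a(r) = a(0) + r a1 + O(r^2) and dividing by r bounds a1[z] below by
  (\<Sigma>(r)/r) |z|^2 up to O(r) + o(1). Two obstacles shape the rest. The eigenvalue is merely
  continuous and may be degenerate, so neither it nor its eigenvectors need follow a differentiable
  branch; slopes are therefore right difference quotients along sequences, taken where ev t - r t
  has just left a level. And \<open>a1\<close> need not be bounded in the ambient norm, so every
  error is measured in one Hilbert norm on the form domain, that of a shift of a(0). Holomorphy only
  gives Taylor estimates for each pair x, y separately; uniform boundedness turns them into
  estimates of forms.\<close>

lemma scaleC_zero_left [simp]: "0 *\<^sub>C x = (0::'a::complex_hilbert_space)"
  using scaleC_of_real[of 0 x] by simp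

lemma scaleC_one [simp]: "1 *\<^sub>C x = (x::'a::complex_hilbert_space)"
  using scaleC_of_real[of 1 x] by simp

lemma scaleC_zero_right [simp]: "c *\<^sub>C 0 = (0::'a::complex_hilbert_space)"
  using scaleC_add_right[of c 0 0] by simp

lemma scaleC_minus1: "(-1) *\<^sub>C x = - (x::'a::complex_hilbert_space)"
  using scaleC_of_real[of "-1" x] by simp

lemma diff_conv_scaleC: "x - y = x + (-1) *\<^sub>C (y::'a::complex_hilbert_space)"
  by (simp add: scaleC_minus1)

lemma csubspace_UNIV: "csubspace UNIV"
  by (simp add: csubspace_def)

lemma csubspace_diff: "csubspace V \<Longrightarrow> x \<in> V \<Longrightarrow> y \<in> V \<Longrightarrow> x - y \<in> V"
  unfolding csubspace_def diff_conv_scaleC by blast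

section \<open>Algebra of sesquilinear and symmetric forms\<close>

locale sesquilinear =
  fixes D :: "'a::complex_hilbert_space set" and t :: "'a \<Rightarrow> 'a \<Rightarrow> complex"
  assumes sesq: "sesquilinear_on D t"
begin

lemma csub: "csubspace D" using sesq by (simp add: sesquilinear_on_def)

lemma zero_mem [simp]: "0 \<in> D"
  and add_mem [simp]: "x \<in> D \<Longrightarrow> y \<in> D \<Longrightarrow> x + y \<in> D"
  and scaleC_mem [simp]: "x \<in> D \<Longrightarrow> c *\<^sub>C x \<in> D"
  and diff_mem [simp]: "x \<in> D \<Longrightarrow> y \<in> D \<Longrightarrow> x - y \<in> D"
  using csub csubspace_diff unfolding csubspace_def by blast+

lemma scaleR_mem [simp]: "x \<in> D \<Longrightarrow> r *\<^sub>R x \<in> D"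
  using scaleC_mem[of x "of_real r"] by (simp add: scaleC_of_real)

lemma add_left [simp]: "x \<in> D \<Longrightarrow> y \<in> D \<Longrightarrow> z \<in> D \<Longrightarrow> t (x + y) z = t x z + t y z"
  and add_right [simp]: "x \<in> D \<Longrightarrow> y \<in> D \<Longrightarrow> z \<in> D \<Longrightarrow> t z (x + y) = t z x + t z y"
  and scaleC_left [simp]: "x \<in> D \<Longrightarrow> y \<in> D \<Longrightarrow> t (c *\<^sub>C x) y = c * t x y"
  and scaleC_right [simp]: "x \<in> D \<Longrightarrow> y \<in> D \<Longrightarrow> t x (c *\<^sub>C y) = cnj c * t x y"
  using sesq unfolding sesquilinear_on_def by blast+

lemma diff_left [simp]: "x \<in> D \<Longrightarrow> y \<in> D \<Longrightarrow> z \<in> D \<Longrightarrow> t (x - y) z = t x z - t y z"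
  and diff_right [simp]: "x \<in> D \<Longrightarrow> y \<in> D \<Longrightarrow> z \<in> D \<Longrightarrow> t z (x - y) = t z x - t z y"
  unfolding diff_conv_scaleC[of x y] by (simp_all del: add_uminus_conv_diff)

lemma zero_left [simp]: "y \<in> D \<Longrightarrow> t 0 y = 0"
  and zero_right [simp]: "y \<in> D \<Longrightarrow> t y 0 = 0"
  using scaleC_left[of 0 y 0] scaleC_right[of y 0 0] by simp_all

lemma scaleR_left [simp]: "x \<in> D \<Longrightarrow> y \<in> D \<Longrightarrow> t (r *\<^sub>R x) y = of_real r * t x y"
  and scaleR_right [simp]: "x \<in> D \<Longrightarrow> y \<in> D \<Longrightarrow> t x (r *\<^sub>R y) = of_real r * t x y"
  using scaleC_left[of x y "of_real r"] scaleC_right[of x y "of_real r"]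
  by (simp_all add: scaleC_of_real)

end

locale symmetric_sesquilinear = sesquilinear +
  assumes sym: "symmetric_form D t"
begin

lemma swap: "x \<in> D \<Longrightarrow> y \<in> D \<Longrightarrow> t y x = cnj (t x y)"
  using sym unfolding symmetric_form_def by blast

lemma diag_real: "x \<in> D \<Longrightarrow> t x x = complex_of_real (Re (t x x))"
  using arg_cong[OF swap[of x x], of Im] by (simp add: complex_eq_iff)

lemma Re_diag_add: "x \<in> D \<Longrightarrow> y \<in> D \<Longrightarrow>
    Re (t (x + y) (x + y)) = Re (t x x) + 2 * Re (t x y) + Re (t y y)"
  using swap[of x y] by simp

lemma Re_diag_diff: "x \<in> D \<Longrightarrow> y \<in> D \<Longrightarrow>
    Re (t (x - y) (x - y)) = Re (t x x) - 2 * Re (t x y) + Re (t y y)"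
  using swap[of x y] by simp

lemma Re_diag_scaleC: "x \<in> D \<Longrightarrow> Re (t (c *\<^sub>C x) (c *\<^sub>C x)) = (cmod c)\<^sup>2 * Re (t x x)"
proof -
  assume "x \<in> D"
  then have "t (c *\<^sub>C x) (c *\<^sub>C x) = c * cnj c * t x x"
    by simp
  also have "\<dots> = of_real ((cmod c)\<^sup>2) * t x x" by (simp only: complex_norm_square)
  finally show ?thesis by simp
qed

end

interpretation cinner: symmetric_sesquilinear UNIV cinner
proof
  have "cinner z (x + y) = cinner z x + cinner z y" for x y z :: 'a
    by (metis cinner_add_left cinner_commute complex_cnj_add)
  moreover have "cinner x (c *\<^sub>C y) = cnj c * cinner x y" for c and x y :: 'a
    by (metis cinner_scaleC_left cinner_commute complex_cnj_mult)
  ultimately show "sesquilinear_on (UNIV :: 'a set) cinner"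
    by (simp add: sesquilinear_on_def csubspace_UNIV cinner_add_left cinner_scaleC_left)
  show "symmetric_form (UNIV :: 'a set) cinner"
    unfolding symmetric_form_def using cinner_commute by blast
qed

text \<open>
  A complete inner product on a subspace whose norm dominates that of the ambient space:
  this covers both the ambient space itself and the domain of a closed form with the form norm.
\<close>

locale hilbert_form = symmetric_sesquilinear D ip
  for D :: "'a::complex_hilbert_space set" and ip :: "'a \<Rightarrow> 'a \<Rightarrow> complex" +
  assumes norm_le: "\<And>x. x \<in> D \<Longrightarrow> (norm x)\<^sup>2 \<le> Re (ip x x)"
    and complete: "\<And>x. \<lbrakk>\<And>n. x n \<in> D;
      \<And>e. e > 0 \<Longrightarrow> \<exists>N. \<forall>m\<ge>N. \<forall>n\<ge>N. Re (ip (x m - x n) (x m - x n)) < e\<rbrakk> \<Longrightarrow>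
      \<exists>l\<in>D. (\<lambda>n. Re (ip (x n - l) (x n - l))) \<longlonglongrightarrow> 0"
begin

section \<open>Geometry of a complete form\<close>

definition nrm :: "'a \<Rightarrow> real" where "nrm x = sqrt (Re (ip x x))"

lemma diag_nonneg: "x \<in> D \<Longrightarrow> 0 \<le> Re (ip x x)"
  using norm_le[of x] zero_le_power2[of "norm x"] by linarith

lemma nrm_power2: "x \<in> D \<Longrightarrow> (nrm x)\<^sup>2 = Re (ip x x)"
  by (simp add: nrm_def diag_nonneg)

lemma diag_nrm: "x \<in> D \<Longrightarrow> ip x x = complex_of_real ((nrm x)\<^sup>2)"
  using diag_real nrm_power2 by metis

lemma nrm_nonneg [simp]: "x \<in> D \<Longrightarrow> 0 \<le> nrm x"
  by (simp add: nrm_def diag_nonneg)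

lemma norm_le_nrm: "x \<in> D \<Longrightarrow> norm x \<le> nrm x"
  by (simp add: nrm_def norm_le real_le_rsqrt)

lemma nrm_zero [simp]: "nrm 0 = 0"
  by (simp add: nrm_def)

lemma nrm_pos: "x \<in> D \<Longrightarrow> x \<noteq> 0 \<Longrightarrow> 0 < nrm x"
  using norm_le_nrm[of x] zero_less_norm_iff[of x] by linarith

lemma diag_pos: "x \<in> D \<Longrightarrow> x \<noteq> 0 \<Longrightarrow> 0 < Re (ip x x)"
  using nrm_pos nrm_power2 by (metis zero_less_power)

lemma nrm_scaleC: "x \<in> D \<Longrightarrow> nrm (c *\<^sub>C x) = cmod c * nrm x"
  unfolding nrm_def by (subst Re_diag_scaleC) (simp_all add: real_sqrt_mult)

lemma nrm_scaleR: "x \<in> D \<Longrightarrow> nrm (r *\<^sub>R x) = \<bar>r\<bar> * nrm x"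
  using nrm_scaleC[of x "of_real r"] by (simp add: scaleC_of_real)

lemma nrm_minus_commute: "x \<in> D \<Longrightarrow> y \<in> D \<Longrightarrow> nrm (x - y) = nrm (y - x)"
  using Re_diag_diff[of x y] Re_diag_diff[of y x] arg_cong[OF swap[of x y], of Re] 
  unfolding nrm_def by (simp del: diff_left diff_right)

text \<open>Pythagoras for \<open>w\<close> and its component along \<open>v\<close>. Nonnegativity
  of the left side yields Cauchy-Schwarz, minimality of \<open>w\<close> yields
  orthogonality.\<close>

lemma diag_sub_component:
  assumes "w \<in> D" "v \<in> D" "v \<noteq> 0"
  shows "Re (ip (w - (ip w v / ip v v) *\<^sub>C v) (w - (ip w v / ip v v) *\<^sub>C v))
    = Re (ip w w) - (cmod (ip w v))\<^sup>2 / Re (ip v v)"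
proof -
  let ?c = "ip w v / ip v v" and ?q = "Re (ip v v)"
  have q: "?q > 0" using diag_pos[OF assms(2,3)] .
  have vv: "ip v v = of_real ?q" using diag_real assms by blast
  then have cvv: "cnj (ip v v) = ip v v" by (metis complex_cnj_complex_of_real)
  have 1: "Re (cnj ?c * ip w v) = (cmod (ip w v))\<^sup>2 / ?q"
  proof -
    have "cnj ?c * ip w v = (ip w v * cnj (ip w v)) / ip v v" using cvv by simp
    also have "\<dots> = (ip w v * cnj (ip w v)) / of_real ?q" by (metis vv)
    also have "\<dots> = of_real ((cmod (ip w v))\<^sup>2 / ?q)"
      by (simp add: complex_norm_square del: of_real_power)
    finally show ?thesis by (metis Re_complex_of_real)
  qed
  have 2: "(cmod ?c)\<^sup>2 * ?q = (cmod (ip w v))\<^sup>2 / ?q"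
  proof -
    have "cmod (ip v v) = ?q" using vv q by (metis norm_of_real abs_of_pos)
    then show ?thesis using q by (simp add: norm_divide power_divide power2_eq_square)
  qed
  have "Re (ip (w - ?c *\<^sub>C v) (w - ?c *\<^sub>C v))
      = Re (ip w w) - 2 * Re (ip w (?c *\<^sub>C v)) + Re (ip (?c *\<^sub>C v) (?c *\<^sub>C v))"
    using assms by (intro Re_diag_diff) auto
  also have "\<dots> = Re (ip w w) - 2 * Re (cnj ?c * ip w v) + (cmod ?c)\<^sup>2 * ?q"
    using Re_diag_scaleC[of v ?c] assms by (simp del: scaleC_left)
  finally show ?thesis using 1 2 by simp
qed

lemma Cauchy_Schwarz:
  assumes "x \<in> D" "y \<in> D" shows "cmod (ip x y) \<le> nrm x * nrm y"
proof (cases "y = 0")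
  case True then show ?thesis using assms by simp
next
  case False
  have q: "Re (ip y y) > 0" using diag_pos[OF assms(2) False] .
  have "0 \<le> Re (ip x x) - (cmod (ip x y))\<^sup>2 / Re (ip y y)"
    using diag_sub_component[OF assms False] diag_nonneg assms by (metis diff_mem scaleC_mem)
  then have "(cmod (ip x y))\<^sup>2 \<le> (nrm x * nrm y)\<^sup>2"
    using q assms by (simp add: power_mult_distrib nrm_power2 field_simps)
  then show ?thesis by (rule power2_le_imp_le) (simp add: assms)
qed

lemma Re_ip_le: "x \<in> D \<Longrightarrow> y \<in> D \<Longrightarrow> Re (ip x y) \<le> nrm x * nrm y"
  using Cauchy_Schwarz[of x y] complex_Re_le_cmod[of "ip x y"] by linarith

lemma nrm_triangle:
  assumes "x \<in> D" "y \<in> D" shows "nrm (x + y) \<le> nrm x + nrm y"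
proof -
  have "(nrm (x + y))\<^sup>2 \<le> (nrm x + nrm y)\<^sup>2"
    using assms Re_diag_add[of x y] Re_ip_le[of x y] nrm_power2[of "x + y"]
    by (simp add: power2_sum nrm_power2)
  then show ?thesis by (rule power2_le_imp_le) (simp add: assms)
qed

lemma nrm_diff_triangle:
  assumes "x \<in> D" "y \<in> D" "z \<in> D" shows "nrm (x - z) \<le> nrm (x - y) + nrm (y - z)"
  using nrm_triangle[of "x - y" "y - z"] assms by simp

lemma nrm_diff_le:
  assumes "x \<in> D" "y \<in> D" shows "nrm (x - y) \<le> nrm x + nrm y"
  using nrm_diff_triangle[of x 0 y] nrm_minus_commute[of 0 y] assms by simp

lemma minimal_orthogonal:
  assumes "w \<in> D" "v \<in> D" and min: "\<And>c. nrm w \<le> nrm (w - c *\<^sub>C v)"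
  shows "ip w v = 0"
proof (cases "v = 0")
  case True then show ?thesis using assms by simp
next
  case False
  have q: "Re (ip v v) > 0" using diag_pos[OF assms(2) False] .
  have "(nrm w)\<^sup>2 \<le> (nrm (w - (ip w v / ip v v) *\<^sub>C v))\<^sup>2"
    using min assms by (intro power_mono) auto
  also have "\<dots> = (nrm w)\<^sup>2 - (cmod (ip w v))\<^sup>2 / Re (ip v v)"
    using diag_sub_component[OF assms(1,2) False] assms by (simp only: nrm_power2 diff_mem scaleC_mem)
  finally have "(cmod (ip w v))\<^sup>2 / Re (ip v v) \<le> 0" by simp
  then show ?thesis using q by (simp add: divide_le_0_iff)
qed

lemma parallelogram:
  assumes "x \<in> D" "y \<in> D"
  shows "(nrm (x - y))\<^sup>2 = 2 * (nrm x)\<^sup>2 + 2 * (nrm y)\<^sup>2 - (nrm (x + y))\<^sup>2"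
  using Re_diag_add[OF assms] Re_diag_diff[OF assms] nrm_power2[OF add_mem[OF assms]]
    nrm_power2[OF diff_mem[OF assms]] nrm_power2[OF assms(1)] nrm_power2[OF assms(2)]
  by linarith

section \<open>Orthogonal projection, Riesz representation and weak compactness\<close>

definition nrm_closed :: "'a set \<Rightarrow> bool" where
  "nrm_closed Y \<longleftrightarrow> (\<forall>x l. (\<forall>n::nat. x n \<in> Y) \<longrightarrow> l \<in> D \<longrightarrow> (\<lambda>n. nrm (x n - l)) \<longlonglongrightarrow> 0 \<longrightarrow> l \<in> Y)"

lemma complete_nrm:
  assumes "\<And>n. x n \<in> D" and "\<And>e. e > 0 \<Longrightarrow> \<exists>N. \<forall>m\<ge>N. \<forall>n\<ge>N. nrm (x m - x n) < e"
  shows "\<exists>l\<in>D. (\<lambda>n. nrm (x n - l)) \<longlonglongrightarrow> 0"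
proof -
  have "\<exists>N. \<forall>m\<ge>N. \<forall>n\<ge>N. Re (ip (x m - x n) (x m - x n)) < e" if "e > 0" for e
  proof -
    have "sqrt e > 0" using that by simp
    from assms(2)[OF this] show ?thesis by (simp add: nrm_def)
  qed
  then obtain l where "l \<in> D" "(\<lambda>n. Re (ip (x n - l) (x n - l))) \<longlonglongrightarrow> 0"
    using complete[of x] assms(1) by blast
  moreover have "(\<lambda>n. sqrt (Re (ip (x n - l) (x n - l)))) \<longlonglongrightarrow> sqrt 0"
    by (intro tendsto_intros calculation)
  ultimately show ?thesis by (auto simp: nrm_def[abs_def])
qed

text \<open>Midpoints stay in \<open>Y\<close>, so by the parallelogram law a sequence minimizing
  the distance is Cauchy; its limit is a minimizer, and the error vector of a minimizer is
  orthogonal to \<open>Y\<close>.\<close>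

lemma projection:
  assumes Y: "csubspace Y" "Y \<subseteq> D" "nrm_closed Y" and x: "x \<in> D"
  shows "\<exists>p\<in>Y. \<forall>v\<in>Y. ip (x - p) v = 0"
proof -
  define S where "S = (\<lambda>y. (nrm (x - y))\<^sup>2) ` Y"
  define d where "d = Inf S"
  have S0: "S \<noteq> {}" using Y(1) by (auto simp: S_def csubspace_def)
  have bdd: "bdd_below S" by (auto simp: S_def intro!: bdd_belowI[of _ 0])
  have d_le: "d \<le> (nrm (x - y))\<^sup>2" if "y \<in> Y" for y
    unfolding d_def by (rule cInf_lower[OF _ bdd]) (auto simp: S_def that)
  have "\<exists>y\<in>Y. (nrm (x - y))\<^sup>2 < d + 1 / Suc n" for n
    using cInf_lessD[OF S0, of "d + 1 / Suc n"] by (force simp: S_def d_def)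
  then obtain y where yY: "\<And>n. y n \<in> Y" and y: "\<And>n. (nrm (x - y n))\<^sup>2 < d + 1 / Suc n" by metis
  have yD: "y n \<in> D" for n using yY Y by blast
  have est: "(nrm (y m - y n))\<^sup>2 < 2 / Suc m + 2 / Suc n" for m n
  proof -
    have mid: "(1/2) *\<^sub>R (y m + y n) \<in> Y"
      using Y(1) yY scaleC_of_real[of "1/2" "y m + y n"] unfolding csubspace_def by metis
    have "(x - y n) + (x - y m) = 2 *\<^sub>R (x - (1/2) *\<^sub>R (y m + y n))"
      by (simp add: algebra_simps scaleR_2)
    then have "nrm ((x - y n) + (x - y m)) = 2 * nrm (x - (1/2) *\<^sub>R (y m + y n))"
      using nrm_scaleR[of "x - (1/2) *\<^sub>R (y m + y n)" 2] x yD by simp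
    then have "4 * d \<le> (nrm ((x - y n) + (x - y m)))\<^sup>2"
      using d_le[OF mid] by (simp add: power_mult_distrib)
    moreover have "(nrm (y m - y n))\<^sup>2 = 2 * (nrm (x - y n))\<^sup>2 + 2 * (nrm (x - y m))\<^sup>2
        - (nrm ((x - y n) + (x - y m)))\<^sup>2"
      using parallelogram[of "x - y n" "x - y m"] x yD by simp
    ultimately show ?thesis using y[of m] y[of n] by simp
  qed
  have "\<exists>N. \<forall>m\<ge>N. \<forall>n\<ge>N. nrm (y m - y n) < e" if e: "e > 0" for e
  proof -
    obtain N :: nat where N: "4 / e\<^sup>2 < real N" using reals_Archimedean2 by blast
    have "nrm (y m - y n) < e" if "m \<ge> N" "n \<ge> N" for m n
    proof -
      have *: "2 / Suc k \<le> e\<^sup>2 / 2" if "k \<ge> N" for k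
      proof -
        have "4 / e\<^sup>2 \<le> Suc k" using N that by linarith
        then show ?thesis using e by (simp add: field_simps)
      qed
      have "(nrm (y m - y n))\<^sup>2 < e\<^sup>2" using est[of m n] *[OF that(1)] *[OF that(2)] by linarith
      then show ?thesis using e by (simp add: power_less_imp_less_base)
    qed
    then show ?thesis by blast
  qed
  then obtain p where pD: "p \<in> D" and p: "(\<lambda>n. nrm (y n - p)) \<longlonglongrightarrow> 0"
    using complete_nrm[of y] yD by blast
  have pY: "p \<in> Y" using Y(3) yY pD p unfolding nrm_closed_def by blast
  have "(\<lambda>n. sqrt (d + 1 / Suc n) + nrm (y n - p)) \<longlonglongrightarrow> sqrt (d + 0) + 0"
    by (intro tendsto_intros p LIMSEQ_Suc[OF lim_1_over_n])
  moreover have "nrm (x - p) \<le> sqrt (d + 1 / Suc n) + nrm (y n - p)" for n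
    using nrm_diff_triangle[of x "y n" p] real_less_rsqrt[OF y[of n]] x yD pD by simp
  ultimately have "nrm (x - p) \<le> sqrt d"
    by (intro LIMSEQ_le_const) auto
  also have "sqrt d \<le> nrm (x - v)" if "v \<in> Y" for v
    using d_le[OF that] that Y x by (intro real_le_lsqrt) auto
  finally have le: "nrm (x - p) \<le> nrm (x - v)" if "v \<in> Y" for v using that by blast
  have "ip (x - p) v = 0" if v: "v \<in> Y" for v
  proof (rule minimal_orthogonal)
    fix c
    have "p + c *\<^sub>C v \<in> Y" using pY v Y(1) unfolding csubspace_def by blast
    from le[OF this] show "nrm (x - p) \<le> nrm (x - p - c *\<^sub>C v)" by (simp add: diff_diff_add)
  next
    show "x - p \<in> D" "v \<in> D" using diff_mem[OF x pD] v Y(2) by blast+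
  qed
  then show ?thesis using pY by blast
qed

text \<open>The kernel of \<open>f\<close> is closed, so a vector outside it has a nonzero component
  \<open>e\<close> orthogonal to it. Every \<open>x\<close> differs from a multiple of
  \<open>e\<close> by a kernel vector, and \<open>f\<close> is a multiple of pairing with
  \<open>e\<close>.\<close>

lemma Riesz:
  assumes add: "\<And>x y. x \<in> D \<Longrightarrow> y \<in> D \<Longrightarrow> f (x + y) = f x + f y"
    and scale: "\<And>c x. x \<in> D \<Longrightarrow> f (c *\<^sub>C x) = c * f x"
    and bd: "\<And>x. x \<in> D \<Longrightarrow> cmod (f x) \<le> K * nrm x"
  shows "\<exists>w\<in>D. \<forall>x\<in>D. f x = ip x w"
proof (cases "\<forall>x\<in>D. f x = 0")
  case True then show ?thesis by (intro bexI[of _ 0]) auto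
next
  case False
  then obtain x0 where x0: "x0 \<in> D" "f x0 \<noteq> 0" by blast
  have f0: "f 0 = 0" using scale[of 0 0] by simp
  have fdiff: "f (x - y) = f x - f y" if "x \<in> D" "y \<in> D" for x y
    unfolding diff_conv_scaleC[of x y] using that by (simp add: add scale)
  define Y where "Y = {x\<in>D. f x = 0}"
  have Y: "csubspace Y" unfolding csubspace_def Y_def using f0 add scale by auto
  have "nrm_closed Y" unfolding nrm_closed_def
  proof (intro allI impI)
    fix x l assume x: "\<forall>n. x n \<in> Y" and l: "l \<in> D" and lim: "(\<lambda>n. nrm (x n - l)) \<longlonglongrightarrow> 0"
    have "cmod (f l) \<le> K * nrm (x n - l)" for n
      using fdiff[of "x n" l] bd[of "x n - l"] x l by (simp add: Y_def)
    moreover have "(\<lambda>n. K * nrm (x n - l)) \<longlonglongrightarrow> K * 0" by (intro tendsto_intros lim)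
    ultimately have "cmod (f l) \<le> K * 0" by (intro LIMSEQ_le_const) auto
    then show "l \<in> Y" using l by (simp add: Y_def)
  qed
  then obtain p where p: "p \<in> Y" "\<And>v. v \<in> Y \<Longrightarrow> ip (x0 - p) v = 0"
    using projection[OF Y _ _ x0(1)] by (auto simp: Y_def)
  define e where "e = x0 - p"
  have eD: "e \<in> D" and fe: "f e \<noteq> 0" using p(1) x0 fdiff[of x0 p] by (auto simp: e_def Y_def)
  have e0: "e \<noteq> 0" using fe f0 by auto
  have ee: "ip e e \<noteq> 0" using diag_nrm[OF eD] nrm_pos[OF eD e0] by simp
  have ve: "ip v e = 0" if "v \<in> Y" for v
    using p(2)[OF that] swap[of e v] eD that by (simp add: e_def Y_def)
  have "f x = ip x (cnj (f e / ip e e) *\<^sub>C e)" if x: "x \<in> D" for x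
  proof -
    have "x - (f x / f e) *\<^sub>C e \<in> Y" using x eD fe scale[of e] by (auto simp: Y_def fdiff)
    from ve[OF this] have 1: "ip x e = (f x / f e) * ip e e" using x eD by simp
    have "ip x (cnj (f e / ip e e) *\<^sub>C e) = f e / ip e e * ip x e"
      using scaleC_right[OF x eD, of "cnj (f e / ip e e)"] by (simp only: complex_cnj_cnj)
    also have "\<dots> = f x" unfolding 1 using fe ee by (simp add: field_simps)
    finally show ?thesis ..
  qed
  then show ?thesis using scaleC_mem[OF eD] by blast
qed

text \<open>A diagonal argument only needs the countable test set \<open>range x\<close>: the test
  vectors with convergent coefficients form a closed subspace, and what is orthogonal to it pairs to
  0 with every member of the sequence.\<close>

lemma weak_compactness:
  assumes xD: "\<And>n. x n \<in> D" and M: "\<And>n. nrm (x n) \<le> M"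
  shows "\<exists>r l. strict_mono (r::nat\<Rightarrow>nat) \<and> l \<in> D \<and> (\<forall>y\<in>D. (\<lambda>n. ip (x (r n)) y) \<longlonglongrightarrow> ip l y)"
proof -
  have M0: "M \<ge> 0" using nrm_nonneg[OF xD[of 0]] M[of 0] by linarith
  have bd: "cmod (ip (x n) y) \<le> M * nrm y" if "y \<in> D" for n y
    using Cauchy_Schwarz[OF xD that, of n] mult_right_mono[OF M[of n] nrm_nonneg[OF that]] by linarith
  have MM: "cmod (ip (x n) y) \<le> M * M" if "y \<in> range x" for n y
  proof -
    obtain k where "y = x k" using \<open>y \<in> range x\<close> by blast
    then show ?thesis using bd[OF xD[of k], of n] mult_left_mono[OF M[of k] M0] by simp
  qed
  obtain r where r: "strict_mono (r::nat\<Rightarrow>nat)"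
    and conv: "\<And>y. y \<in> range x \<Longrightarrow> \<exists>l. (\<lambda>n. ip (x (r n)) y) \<longlonglongrightarrow> l"
  proof (rule function_convergent_subsequence[of "range x" "\<lambda>n y. ip (x n) y" "M * M"])
    show "cmod (ip (x n) y) \<le> M * M" if "y \<in> range x" for n y using MM that .
    fix k assume "strict_mono k" "\<And>y. y \<in> range x \<Longrightarrow> \<exists>l. (\<lambda>n. ip (x (k n)) y) \<longlonglongrightarrow> l"
    then show thesis by (rule that)
  qed simp
  define Y where "Y = {y\<in>D. convergent (\<lambda>n. ip (x (r n)) y)}"
  have Y: "csubspace Y" unfolding csubspace_def
  proof (intro conjI ballI allI)
    show "0 \<in> Y" using xD by (simp add: Y_def convergent_const)
    fix u v assume "u \<in> Y" "v \<in> Y"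
    then show "u + v \<in> Y" using xD by (auto simp: Y_def intro: convergent_add)
  next
    fix c u assume "u \<in> Y"
    then show "c *\<^sub>C u \<in> Y" using xD
      by (auto simp: Y_def convergent_def intro!: tendsto_mult_left)
  qed
  have "nrm_closed Y" unfolding nrm_closed_def
  proof (intro allI impI)
    fix y l assume y: "\<forall>n. y n \<in> Y" and l: "l \<in> D" and lim: "(\<lambda>n. nrm (y n - l)) \<longlonglongrightarrow> 0"
    have "Cauchy (\<lambda>n. ip (x (r n)) l)"
    proof (rule metric_CauchyI)
      fix e :: real assume e: "e > 0"
      \<comment> \<open>\<open>M + 1\<close> keeps the denominator positive when
        \<open>M = 0\<close>; the thirds serve the triangle inequality through the approximant
        \<open>y k\<close>.\<close>
      have "e / (3 * (M + 1)) > 0" using e M0 by simp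
      from LIMSEQ_D[OF lim this] obtain k where k: "nrm (y k - l) < e / (3 * (M + 1))"
        using y l by (fastforce simp: Y_def)
      have yk: "y k \<in> D" using y by (auto simp: Y_def)
      have "Cauchy (\<lambda>n. ip (x (r n)) (y k))" using y by (auto simp: Y_def intro: convergent_Cauchy)
      then obtain N where N: "\<And>m n. m \<ge> N \<Longrightarrow> n \<ge> N \<Longrightarrow> dist (ip (x (r m)) (y k)) (ip (x (r n)) (y k)) < e/3"
        using metric_CauchyD[of _ "e/3"] e by (metis divide_pos_pos zero_less_numeral)
      have close: "dist (ip (x (r n)) (y k)) (ip (x (r n)) l) < e/3" for n
      proof -
        have "dist (ip (x (r n)) (y k)) (ip (x (r n)) l) \<le> M * nrm (y k - l)"
          unfolding dist_norm using bd[of "y k - l" "r n"] yk l xD by simp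
        also have "\<dots> \<le> (M + 1) * nrm (y k - l)" using yk l by (intro mult_right_mono) auto
        also have "\<dots> < e/3" using k M0 e by (simp add: field_simps)
        finally show ?thesis .
      qed
      have "dist (ip (x (r m)) l) (ip (x (r n)) l) < e" if "m \<ge> N" "n \<ge> N" for m n
        using N[OF that] close[of m] close[of n] dist_commute[of "ip (x (r n)) (y k)"]
          dist_triangle[of "ip (x (r m)) l" "ip (x (r n)) l" "ip (x (r m)) (y k)"]
          dist_commute[of "ip (x (r m)) (y k)"]
          dist_triangle[of "ip (x (r m)) (y k)" "ip (x (r n)) l" "ip (x (r n)) (y k)"]
        by (metis add_strict_mono dist_triangle_third)
      then show "\<exists>N. \<forall>m\<ge>N. \<forall>n\<ge>N. dist (ip (x (r m)) l) (ip (x (r n)) l) < e" by blast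
    qed
    then show "l \<in> Y" using l by (simp add: Y_def Cauchy_convergent)
  qed
  have xY: "x n \<in> Y" for n using conv[of "x n"] xD by (auto simp: Y_def convergent_def)
  have "Y = D"
  proof
    show "D \<subseteq> Y"
    proof
      fix y assume yD: "y \<in> D"
      obtain p where p: "p \<in> Y" "\<forall>v\<in>Y. ip (y - p) v = 0"
        using projection[OF Y _ \<open>nrm_closed Y\<close> yD] by (auto simp: Y_def)
      have pD: "p \<in> D" using p by (simp add: Y_def)
      \<comment> \<open>The remainder \<open>y - p\<close> is invisible to the whole sequence, so
        \<open>y\<close> has the same coefficients as its projection \<open>p\<close>, where they
        converge.\<close>
      have "ip (x n) (y - p) = 0" for n
        using bspec[OF p(2) xY[of n]] swap[OF diff_mem[OF yD pD] xD[of n]] by (simp del: diff_left diff_right)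
      then have "ip (x n) y = ip (x n) p" for n using yD pD xD by simp
      then show "y \<in> Y" using p(1) yD by (simp add: Y_def)
    qed
  qed (auto simp: Y_def)
  \<comment> \<open>The sequence sits in the second argument so that the limit functional is linear
    and \<open>Riesz\<close> applies; conjugation restores the order of the claim.\<close>
  define f where "f y = lim (\<lambda>n. ip y (x (r n)))" for y
  have f: "(\<lambda>n. ip y (x (r n))) \<longlonglongrightarrow> f y" if "y \<in> D" for y
  proof -
    have "y \<in> Y" using that \<open>Y = D\<close> by simp
    then obtain l where "(\<lambda>n. ip (x (r n)) y) \<longlonglongrightarrow> l" by (auto simp: Y_def convergent_def)
    from tendsto_cnj[OF this] have "convergent (\<lambda>n. ip y (x (r n)))"
      unfolding swap[OF that xD] complex_cnj_cnj convergent_def by blast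
    then show ?thesis unfolding f_def by (rule convergent_LIMSEQ_iff[THEN iffD1])
  qed
  have "\<exists>w\<in>D. \<forall>y\<in>D. f y = ip y w"
  proof (rule Riesz)
    fix u v assume uv: "u \<in> D" "v \<in> D"
    have "(\<lambda>n. ip u (x (r n)) + ip v (x (r n))) \<longlonglongrightarrow> f u + f v"
      by (intro tendsto_add f uv)
    then show "f (u + v) = f u + f v"
      using f[of "u + v"] uv xD LIMSEQ_unique by force
  next
    fix c u assume u: "u \<in> D"
    have "(\<lambda>n. c * ip u (x (r n))) \<longlonglongrightarrow> c * f u"
      by (intro tendsto_mult_left f u)
    then show "f (c *\<^sub>C u) = c * f u"
      using f[of "c *\<^sub>C u"] u xD LIMSEQ_unique by force
  next
    fix u assume u: "u \<in> D"
    have "cmod (ip u (x n)) \<le> M * nrm u" for n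
      using bd[OF u, of n] swap[of u "x n"] u xD by simp
    then show "cmod (f u) \<le> M * nrm u"
      by (intro LIMSEQ_le_const2[OF tendsto_norm[OF f[OF u]]]) auto
  qed
  then obtain w where w: "w \<in> D" "\<And>y. y \<in> D \<Longrightarrow> f y = ip y w" by blast
  have "(\<lambda>n. ip (x (r n)) y) \<longlonglongrightarrow> ip w y" if "y \<in> D" for y
    using tendsto_cnj[OF f[OF that]] unfolding w(2)[OF that] swap[OF that w(1)] swap[OF that xD] .
  then show ?thesis using r w(1) by blast
qed

end


section \<open>The ambient inner product as an instance\<close>

interpretation cinner: hilbert_form UNIV cinner
proof
  show "(norm x)\<^sup>2 \<le> Re (cinner x x)" for x :: 'a
    by (simp add: cinner_self)
  fix x :: "nat \<Rightarrow> 'a"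
  assume *: "\<And>e. e > 0 \<Longrightarrow> \<exists>N. \<forall>m\<ge>N. \<forall>n\<ge>N. Re (cinner (x m - x n) (x m - x n)) < e"
  have "Cauchy x"
  proof (rule CauchyI)
    fix e :: real assume e: "e > 0"
    then have "0 < e\<^sup>2" by simp
    from *[OF this] obtain N where N: "\<And>m n. m \<ge> N \<Longrightarrow> n \<ge> N \<Longrightarrow> (norm (x m - x n))\<^sup>2 < e\<^sup>2"
      by (auto simp: cinner_self simp del: cinner.diff_left cinner.diff_right)
    show "\<exists>M. \<forall>m\<ge>M. \<forall>n\<ge>M. norm (x m - x n) < e"
      using power_less_imp_less_base[OF N] e by (meson less_imp_le)
  qed
  then obtain l where "x \<longlonglongrightarrow> l" using Cauchy_convergent convergentD by blast
  then have "(\<lambda>n. (norm (x n - l))\<^sup>2) \<longlonglongrightarrow> 0\<^sup>2"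
    by (intro tendsto_power) (simp add: LIM_zero tendsto_norm_zero)
  then show "\<exists>l\<in>UNIV. (\<lambda>n. Re (cinner (x n - l) (x n - l))) \<longlonglongrightarrow> 0"
    by (intro bexI[of _ l]) (simp_all add: cinner_self del: cinner.diff_left cinner.diff_right)
qed

lemma cinner_nrm [simp]: "cinner.nrm x = norm x"
  by (simp add: cinner.nrm_def cinner_self)

lemma cinner_le: "cmod (cinner x y) \<le> norm x * norm y"
  using cinner.Cauchy_Schwarz[of x y] by simp

lemma tendsto_cinner_right:
  assumes "(\<lambda>n. norm (x n - l)) \<longlonglongrightarrow> 0" shows "(\<lambda>n. cinner w (x n)) \<longlonglongrightarrow> cinner w l"
proof (rule LIM_zero_cancel, rule Lim_null_comparison)
  show "\<forall>\<^sub>F n in sequentially. norm (cinner w (x n) - cinner w l) \<le> norm w * norm (x n - l)"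
    using cinner_le[of w "x _ - l"] by simp
  show "(\<lambda>n. norm w * norm (x n - l)) \<longlonglongrightarrow> 0" using tendsto_mult_right_zero[OF assms] .
qed

lemma tendsto_cinner_left:
  assumes "(\<lambda>n. norm (x n - l)) \<longlonglongrightarrow> 0" shows "(\<lambda>n. cinner (x n) w) \<longlonglongrightarrow> cinner l w"
  using tendsto_cnj[OF tendsto_cinner_right[OF assms]] by (simp add: cinner_commute[symmetric])

section \<open>Uniform boundedness\<close>

context hilbert_form
begin

text \<open>A Baire argument by nested balls: if no constant works, every ball contains a smaller
  one on which \<open>p\<close> exceeds a prescribed bound. By completeness the balls have a common
  point, where \<open>p\<close> would exceed every natural number.\<close>

lemma lsc_seminorm_bounded:
  assumes sub: "\<And>x y. x \<in> D \<Longrightarrow> y \<in> D \<Longrightarrow> p (x + y) \<le> p x + p y"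
    and scale: "\<And>r x. x \<in> D \<Longrightarrow> p (r *\<^sub>R x) \<le> \<bar>r\<bar> * p x"
    and lsc: "\<And>x b. x \<in> D \<Longrightarrow> b < p x \<Longrightarrow> \<exists>e>0. \<forall>y\<in>D. nrm (y - x) < e \<longrightarrow> b < p y"
  shows "\<exists>C. \<forall>x\<in>D. p x \<le> C * nrm x"
proof (rule ccontr)
  assume "\<not> ?thesis"
  then have unbdd: "\<exists>x\<in>D. C * nrm x < p x" for C by (meson not_le)
  have p0: "p 0 \<le> 0" using scale[of 0 0] by simp
  \<comment> \<open>A vector \<open>u\<close> of norm e/4 with \<open>p u > b\<close> exists by
    unboundedness. Since 2u is the difference of \<open>S + u\<close> and \<open>S - u\<close>,
    subadditivity makes \<open>p\<close> exceed b at one of these, and lower semicontinuity keeps it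
    so on a ball.\<close>
  have step: "\<exists>S' e'. S' \<in> D \<and> e' > 0 \<and> nrm (S' - S) \<le> e / 4 \<and> e' \<le> e / 2 \<and>
      (\<forall>y\<in>D. nrm (y - S') < e' \<longrightarrow> b < p y)" if S: "S \<in> D" and e: "e > 0" for S e b
  proof -
    obtain x where x: "x \<in> D" "4 * \<bar>b\<bar> / e * nrm x < p x" using unbdd by blast
    have "0 \<le> 4 * \<bar>b\<bar> / e * nrm x" using e x(1) by simp
    then have "x \<noteq> 0" using x p0 by auto
    then have n: "nrm x > 0" using nrm_pos x by blast
    define r where "r = e / (4 * nrm x)"
    have r: "r > 0" using e n by (simp add: r_def)
    define u where "u = r *\<^sub>R x"
    have u: "u \<in> D" "nrm u = e / 4" using x n e by (auto simp: u_def nrm_scaleR r_def)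
    have "p x \<le> p u / r" using scale[OF u(1), of "1 / r"] r by (simp add: u_def)
    moreover have "4 * \<bar>b\<bar> / e * nrm x = \<bar>b\<bar> / r" using n e by (simp add: r_def)
    ultimately have "\<bar>b\<bar> / r < p u / r" using x(2) by linarith
    then have "b < p u" using r by (simp add: divide_less_cancel)
    moreover have "2 *\<^sub>R u = (S + u) + (-1) *\<^sub>R (S - u)" by (simp add: scaleR_2)
    then have "p (2 *\<^sub>R u) \<le> p (S + u) + p (S - u)"
      using sub[of "S + u" "(-1) *\<^sub>R (S - u)"] scale[of "S - u" "-1"] S u by simp
    moreover have "2 * p u \<le> p (2 *\<^sub>R u)"
      using scale[of "2 *\<^sub>R u" "1/2"] u by simp
    ultimately have "b < p (S + u) \<or> b < p (S - u)" by linarith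
    moreover have "nrm (S + u - S) = e / 4" using u by simp
    moreover have "nrm (S - u - S) = e / 4" using u nrm_scaleR[of u "-1"] by simp
    ultimately obtain S' where S': "S' \<in> D" "nrm (S' - S) = e / 4" "b < p S'"
      using S u by (metis add_mem diff_mem)
    obtain e0 where e0: "e0 > 0" "\<forall>y\<in>D. nrm (y - S') < e0 \<longrightarrow> b < p y"
      using lsc[OF S'(1,3)] by blast
    show ?thesis using S' e0 e by (intro exI[of _ S'] exI[of _ "min e0 (e / 2)"]) auto
  qed
  have "\<exists>f. \<forall>n. (fst (f n) \<in> D \<and> snd (f n) > 0) \<and>
      (nrm (fst (f (Suc n)) - fst (f n)) \<le> snd (f n) / 4 \<and> snd (f (Suc n)) \<le> snd (f n) / 2 \<and>
       (\<forall>y\<in>D. nrm (y - fst (f (Suc n))) < snd (f (Suc n)) \<longrightarrow> real n < p y))"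
  proof (rule dependent_nat_choice)
    show "\<exists>x. fst x \<in> D \<and> snd x > (0::real)" by (rule exI[of _ "(0, 1)"]) simp
    fix x :: "'a \<times> real" and n assume "fst x \<in> D \<and> 0 < snd x"
    then show "\<exists>y. (fst y \<in> D \<and> 0 < snd y) \<and> nrm (fst y - fst x) \<le> snd x / 4 \<and>
      snd y \<le> snd x / 2 \<and> (\<forall>z\<in>D. nrm (z - fst y) < snd y \<longrightarrow> real n < p z)"
      using step[of "fst x" "snd x" "real n"] by fastforce
  qed
  then obtain f where f: "\<And>n. fst (f n) \<in> D" "\<And>n. snd (f n) > 0"
      "\<And>n. nrm (fst (f (Suc n)) - fst (f n)) \<le> snd (f n) / 4"
      "\<And>n. snd (f (Suc n)) \<le> snd (f n) / 2"
      "\<And>n y. y \<in> D \<Longrightarrow> nrm (y - fst (f (Suc n))) < snd (f (Suc n)) \<Longrightarrow> real n < p y" by blast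
  define S e where "S = (\<lambda>n. fst (f n))" and "e = (\<lambda>n. snd (f n))"
  have SD: "S n \<in> D" and e0: "e n > 0" and S1: "nrm (S (Suc n) - S n) \<le> e n / 4"
    and e1: "e (Suc n) \<le> e n / 2" for n
    using f by (auto simp: S_def e_def)
  \<comment> \<open>The summand e/2 is the distance still to be travelled: a move costs at most e/4
    and the radius then at least halves, so the sum never grows.\<close>
  have near: "nrm (S (n + k) - S n) + e (n + k) / 2 \<le> e n / 2" for n k
  proof (induction k)
    case 0 then show ?case by simp
  next
    case (Suc k)
    have "nrm (S (n + Suc k) - S n) \<le> nrm (S (Suc (n + k)) - S (n + k)) + nrm (S (n + k) - S n)"
      using nrm_diff_triangle[OF SD SD SD] by simp
    then show ?case using Suc S1[of "n + k"] e1[of "n + k"] by simp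
  qed
  have near': "nrm (S m - S n) \<le> e n / 2" if "m \<ge> n" for m n
    using near[of n "m - n"] e0[of m] that by simp
  have epow: "e n \<le> e 0 * (1/2) ^ n" for n
  proof (induction n)
    case (Suc n) then show ?case using e1[of n] by simp
  qed simp
  have "(\<lambda>n. e 0 * (1/2) ^ n) \<longlonglongrightarrow> e 0 * 0" by (intro tendsto_intros LIMSEQ_realpow_zero) auto
  then have elim: "\<exists>N. e N < d" if "d > 0" for d
  proof -
    have "\<forall>\<^sub>F n in sequentially. e 0 * (1/2) ^ n < d"
      using order_tendstoD(2)[OF \<open>(\<lambda>n. e 0 * (1/2) ^ n) \<longlonglongrightarrow> e 0 * 0\<close>, of d] that by simp
    then obtain n where "e 0 * (1/2) ^ n < d" using eventually_happens by force
    then show ?thesis using epow[of n] by (intro exI[of _ n]) linarith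
  qed
  have "\<exists>N. \<forall>m\<ge>N. \<forall>n\<ge>N. nrm (S m - S n) < d" if d: "d > 0" for d
  proof -
    obtain N where N: "e N < d" using elim d by blast
    have "nrm (S m - S n) < d" if "m \<ge> N" "n \<ge> N" for m n
      using nrm_diff_triangle[OF SD[of m] SD[of N] SD[of n]] near'[OF that(1)] near'[OF that(2)]
        nrm_minus_commute[OF SD[of N] SD[of n]] N by linarith
    then show ?thesis by blast
  qed
  then obtain l where l: "l \<in> D" "(\<lambda>n. nrm (S n - l)) \<longlonglongrightarrow> 0" using complete_nrm SD by blast
  \<comment> \<open>The limit lies within half the radius of each centre, hence strictly inside each
    ball. The ball with index n + 1 carries the bound n.\<close>
  have "real n < p l" for n
  proof -
    let ?n = "Suc n"
    have "(\<lambda>m. nrm (S m - l) + e ?n / 2) \<longlonglongrightarrow> 0 + e ?n / 2" by (intro tendsto_intros l)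
    moreover have "\<forall>m\<ge>?n. nrm (l - S ?n) \<le> nrm (S m - l) + e ?n / 2"
    proof (intro allI impI)
      fix m assume "?n \<le> m"
      then show "nrm (l - S ?n) \<le> nrm (S m - l) + e ?n / 2"
        using nrm_diff_triangle[OF l(1) SD[of m] SD[of ?n]] near'[of ?n m]
          nrm_minus_commute[OF l(1) SD[of m]] by linarith
    qed
    ultimately have "nrm (l - S ?n) \<le> 0 + e ?n / 2" by (intro LIMSEQ_le_const) blast+
    then have "nrm (l - S ?n) < e ?n" using e0[of ?n] by linarith
    then show ?thesis using f(5)[OF l(1), of n] by (simp add: S_def e_def)
  qed
  then show False using reals_Archimedean2[of "p l"] less_asym by blast
qed

text \<open>A pointwise supremum of bounded seminorms is a lower semicontinuous seminorm, to which
  the Baire argument applies.\<close>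

lemma uniform_boundedness:
  assumes sub: "\<And>i x y. i \<in> I \<Longrightarrow> x \<in> D \<Longrightarrow> y \<in> D \<Longrightarrow> T i (x + y) \<le> T i x + T i y"
    and scale: "\<And>i r x. i \<in> I \<Longrightarrow> x \<in> D \<Longrightarrow> T i (r *\<^sub>R x) \<le> \<bar>r\<bar> * (T i x :: real)"
    and bdd: "\<And>i. i \<in> I \<Longrightarrow> \<exists>C. \<forall>x\<in>D. T i x \<le> C * nrm x"
    and pointwise: "\<And>x. x \<in> D \<Longrightarrow> \<exists>B. \<forall>i\<in>I. T i x \<le> B"
  shows "\<exists>C. \<forall>i\<in>I. \<forall>x\<in>D. T i x \<le> C * nrm x"
proof (cases "I = {}")
  case False
  define p where "p x = (SUP i\<in>I. T i x)" for x
  have up: "T i x \<le> p x" if "i \<in> I" "x \<in> D" for i x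
  proof -
    obtain B where "\<forall>i\<in>I. T i x \<le> B" using pointwise[OF \<open>x \<in> D\<close>] by blast
    then have "bdd_above ((\<lambda>i. T i x) ` I)" by (intro bdd_aboveI2) auto
    then show ?thesis unfolding p_def using \<open>i \<in> I\<close> by (rule cSUP_upper[rotated])
  qed
  have "\<exists>C. \<forall>x\<in>D. p x \<le> C * nrm x"
  proof (rule lsc_seminorm_bounded)
    fix x y assume xy: "x \<in> D" "y \<in> D"
    show "p (x + y) \<le> p x + p y"
      unfolding p_def[of "x + y"]
    proof (rule cSUP_least[OF False])
      fix i assume "i \<in> I"
      then show "T i (x + y) \<le> p x + p y" using sub[of i x y] up[of i x] up[of i y] xy by linarith
    qed
  next
    fix r x assume x: "x \<in> D"
    show "p (r *\<^sub>R x) \<le> \<bar>r\<bar> * p x"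
      unfolding p_def[of "r *\<^sub>R x"]
    proof (rule cSUP_least[OF False])
      fix i assume "i \<in> I"
      then show "T i (r *\<^sub>R x) \<le> \<bar>r\<bar> * p x"
        using scale[of i x r] mult_left_mono[OF up[of i x], of "\<bar>r\<bar>"] x by linarith
    qed
  next
    fix x b assume x: "x \<in> D" and "b < p x"
    then obtain i where i: "i \<in> I" "b < T i x"
      unfolding p_def using less_cSUP_iff[OF False] pointwise[OF x] by (metis bdd_aboveI2)
    obtain C where C: "\<And>x. x \<in> D \<Longrightarrow> T i x \<le> C * nrm x" using bdd[OF i(1)] by blast
    \<comment> \<open>Within this distance the single seminorm \<open>T i\<close> changes by less
      than \<open>T i x - b\<close>; adding 1 avoids division by 0 if \<open>C = 0\<close>.\<close>
    define e where "e = (T i x - b) / (\<bar>C\<bar> + 1)"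
    have "b < p y" if y: "y \<in> D" "nrm (y - x) < e" for y
    proof -
      have "T i x \<le> T i y + T i (x - y)" using sub[of i y "x - y"] i x y by simp
      moreover have "T i (x - y) \<le> C * nrm (x - y)" using C x y by simp
      moreover have "C * nrm (x - y) \<le> (\<bar>C\<bar> + 1) * nrm (y - x)"
        using nrm_minus_commute[OF x y(1)] x y by (intro mult_mono) auto
      moreover have "(\<bar>C\<bar> + 1) * nrm (y - x) < T i x - b"
        using y(2) by (simp add: e_def field_simps)
      ultimately show ?thesis using up[OF i(1) y(1)] by linarith
    qed
    moreover have "e > 0" using i by (simp add: e_def add_nonneg_pos)
    ultimately show "\<exists>e>0. \<forall>y\<in>D. nrm (y - x) < e \<longrightarrow> b < p y" by blast
  qed
  then show ?thesis using up by (meson order_trans)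
qed simp

text \<open>Uniform boundedness is used twice: in \<open>x\<close> with \<open>y\<close> fixed, then
  in \<open>y\<close> for the family indexed by pairs of an index and a vector of the unit
  ball.\<close>

lemma uniform_boundedness_sesquilinear:
  assumes sesq: "\<And>i. i \<in> I \<Longrightarrow> sesquilinear_on D (q i)"
    and bdd: "\<And>i. i \<in> I \<Longrightarrow> \<exists>C. \<forall>x\<in>D. \<forall>y\<in>D. cmod (q i x y) \<le> C * nrm x * nrm y"
    and pointwise: "\<And>x y. x \<in> D \<Longrightarrow> y \<in> D \<Longrightarrow> \<exists>B. \<forall>i\<in>I. cmod (q i x y) \<le> B"
  shows "\<exists>K\<ge>0. \<forall>i\<in>I. \<forall>x\<in>D. \<forall>y\<in>D. cmod (q i x y) \<le> K * nrm x * nrm y"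
proof -
  have S: "sesquilinear D (q i)" if "i \<in> I" for i using sesq[OF that] by unfold_locales
  have 1: "\<exists>C. \<forall>i\<in>I. \<forall>x\<in>D. cmod (q i x y) \<le> C * nrm x" if y: "y \<in> D" for y
  proof (rule uniform_boundedness)
    fix i x x' assume i: "i \<in> I" "x \<in> D" "x' \<in> D"
    show "cmod (q i (x + x') y) \<le> cmod (q i x y) + cmod (q i x' y)"
      using i y by (simp add: sesquilinear.add_left[OF S] norm_triangle_ineq)
  next
    fix i r x assume i: "i \<in> I" "x \<in> D"
    show "cmod (q i (r *\<^sub>R x) y) \<le> \<bar>r\<bar> * cmod (q i x y)"
      using i y by (simp add: sesquilinear.scaleR_left[OF S] norm_mult)
  next
    fix i assume "i \<in> I"
    then obtain C where "\<forall>x\<in>D. \<forall>y\<in>D. cmod (q i x y) \<le> C * nrm x * nrm y" using bdd by blast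
    then show "\<exists>C. \<forall>x\<in>D. cmod (q i x y) \<le> C * nrm x"
      using y by (intro exI[of _ "C * nrm y"]) (auto simp: mult_ac)
  qed (use pointwise y in auto)
  have "\<exists>C. \<forall>j \<in> I \<times> {x\<in>D. nrm x \<le> 1}. \<forall>y\<in>D. cmod (q (fst j) (snd j) y) \<le> C * nrm y"
  proof (rule uniform_boundedness)
    fix j y y' assume j: "j \<in> I \<times> {x\<in>D. nrm x \<le> 1}" "y \<in> D" "y' \<in> D"
    have "fst j \<in> I" "snd j \<in> D" using j by auto
    then show "cmod (q (fst j) (snd j) (y + y')) \<le> cmod (q (fst j) (snd j) y) + cmod (q (fst j) (snd j) y')"
      using j(2,3) by (simp add: sesquilinear.add_right[OF S] norm_triangle_ineq)
  next
    fix j y r assume j: "j \<in> I \<times> {x\<in>D. nrm x \<le> 1}" "y \<in> D"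
    have "fst j \<in> I" "snd j \<in> D" using j by auto
    then show "cmod (q (fst j) (snd j) (r *\<^sub>R y)) \<le> \<bar>r\<bar> * cmod (q (fst j) (snd j) y)"
      using j(2) by (simp add: sesquilinear.scaleR_right[OF S] norm_mult)
  next
    fix j assume j: "j \<in> I \<times> {x\<in>D. nrm x \<le> 1}"
    then obtain C where "\<forall>x\<in>D. \<forall>y\<in>D. cmod (q (fst j) x y) \<le> C * nrm x * nrm y"
      using bdd[of "fst j"] by auto
    then show "\<exists>C. \<forall>y\<in>D. cmod (q (fst j) (snd j) y) \<le> C * nrm y"
      using j by (intro exI[of _ "C * nrm (snd j)"]) auto
  next
    fix y assume y: "y \<in> D"
    obtain C where C: "\<forall>i\<in>I. \<forall>x\<in>D. cmod (q i x y) \<le> C * nrm x" using 1 y by blast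
    have "cmod (q (fst j) (snd j) y) \<le> \<bar>C\<bar>" if j: "j \<in> I \<times> {x\<in>D. nrm x \<le> 1}" for j
    proof -
      have "cmod (q (fst j) (snd j) y) \<le> C * nrm (snd j)" using C j by auto
      also have "\<dots> \<le> \<bar>C\<bar> * 1" using j by (intro mult_mono) auto
      finally show ?thesis by simp
    qed
    then show "\<exists>B. \<forall>j\<in>I \<times> {x\<in>D. nrm x \<le> 1}. cmod (q (fst j) (snd j) y) \<le> B" by blast
  qed
  then obtain K where K: "\<And>i x y. i \<in> I \<Longrightarrow> x \<in> D \<Longrightarrow> nrm x \<le> 1 \<Longrightarrow> y \<in> D \<Longrightarrow> cmod (q i x y) \<le> K * nrm y"
    by fastforce
  have "cmod (q i x y) \<le> \<bar>K\<bar> * nrm x * nrm y" if i: "i \<in> I" and x: "x \<in> D" and y: "y \<in> D" for i x y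
  proof (cases "x = 0")
    case True then show ?thesis using y by (simp add: sesquilinear.zero_left[OF S[OF i]])
  next
    case False
    have n: "nrm x > 0" using nrm_pos x False by blast
    have "cmod (q i ((1 / nrm x) *\<^sub>R x) y) \<le> K * nrm y"
      using n x y i by (intro K) (auto simp: nrm_scaleR)
    then have "cmod (q i x y) / nrm x \<le> K * nrm y"
      using x y n by (simp add: sesquilinear.scaleR_left[OF S[OF i]] norm_mult norm_divide)
    also have "\<dots> \<le> \<bar>K\<bar> * nrm y" using y by (intro mult_right_mono) auto
    finally show ?thesis using n by (simp add: field_simps)
  qed
  then show ?thesis by (intro exI[of _ "\<bar>K\<bar>"]) auto
qed

section \<open>Interplay of the form norm with the ambient norm\<close>

definition resolvent :: "'a \<Rightarrow> 'a" where
  "resolvent y = (SOME w. w \<in> D \<and> (\<forall>x\<in>D. cinner x y = ip x w))"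

text \<open>When \<open>ip\<close> is the form of T shifted by c, the vector obtained is (T + c)^-1
  y. Through it, pairing with an ambient vector becomes pairing in the form, which transfers weak
  convergence to the ambient space.\<close>

lemma resolvent: "resolvent y \<in> D \<and> (\<forall>x\<in>D. cinner x y = ip x (resolvent y))"
  unfolding resolvent_def
proof (rule someI_ex)
  have "\<exists>w\<in>D. \<forall>x\<in>D. cinner x y = ip x w"
  proof (rule Riesz)
    fix x assume "x \<in> D"
    then show "cmod (cinner x y) \<le> norm y * nrm x"
      using cinner_le[of x y] mult_left_mono[OF norm_le_nrm[of x], of "norm y"]
      by (metis mult.commute norm_ge_zero order_trans)
  qed simp_all
  then show "\<exists>w. w \<in> D \<and> (\<forall>x\<in>D. cinner x y = ip x w)" by blast
qed

lemma resolvent_mem [simp]: "resolvent y \<in> D"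
  and cinner_resolvent: "x \<in> D \<Longrightarrow> cinner x y = ip x (resolvent y)"
  using resolvent by blast+

lemma weak_imp_weak_cinner:
  assumes "\<And>n. x n \<in> D" "l \<in> D" "\<And>y. y \<in> D \<Longrightarrow> (\<lambda>n. ip (x n) y) \<longlonglongrightarrow> ip l y"
  shows "(\<lambda>n. cinner (x n) y) \<longlonglongrightarrow> cinner l y"
  using assms by (simp add: cinner_resolvent)

text \<open>For fixed \<open>y\<close> a form-bounded q(., y) is represented by a vector of
  \<open>D\<close>, hence weakly continuous. This is how limits are taken in the forms of the family
  and in \<open>a1\<close>.\<close>

lemma weak_tendsto_sesquilinear:
  assumes x: "\<And>n. x n \<in> D" "l \<in> D" "\<And>y. y \<in> D \<Longrightarrow> (\<lambda>n. ip (x n) y) \<longlonglongrightarrow> ip l y"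
    and q: "sesquilinear_on D q" "\<And>x y. x \<in> D \<Longrightarrow> y \<in> D \<Longrightarrow> cmod (q x y) \<le> C * nrm x * nrm y"
    and y: "y \<in> D"
  shows "(\<lambda>n. q (x n) y) \<longlonglongrightarrow> q l y"
proof -
  interpret q: sesquilinear D q using q(1) by unfold_locales
  have "\<exists>w\<in>D. \<forall>x\<in>D. q x y = ip x w"
  proof (rule Riesz)
    fix x assume "x \<in> D"
    then show "cmod (q x y) \<le> C * nrm y * nrm x" using q(2)[of x y] y by (simp add: mult_ac)
  qed (use y in simp_all)
  then show ?thesis using x by auto
qed

text \<open>A closed graph argument: both norms are complete and dominate the ambient one. The
  second is lower semicontinuous for the first, since a set bounded in it is weakly compact and its
  weak limits are identified in the ambient space.\<close>

lemma nrm_dominates: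
  assumes "hilbert_form D ip'"
  shows "\<exists>C. \<forall>x\<in>D. hilbert_form.nrm ip' x \<le> C * nrm x"
proof -
  interpret H: hilbert_form D ip' by fact
  show ?thesis
  proof (rule lsc_seminorm_bounded)
    fix x b assume x: "x \<in> D" and b: "b < H.nrm x"
    show "\<exists>e>0. \<forall>y\<in>D. nrm (y - x) < e \<longrightarrow> b < H.nrm y"
    proof (rule ccontr)
      assume neg: "\<not> ?thesis"
      have "\<exists>y\<in>D. nrm (y - x) < 1 / Suc n \<and> H.nrm y \<le> b" for n
        using neg by (metis not_less of_nat_0_less_iff zero_less_Suc zero_less_divide_1_iff)
      then obtain y where y: "\<And>n. y n \<in> D" "\<And>n. nrm (y n - x) < 1 / Suc n" "\<And>n. H.nrm (y n) \<le> b"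
        by metis
      have "y \<longlonglongrightarrow> x"
      proof (rule LIM_zero_cancel, rule Lim_null_comparison)
        show "\<forall>\<^sub>F n in sequentially. norm (y n - x) \<le> 1 / Suc n"
          using norm_le_nrm[of "y _ - x"] y x by (intro always_eventually allI) (meson diff_mem less_imp_le order_trans)
        show "(\<lambda>n. 1 / real (Suc n)) \<longlonglongrightarrow> 0" by (rule LIMSEQ_Suc[OF lim_1_over_n])
      qed
      \<comment> \<open>The weak limit \<open>l\<close> in the second norm must be the ambient limit
        \<open>x\<close>; Cauchy-Schwarz then bounds the second norm of \<open>x\<close> by
        \<open>b\<close>, a contradiction.\<close>
      obtain r l where r: "strict_mono (r::nat\<Rightarrow>nat)" and l: "l \<in> D"
        and w: "\<And>z. z \<in> D \<Longrightarrow> (\<lambda>n. ip' (y (r n)) z) \<longlonglongrightarrow> ip' l z"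
        using H.weak_compactness[of y b] y by blast
      have "cinner (l - x) z = 0" for z
      proof -
        have "(\<lambda>n. cinner (y (r n)) z) \<longlonglongrightarrow> cinner l z"
          using H.weak_imp_weak_cinner[of "\<lambda>n. y (r n)"] y l w by blast
        moreover have "(\<lambda>n. cinner (y (r n)) z) \<longlonglongrightarrow> cinner x z"
          using LIMSEQ_subseq_LIMSEQ[OF \<open>y \<longlonglongrightarrow> x\<close> r]
          by (intro tendsto_cinner_left tendsto_norm_zero LIM_zero) (simp add: o_def)
        ultimately have "cinner l z = cinner x z" by (rule LIMSEQ_unique)
        then show ?thesis by simp
      qed
      from this[of "l - x"] have "l = x"
        by (simp add: cinner_self del: cinner.diff_left cinner.diff_right)
      have b0: "0 \<le> b" using H.nrm_nonneg[OF y(1)[of 0]] y(3)[of 0] by linarith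
      have "(\<lambda>n. cmod (ip' (y (r n)) x)) \<longlonglongrightarrow> cmod (ip' x x)"
        using tendsto_norm[OF w[OF x]] \<open>l = x\<close> by simp
      moreover have "cmod (ip' (y n) x) \<le> b * H.nrm x" for n
        using H.Cauchy_Schwarz[OF y(1) x] mult_right_mono[OF y(3) H.nrm_nonneg[OF x]]
        by (meson order_trans)
      ultimately have "cmod (ip' x x) \<le> b * H.nrm x" by (intro LIMSEQ_le_const2) auto
      then have "(H.nrm x)\<^sup>2 \<le> b * H.nrm x"
        by (simp add: H.diag_nrm[OF x] norm_power H.nrm_nonneg[OF x])
      then show False using b b0 by (simp add: power2_eq_square)
    qed
  qed (simp_all add: H.nrm_triangle H.nrm_scaleR)
qed

end

text \<open>A weak limit of a subsequence is orthogonal to every \<open>w j\<close>, hence to itself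
  as a weak limit of such vectors, so it vanishes.\<close>

lemma weakly_tendsto_0_pairwise:
  fixes w :: "nat \<Rightarrow> 'a::complex_hilbert_space"
  assumes bdd: "\<And>k. norm (w k) \<le> M" and pair: "\<And>j. (\<lambda>k. cinner (w k) (w j)) \<longlonglongrightarrow> 0"
  shows "weakly_tendsto_0 w"
  unfolding weakly_tendsto_0_def
proof (rule allI, rule ccontr)
  fix y assume "\<not> (\<lambda>n. cinner (w n) y) \<longlonglongrightarrow> 0"
  then obtain e where e: "e > 0" "\<not> (\<forall>\<^sub>F n in sequentially. cmod (cinner (w n) y) < e)"
    unfolding tendsto_iff by auto
  then have "infinite {n. \<not> cmod (cinner (w n) y) < e}"
    by (simp add: cofinite_eq_sequentially[symmetric] eventually_cofinite)
  then obtain r where r: "strict_mono (r::nat\<Rightarrow>nat)" "\<And>n. \<not> cmod (cinner (w (r n)) y) < e"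
    using infinite_enumerate by blast
  obtain r' l where r': "strict_mono (r'::nat\<Rightarrow>nat)"
    and l: "\<And>z. (\<lambda>n. cinner (w (r (r' n))) z) \<longlonglongrightarrow> cinner l z"
    using cinner.weak_compactness[of "\<lambda>n. w (r n)" M] bdd by auto
  have mono: "strict_mono (\<lambda>n. r (r' n))" using strict_mono_o[OF r(1) r'] by (simp add: o_def)
  have "cinner l (w j) = 0" for j
    using LIMSEQ_unique[OF l[of "w j"]] LIMSEQ_subseq_LIMSEQ[OF pair[of j] mono] by (simp add: o_def)
  then have "cinner (w j) l = 0" for j by (metis cinner_commute complex_cnj_zero)
  then have "cinner l l = 0" using LIMSEQ_unique[OF l[of l]] by simp
  then have "(\<lambda>n. cinner (w (r (r' n))) y) \<longlonglongrightarrow> 0" using l[of y] by (simp add: cinner_self)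
  then have "\<forall>\<^sub>F n in sequentially. cmod (cinner (w (r (r' n))) y) < e"
    using e(1) by (auto simp: tendsto_iff)
  then show False using r(2) by simp
qed

section \<open>Closed forms and their operators\<close>

lemma Re_ge_vertex:
  assumes "\<bar>Arg (z - v)\<bar> \<le> \<theta>" "\<theta> < pi / 2" shows "Re v \<le> Re z"
proof -
  have "0 \<le> cos (Arg (z - v))" using assms by (intro cos_ge_zero) auto
  then have "0 \<le> Re (rcis (cmod (z - v)) (Arg (z - v)))" by simp
  then show ?thesis by (simp add: rcis_cmod_Arg)
qed

lemma sectorial_lower_bound:
  assumes "sesquilinear_on D t" "sectorial D t"
  shows "\<exists>c. \<forall>x\<in>D. - c * (norm x)\<^sup>2 \<le> Re (t x x)"
proof -
  interpret sesquilinear D t using assms(1) by unfold_locales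
  obtain v \<theta> where \<theta>: "\<theta> < pi / 2" and v: "\<And>z. z \<in> numerical_range D t \<Longrightarrow> \<bar>Arg (z - v)\<bar> \<le> \<theta>"
    using assms(2) unfolding sectorial_def by blast
  have "Re v * (norm x)\<^sup>2 \<le> Re (t x x)" if x: "x \<in> D" for x
  proof (cases "x = 0")
    case True then show ?thesis by simp
  next
    case False
    define u where "u = (1 / norm x) *\<^sub>R x"
    have "norm u = 1" "u \<in> D" using x False by (simp_all add: u_def)
    then have "t u u \<in> numerical_range D t" unfolding numerical_range_def by blast
    from Re_ge_vertex[OF v[OF this] \<theta>] have "Re v \<le> Re (t u u)" .
    moreover have "t u u = of_real (1 / (norm x)\<^sup>2) * t x x"
      using x by (simp add: u_def power2_eq_square)
    then have "Re (t u u) = Re (t x x) / (norm x)\<^sup>2" by (simp del: of_real_divide of_real_power)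
    ultimately show ?thesis using False by (simp add: field_simps)
  qed
  then show ?thesis by (intro exI[of _ "- Re v"]) simp
qed

definition form_shift :: "('a::complex_hilbert_space \<Rightarrow> 'a \<Rightarrow> complex) \<Rightarrow> real \<Rightarrow> 'a \<Rightarrow> 'a \<Rightarrow> complex" where
  "form_shift t c x y = t x y + of_real c * cinner x y"

lemma Re_form_shift_diag: "Re (form_shift t c x x) = Re (t x x) + c * (norm x)\<^sup>2"
  by (simp add: form_shift_def cinner_self del: of_real_power)

text \<open>Closedness of a form is completeness of its domain for the shifted inner product: a
  Cauchy sequence there converges in the ambient norm, and its form differences tend to 0.\<close>

lemma hilbert_form_shift:
  fixes D :: "'a::complex_hilbert_space set"
  assumes closed: "closed_sectorial_form D t" and sym: "symmetric_form D t"
    and c: "\<And>x. x \<in> D \<Longrightarrow> (norm x)\<^sup>2 \<le> Re (t x x) + c * (norm x)\<^sup>2"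
  shows "hilbert_form D (form_shift t c)"
proof -
  have sesq: "sesquilinear_on D t" using closed by (simp add: closed_sectorial_form_def)
  interpret symmetric_sesquilinear D t using sesq sym by unfold_locales
  show ?thesis
  proof
    show "sesquilinear_on D (form_shift t c)"
      unfolding sesquilinear_on_def form_shift_def using csub by (simp add: algebra_simps)
    show "symmetric_form D (form_shift t c)"
      unfolding symmetric_form_def form_shift_def
      by (intro ballI, subst swap, assumption, assumption, subst cinner_commute) simp
    show "(norm x)\<^sup>2 \<le> Re (form_shift t c x x)" if "x \<in> D" for x
      using c[OF that] by (simp add: Re_form_shift_diag)
    fix x :: "nat \<Rightarrow> 'a" assume x: "\<And>n. x n \<in> D"
      and Cauchy: "\<And>e. e > 0 \<Longrightarrow> \<exists>N. \<forall>m\<ge>N. \<forall>n\<ge>N. Re (form_shift t c (x m - x n) (x m - x n)) < e"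
    have small: "\<exists>N. \<forall>m\<ge>N. \<forall>n\<ge>N. norm (x m - x n) < e \<and> cmod (t (x m - x n) (x m - x n)) < e"
      if e: "e > 0" for e
    proof -
      \<comment> \<open>The first bound makes ambient differences smaller than e. The second absorbs
        the shift, because |t[u]| is at most (t[u] + c |u|^2) + |c| |u|^2, which is below (1 + |c|)
        d.\<close>
      define d where "d = min (e\<^sup>2) (e / (1 + \<bar>c\<bar>))"
      have "d > 0" using e by (simp add: d_def add_pos_nonneg)
      from Cauchy[OF this] obtain N where
        N: "\<And>m n. m \<ge> N \<Longrightarrow> n \<ge> N \<Longrightarrow> Re (form_shift t c (x m - x n) (x m - x n)) < d" by blast
      have "norm (x m - x n) < e \<and> cmod (t (x m - x n) (x m - x n)) < e" if "m \<ge> N" "n \<ge> N" for m n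
      proof -
        define u where "u = x m - x n"
        have u: "u \<in> D" using x by (simp add: u_def)
        have less: "Re (t u u) + c * (norm u)\<^sup>2 < d"
          using N[OF that] unfolding u_def Re_form_shift_diag by simp
        then have nu: "(norm u)\<^sup>2 < d" using c[OF u] by linarith
        then have "(norm u)\<^sup>2 < e\<^sup>2" by (simp add: d_def)
        then have "norm u < e" using e by (simp add: power_less_imp_less_base)
        moreover have "\<bar>Re (t u u)\<bar> \<le> (Re (t u u) + c * (norm u)\<^sup>2) + \<bar>c\<bar> * (norm u)\<^sup>2"
        proof -
          have "\<bar>c * (norm u)\<^sup>2\<bar> = \<bar>c\<bar> * (norm u)\<^sup>2" by (simp add: abs_mult)
          moreover have "0 \<le> Re (t u u) + c * (norm u)\<^sup>2" using c[OF u] zero_le_power2[of "norm u"] by linarith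
          ultimately show ?thesis by linarith
        qed
        moreover have "\<bar>c\<bar> * (norm u)\<^sup>2 \<le> \<bar>c\<bar> * d" using nu by (intro mult_left_mono) auto
        ultimately have "\<bar>Re (t u u)\<bar> < (1 + \<bar>c\<bar>) * d" using less by (simp add: algebra_simps)
        also have "\<dots> \<le> e"
        proof -
          have "d \<le> e / (1 + \<bar>c\<bar>)" by (simp add: d_def)
          then show ?thesis by (simp add: pos_le_divide_eq add_pos_nonneg mult.commute)
        qed
        finally have "cmod (t u u) < e" by (subst diag_real[OF u]) simp
        then show ?thesis using \<open>norm u < e\<close> by (simp add: u_def del: diff_left diff_right)
      qed
      then show ?thesis by blast
    qed
    have "Cauchy x" by (rule CauchyI) (use small in blast)
    then obtain l where l: "x \<longlonglongrightarrow> l" using Cauchy_convergent convergentD by blast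
    have "((\<lambda>(n, m). t (x n - x m) (x n - x m)) \<longlongrightarrow> 0) (sequentially \<times>\<^sub>F sequentially)"
      unfolding tendsto_iff
    proof (intro allI impI)
      fix e :: real assume "e > 0"
      from small[OF this] obtain N where
        N: "\<And>m n. m \<ge> N \<Longrightarrow> n \<ge> N \<Longrightarrow> cmod (t (x m - x n) (x m - x n)) < e" by blast
      show "\<forall>\<^sub>F p in sequentially \<times>\<^sub>F sequentially. dist (case p of (n, m) \<Rightarrow> t (x n - x m) (x n - x m)) 0 < e"
        unfolding eventually_prod_sequentially
        by (intro exI[of _ N] allI impI) (simp add: N del: diff_left diff_right)
    qed
    with x l closed have lD: "l \<in> D" and lim: "(\<lambda>n. t (x n - l) (x n - l)) \<longlonglongrightarrow> 0"
      unfolding closed_sectorial_form_def by blast+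
    have "(\<lambda>n. Re (t (x n - l) (x n - l)) + c * (norm (x n - l))\<^sup>2) \<longlonglongrightarrow> Re 0 + c * 0\<^sup>2"
      by (intro tendsto_intros lim tendsto_norm_zero LIM_zero l)
    then have "(\<lambda>n. Re (form_shift t c (x n - l) (x n - l))) \<longlonglongrightarrow> 0"
      unfolding Re_form_shift_diag by simp
    then show "\<exists>l\<in>D. (\<lambda>n. Re (form_shift t c (x n - l) (x n - l))) \<longlonglongrightarrow> 0" using lD by blast
  qed
qed

lemma form_bound:
  assumes "hilbert_form D (form_shift t c)" and D: "x \<in> D" "y \<in> D"
  shows "cmod (t x y) \<le> (1 + \<bar>c\<bar>) *
    (hilbert_form.nrm (form_shift t c) x * hilbert_form.nrm (form_shift t c) y)"
proof -
  interpret hilbert_form D "form_shift t c" by fact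
  have "cmod (t x y) \<le> cmod (form_shift t c x y) + cmod (of_real c * cinner x y)"
    using norm_triangle_ineq4[of "form_shift t c x y" "of_real c * cinner x y"]
    by (simp add: form_shift_def)
  also have "cmod (form_shift t c x y) \<le> nrm x * nrm y" by (rule Cauchy_Schwarz[OF D])
  also have "cmod (of_real c * cinner x y) \<le> \<bar>c\<bar> * (nrm x * nrm y)"
    unfolding norm_mult norm_of_real
    by (intro mult_left_mono order_trans[OF cinner_le] mult_mono norm_le_nrm D) (use D in auto)
  finally show ?thesis by (simp add: algebra_simps)
qed

section \<open>The operator of a closed symmetric form\<close>

locale form_operator = symmetric_sesquilinear D t
  for D :: "'a::complex_hilbert_space set" and t +
  fixes DT :: "'a set" and T :: "'a \<Rightarrow> 'a"
  assumes closed: "closed_sectorial_form D t"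
    and assoc: "associated_operator D t DT T"
begin

lemma shift_exists:
  "\<exists>c. (\<forall>x\<in>D. - c * (norm x)\<^sup>2 \<le> Re (t x x)) \<and> hilbert_form D (form_shift t (c + 1))"
proof -
  obtain c where c: "\<And>x. x \<in> D \<Longrightarrow> - c * (norm x)\<^sup>2 \<le> Re (t x x)"
    using sectorial_lower_bound[OF sesq] closed unfolding closed_sectorial_form_def by blast
  have "(norm x)\<^sup>2 \<le> Re (t x x) + (c + 1) * (norm x)\<^sup>2" if "x \<in> D" for x
    using c[OF that] by (simp add: algebra_simps)
  then show ?thesis using c hilbert_form_shift[OF closed sym] by blast
qed

lemma DT_subset: "DT \<subseteq> D"
  using assoc by (simp add: associated_operator_def is_core_def)

lemma linear_op: "linear_operator DT T"
  using assoc by (simp add: associated_operator_def self_adjoint_def)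

lemma in_domain_iff: "(y \<in> DT \<and> T y = z) \<longleftrightarrow> (\<forall>x\<in>DT. cinner (T x) y = cinner x z)"
proof -
  have "adjoint_graph DT T = {(y, T y) | y. y \<in> DT}"
    using assoc by (simp add: associated_operator_def self_adjoint_def)
  then have "(y, z) \<in> adjoint_graph DT T \<longleftrightarrow> y \<in> DT \<and> T y = z" by auto
  then show ?thesis by (auto simp: adjoint_graph_def)
qed

text \<open>
  The vectors \<open>y\<close> satisfying the identity form a closed restriction of the form that contains
  the core, hence they exhaust the form domain.
\<close>

lemma operator_form:
  assumes x: "x \<in> DT" and y: "y \<in> D"
  shows "cinner (T x) y = t x y"
proof -
  define D' where "D' = {y\<in>D. \<forall>w\<in>DT. cinner (T w) y = t w y}"
  have D'D: "D' \<subseteq> D" by (auto simp: D'_def)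
  have DTD: "w \<in> D" if "w \<in> DT" for w using DT_subset that by blast
  obtain c where "hilbert_form D (form_shift t c)" using shift_exists by blast
  then interpret H: hilbert_form D "form_shift t c" .
  have "closed_sectorial_form D' t" unfolding closed_sectorial_form_def
  proof (intro conjI allI impI)
    have "csubspace D'"
      unfolding csubspace_def D'_def using DTD by auto
    then show "sesquilinear_on D' t" using sesq D'D unfolding sesquilinear_on_def by blast
    have "numerical_range D' t \<subseteq> numerical_range D t"
      using D'D unfolding numerical_range_def by blast
    then show "sectorial D' t" using closed unfolding closed_sectorial_form_def sectorial_def by blast
  next
    fix x l assume x: "\<forall>n. x n \<in> D'" and l: "x \<longlonglongrightarrow> l"
      and "((\<lambda>(n, m). t (x n - x m) (x n - x m)) \<longlongrightarrow> 0) (sequentially \<times>\<^sub>F sequentially)"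
    with closed D'D have lD: "l \<in> D" and lim: "(\<lambda>n. t (x n - l) (x n - l)) \<longlonglongrightarrow> 0"
      unfolding closed_sectorial_form_def by blast+
    have xD: "x n \<in> D" for n using x D'D by blast
    have nl: "(\<lambda>n. norm (x n - l)) \<longlonglongrightarrow> 0" by (intro tendsto_norm_zero LIM_zero l)
    have "(\<lambda>n. sqrt (Re (t (x n - l) (x n - l)) + c * (norm (x n - l))\<^sup>2)) \<longlonglongrightarrow> sqrt (Re 0 + c * 0\<^sup>2)"
      by (intro tendsto_intros lim nl)
    then have nrm0: "(\<lambda>n. H.nrm (x n - l)) \<longlonglongrightarrow> 0"
      unfolding H.nrm_def Re_form_shift_diag by simp
    have "cinner (T w) l = t w l" if w: "w \<in> DT" for w
    proof -
      have "(\<lambda>n. form_shift t c w (x n) - form_shift t c w l) \<longlonglongrightarrow> 0"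
      proof (rule Lim_null_comparison[OF always_eventually], rule allI)
        show "cmod (form_shift t c w (x n) - form_shift t c w l) \<le> H.nrm w * H.nrm (x n - l)" for n
          using H.Cauchy_Schwarz[OF DTD[OF w] diff_mem[OF xD lD], of n] DTD[OF w] xD lD by simp
        show "(\<lambda>n. H.nrm w * H.nrm (x n - l)) \<longlonglongrightarrow> 0" using tendsto_mult_right_zero[OF nrm0] .
      qed
      \<comment> \<open>Subtracting c times the ambient inner products turns convergence of the
        shifted form into convergence of \<open>t\<close>.\<close>
      from tendsto_diff[OF LIM_zero_cancel[OF this] tendsto_mult_left[OF tendsto_cinner_right[OF nl, of w], of "of_real c"]]
      have "(\<lambda>n. t w (x n)) \<longlonglongrightarrow> t w l" by (simp add: form_shift_def)
      moreover have "t w (x n) = cinner (T w) (x n)" for n using x w by (auto simp: D'_def)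
      ultimately show ?thesis using LIMSEQ_unique[OF tendsto_cinner_right[OF nl, of "T w"]] by simp
    qed
    then show "l \<in> D'" using lD by (simp add: D'_def)
    show "(\<lambda>n. t (x n - l) (x n - l)) \<longlonglongrightarrow> 0" by (rule lim)
  qed
  moreover have "form_extends D' t DT t"
    using assoc DT_subset unfolding form_extends_def D'_def associated_operator_def by blast
  ultimately have "form_extends D' t D t"
    using assoc unfolding associated_operator_def is_core_def is_form_closure_def by blast
  then have "y \<in> D'" using y unfolding form_extends_def by blast
  then show ?thesis using x by (simp add: D'_def)
qed

text \<open>The maximality half of the representation theorem: the hypothesis puts (x, z) into the
  graph of the adjoint, and \<open>T\<close> is its own adjoint.\<close>

lemma form_representation:
  assumes x: "x \<in> D" and z: "\<And>y. y \<in> D \<Longrightarrow> t x y = cinner z y"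
  shows "x \<in> DT \<and> T x = z"
  unfolding in_domain_iff
proof
  fix w assume w: "w \<in> DT"
  then have wD: "w \<in> D" using DT_subset by blast
  have "cinner (T w) x = t w x" using operator_form[OF w x] .
  also have "\<dots> = cnj (t x w)" using swap[OF x wD] .
  also have "\<dots> = cnj (cinner z w)" using z[OF wD] by simp
  also have "\<dots> = cinner w z" by (metis cinner_commute)
  finally show "cinner (T w) x = cinner w z" .
qed

text \<open>With the kernel described by the form alone, a limit that exists only weakly in the form
  domain can be recognized as a kernel vector.\<close>

lemma kernel_iff: "op_kernel DT T = {x\<in>D. \<forall>y\<in>D. t x y = 0}"
proof
  show "op_kernel DT T \<subseteq> {x\<in>D. \<forall>y\<in>D. t x y = 0}"
    using operator_form DT_subset by (auto simp: op_kernel_def) (metis cinner.zero_left UNIV_I)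
  show "{x\<in>D. \<forall>y\<in>D. t x y = 0} \<subseteq> op_kernel DT T"
    using form_representation[of _ 0] by (auto simp: op_kernel_def)
qed

end

section \<open>Essential spectrum\<close>

text \<open>Each choice may depend on the set of all earlier values, as near orthogonality to every
  predecessor demands.\<close>

lemma ex_sequence_wellorder:
  assumes "\<And>F n. finite F \<Longrightarrow> \<exists>w. P F (n::nat) w"
  shows "\<exists>w. \<forall>n. P (w ` {..<n}) n (w n)"
proof -
  have "\<exists>w. \<forall>n. (\<lambda>f n r. P (f ` {..<n}) n r) w n (w n)"
  proof (rule dependent_wellorder_choice)
    fix r and f g :: "nat \<Rightarrow> 'a" and n :: nat
    assume "\<And>y. y < n \<Longrightarrow> f y = g y"
    then have "f ` {..<n} = g ` {..<n}" by (intro image_cong) auto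
    then show "P (f ` {..<n}) n r = P (g ` {..<n}) n r" by simp
  qed (use assms in auto)
  then show ?thesis by simp
qed

context form_operator
begin

text \<open>Variational substitute for the essential spectrum lying above \<mu>. The additive error
  \<delta> spares a normalization, so vectors may tend to 0; the bound \<open>M\<close> keeps the
  sequence in a form-bounded set.\<close>

definition asymptotic_bound :: "real \<Rightarrow> bool" where
  "asymptotic_bound \<mu> \<longleftrightarrow> (\<forall>u M \<delta>. (\<forall>k::nat. u k \<in> D \<and> norm (u k) \<le> M \<and> Re (t (u k) (u k)) \<le> M) \<longrightarrow>
     weakly_tendsto_0 u \<longrightarrow> \<delta> > 0 \<longrightarrow>
     (\<forall>\<^sub>F k in sequentially. \<mu> * (norm (u k))\<^sup>2 - \<delta> \<le> Re (t (u k) (u k))))"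

lemma asymptotic_bound_antimono:
  assumes "asymptotic_bound \<mu>" "\<nu> \<le> \<mu>" shows "asymptotic_bound \<nu>"
  unfolding asymptotic_bound_def
proof (intro allI impI)
  fix u M \<delta>
  assume "\<forall>k::nat. u k \<in> D \<and> norm (u k) \<le> M \<and> Re (t (u k) (u k)) \<le> M" "weakly_tendsto_0 u" "0 < (\<delta>::real)"
  with assms(1) have "\<forall>\<^sub>F k in sequentially. \<mu> * (norm (u k))\<^sup>2 - \<delta> \<le> Re (t (u k) (u k))"
    unfolding asymptotic_bound_def by blast
  then show "\<forall>\<^sub>F k in sequentially. \<nu> * (norm (u k))\<^sup>2 - \<delta> \<le> Re (t (u k) (u k))"
  proof eventually_elim
    case (elim k)
    then show ?case using mult_right_mono[OF assms(2), of "(norm (u k))\<^sup>2"] by simp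
  qed
qed

text \<open>Norms are bounded by \<open>M\<close>, so replacing the supremum by a member of
  \<open>S\<close> within \<open>d\<close> of it costs at most \<delta>/2 in the quadratic
  term.\<close>

lemma asymptotic_bound_Sup:
  assumes S: "S \<noteq> {}" "bdd_above S" "\<And>\<mu>. \<mu> \<in> S \<Longrightarrow> asymptotic_bound \<mu>"
  shows "asymptotic_bound (Sup S)"
  unfolding asymptotic_bound_def
proof (intro allI impI)
  fix u M \<delta>
  assume u: "\<forall>k::nat. u k \<in> D \<and> norm (u k) \<le> M \<and> Re (t (u k) (u k)) \<le> M" "weakly_tendsto_0 u" "0 < (\<delta>::real)"
  define d where "d = \<delta> / (2 * (M\<^sup>2 + 1))"
  have d: "d > 0" using u(3) by (simp add: d_def add_nonneg_pos)
  then obtain \<mu> where \<mu>: "\<mu> \<in> S" "Sup S - d < \<mu>"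
    using less_cSup_iff[OF S(1,2), of "Sup S - d"] by auto
  have "\<forall>\<^sub>F k in sequentially. \<mu> * (norm (u k))\<^sup>2 - \<delta> / 2 \<le> Re (t (u k) (u k))"
    using S(3)[OF \<mu>(1)] u half_gt_zero unfolding asymptotic_bound_def by blast
  then show "\<forall>\<^sub>F k in sequentially. Sup S * (norm (u k))\<^sup>2 - \<delta> \<le> Re (t (u k) (u k))"
  proof eventually_elim
    case (elim k)
    have "(Sup S - \<mu>) * (norm (u k))\<^sup>2 \<le> d * (norm (u k))\<^sup>2"
      using \<mu> by (intro mult_right_mono) auto
    also have "\<dots> \<le> d * (M\<^sup>2 + 1)"
      using power_mono[of "norm (u k)" M 2] u(1) d by (intro mult_left_mono) auto
    also have "\<dots> = \<delta> / 2"
    proof -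
      have "M\<^sup>2 + 1 > 0" by (simp add: add_nonneg_pos)
      then show ?thesis by (simp add: d_def field_simps)
    qed
    finally show ?case using elim by (simp add: algebra_simps)
  qed
qed

text \<open>A sequence violating the bound stays \<delta> below \<mu> |u|^2 infinitely often. The
  lower bound of the form prevents those vectors from being small, so normalizing preserves near
  orthogonality to \<open>F\<close>.\<close>

lemma near_optimal_vector:
  assumes lower: "\<And>x. x \<in> D \<Longrightarrow> - c * (norm x)\<^sup>2 \<le> Re (t x x)"
    and not: "\<not> asymptotic_bound \<mu>" and F: "finite F" and \<eta>: "\<eta> > 0"
  shows "\<exists>w\<in>D. norm w = 1 \<and> Re (t w w) < \<mu> \<and> (\<forall>v\<in>F. cmod (cinner w v) < \<eta>)"
proof -
  obtain u M \<delta> where u: "\<And>k::nat. u k \<in> D" and weak: "weakly_tendsto_0 u" and \<delta>: "\<delta> > 0"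
    and "\<not> (\<forall>\<^sub>F k in sequentially. \<mu> * (norm (u k))\<^sup>2 - \<delta> \<le> Re (t (u k) (u k)))"
    using not unfolding asymptotic_bound_def by blast
  then have freq: "\<exists>\<^sub>F k in sequentially. Re (t (u k) (u k)) < \<mu> * (norm (u k))\<^sup>2 - \<delta>"
    by (simp add: frequently_def not_less)
  \<comment> \<open>Lower bound for the norms: the violation together with t[x] >= -c |x|^2 gives
    \<delta> < (\<mu> + c) |x|^2.\<close>
  define \<beta> where "\<beta> = sqrt (\<delta> / (\<bar>\<mu> + c\<bar> + 1))"
  have \<beta>: "\<beta> > 0" using \<delta> by (simp add: \<beta>_def add_nonneg_pos)
  have "\<forall>\<^sub>F k in sequentially. \<forall>v\<in>F. cmod (cinner (u k) v) < \<eta> * \<beta>"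
  proof (rule eventually_ball_finite[OF F], rule ballI)
    fix v assume "v \<in> F"
    have "(\<lambda>k. cinner (u k) v) \<longlonglongrightarrow> 0" using weak unfolding weakly_tendsto_0_def by blast
    then show "\<forall>\<^sub>F k in sequentially. cmod (cinner (u k) v) < \<eta> * \<beta>"
      using \<eta> \<beta> unfolding tendsto_iff by (auto dest: spec[of _ "\<eta> * \<beta>"])
  qed
  with freq have "\<exists>\<^sub>F k in sequentially. Re (t (u k) (u k)) < \<mu> * (norm (u k))\<^sup>2 - \<delta> \<and>
      (\<forall>v\<in>F. cmod (cinner (u k) v) < \<eta> * \<beta>)"
    by (rule frequently_eventually_frequently)
  then obtain k where k: "Re (t (u k) (u k)) < \<mu> * (norm (u k))\<^sup>2 - \<delta>"
      "\<And>v. v \<in> F \<Longrightarrow> cmod (cinner (u k) v) < \<eta> * \<beta>"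
    using frequently_ex by blast
  define x where "x = u k"
  have x: "x \<in> D" using u by (simp add: x_def)
  have "\<delta> < (\<mu> + c) * (norm x)\<^sup>2" using k(1) lower[OF x] by (simp add: x_def algebra_simps)
  also have "\<dots> \<le> (\<bar>\<mu> + c\<bar> + 1) * (norm x)\<^sup>2" by (intro mult_right_mono) auto
  finally have "\<delta> / (\<bar>\<mu> + c\<bar> + 1) < (norm x)\<^sup>2" by (simp add: pos_divide_less_eq add_nonneg_pos mult.commute)
  then have \<beta>x: "\<beta> < norm x" unfolding \<beta>_def by (intro real_less_lsqrt) auto
  then have nx: "norm x > 0" using \<beta> by linarith
  define w where "w = (1 / norm x) *\<^sub>R x"
  have "t w w = of_real (1 / (norm x)\<^sup>2) * t x x" using x by (simp add: w_def power2_eq_square)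
  then have tw: "Re (t w w) = Re (t x x) / (norm x)\<^sup>2" by (simp del: of_real_divide of_real_power)
  have "Re (t x x) < \<mu> * (norm x)\<^sup>2" using k(1) \<delta> by (simp add: x_def)
  then have "Re (t w w) < \<mu>" unfolding tw using nx by (simp add: pos_divide_less_eq)
  moreover have "cmod (cinner w v) < \<eta>" if "v \<in> F" for v
  proof -
    have "cmod (cinner w v) = cmod (cinner x v) / norm x"
      by (simp add: w_def norm_mult norm_divide)
    also have "\<dots> < \<eta>"
    proof -
      have "cmod (cinner x v) < \<eta> * norm x"
        using k(2)[OF that] mult_strict_left_mono[OF \<beta>x \<eta>] by (simp add: x_def)
      then show ?thesis using nx by (simp add: pos_divide_less_eq)
    qed
    finally show ?thesis .
  qed
  moreover have "norm w = 1" "w \<in> D" using nx x by (auto simp: w_def)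
  ultimately show ?thesis by blast
qed

text \<open>
  With \<open>m\<close> optimal and \<open>w\<close> a minimizing sequence, the resolvent improves \<open>w\<close> to
  \<open>y = \<kappa> (T + c + 1)\<^sup>-\<^sup>1 w\<close> with \<open>\<kappa> = m + c + 1\<close>: it lowers \<open>t - m\<close> by at least the
  squared form norm of \<open>w - y\<close>, so that \<open>w - y\<close> is small, and \<open>(T - m) y = \<kappa> (w - y)\<close>.
\<close>

lemma optimal_bound_in_essential_spectrum:
  assumes lower: "\<And>x. x \<in> D \<Longrightarrow> - c * (norm x)\<^sup>2 \<le> Re (t x x)"
    and hilb: "hilbert_form D (form_shift t (c + 1))"
    and good: "asymptotic_bound m" and opt: "\<And>\<eta>. \<eta> > 0 \<Longrightarrow> \<not> asymptotic_bound (m + \<eta>)"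
    and mc: "- c \<le> m"
  shows "complex_of_real m \<in> essential_spectrum DT T"
proof -
  interpret H: hilbert_form D "form_shift t (c + 1)" by fact
  \<comment> \<open>With this factor, \<kappa> (T + c + 1)^-1 fixes exactly the solutions of T w = m
    w, so \<open>w - y\<close> measures how far \<open>w\<close> is from solving it.\<close>
  define \<kappa> where "\<kappa> = m + (c + 1)"
  have \<kappa>: "\<kappa> \<ge> 1" using mc by (simp add: \<kappa>_def)
  \<comment> \<open>The failing bounds m + 1/(n+1) supply unit vectors almost orthogonal to all
    predecessors, which forces weak convergence to 0.\<close>
  have "\<exists>w. \<forall>n. w n \<in> D \<and> norm (w n) = 1 \<and> Re (t (w n) (w n)) < m + 1 / Suc n \<and>
      (\<forall>v \<in> w ` {..<n}. cmod (cinner (w n) v) < 1 / Suc n)"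
    by (rule ex_sequence_wellorder[where P = "\<lambda>F n w. w \<in> D \<and> norm w = 1 \<and>
        Re (t w w) < m + 1 / Suc n \<and> (\<forall>v\<in>F. cmod (cinner w v) < 1 / Suc n)"])
       (use near_optimal_vector[OF lower opt] in \<open>auto simp: Bex_def\<close>)
  then obtain w where w: "\<And>n. w n \<in> D" "\<And>n. norm (w n) = 1" "\<And>n. Re (t (w n) (w n)) < m + 1 / Suc n"
    and wv: "\<And>n j. j < n \<Longrightarrow> cmod (cinner (w n) (w j)) < 1 / Suc n"
    by (auto simp: Ball_def) 
  have lim1: "(\<lambda>n. 1 / real (Suc n)) \<longlonglongrightarrow> 0" by (rule LIMSEQ_Suc[OF lim_1_over_n])
  have weak_w: "weakly_tendsto_0 w"
  proof (rule weakly_tendsto_0_pairwise)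
    show "norm (w k) \<le> 1" for k using w by simp
    show "(\<lambda>k. cinner (w k) (w j)) \<longlonglongrightarrow> 0" for j
      by (rule Lim_null_comparison[OF _ lim1])
         (use wv less_imp_le in \<open>auto simp: eventually_sequentially intro!: exI[of _ "Suc j"] less_imp_le\<close>)
  qed
  define y where "y n = H.resolvent (\<kappa> *\<^sub>R w n)" for n
  have yD: "y n \<in> D" for n by (simp add: y_def)
  have y: "form_shift t (c + 1) x (y n) = of_real \<kappa> * cinner x (w n)" if "x \<in> D" for x n
    using H.cinner_resolvent[OF that, of "\<kappa> *\<^sub>R w n"] by (simp add: y_def)
  have yDT: "y n \<in> DT \<and> T (y n) = \<kappa> *\<^sub>R w n - (c + 1) *\<^sub>R y n" for n
  proof (rule form_representation[OF yD])
    fix x assume x: "x \<in> D"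
    have "t (y n) x = cnj (t x (y n))" using swap[OF x yD] .
    also have "t x (y n) = of_real \<kappa> * cinner x (w n) - of_real (c + 1) * cinner x (y n)"
      using y[OF x, of n] by (simp add: form_shift_def algebra_simps)
    also have "cnj \<dots> = of_real \<kappa> * cinner (w n) x - of_real (c + 1) * cinner (y n) x"
      by (simp add: cinner_commute[of x])
    finally show "t (y n) x = cinner (\<kappa> *\<^sub>R w n - (c + 1) *\<^sub>R y n) x"
      by simp
  qed
  have weak_y: "weakly_tendsto_0 y" unfolding weakly_tendsto_0_def
  proof
    fix z
    have "cinner (y n) z = of_real \<kappa> * cinner (w n) (H.resolvent z)" for n
    proof -
      have "cinner (y n) z = cnj (form_shift t (c + 1) (H.resolvent z) (y n))"
        using H.cinner_resolvent[OF yD] H.swap[of "H.resolvent z" "y n"] yD by simp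
      also have "\<dots> = of_real \<kappa> * cinner (w n) (H.resolvent z)"
        by (simp add: y cinner_commute[of "H.resolvent z"])
      finally show ?thesis .
    qed
    moreover have "(\<lambda>n. of_real \<kappa> * cinner (w n) (H.resolvent z)) \<longlonglongrightarrow> of_real \<kappa> * 0"
      using weak_w unfolding weakly_tendsto_0_def by (intro tendsto_intros) blast
    ultimately show "(\<lambda>n. cinner (y n) z) \<longlonglongrightarrow> 0" by simp
  qed
  have y_sq: "(H.nrm (y n))\<^sup>2 = \<kappa> * Re (cinner (y n) (w n))" for n
    using H.nrm_power2[OF yD] y[OF yD, of n n] by simp
  have y_le: "H.nrm (y n) \<le> \<kappa>" for n
  proof -
    have "Re (cinner (y n) (w n)) \<le> norm (y n)"
      using cinner.Re_ip_le[of "y n" "w n"] w by simp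
    also have "\<dots> \<le> H.nrm (y n)" using H.norm_le_nrm[OF yD] .
    finally have "H.nrm (y n) * H.nrm (y n) \<le> \<kappa> * H.nrm (y n)"
      using y_sq[of n] \<kappa> mult_left_mono by (fastforce simp: power2_eq_square)
    then show ?thesis using H.nrm_nonneg[OF yD[of n]] \<kappa>
      by (cases "H.nrm (y n) = 0") (auto simp: mult_le_cancel_right)
  qed
  \<comment> \<open>Expanding both sides, the right exceeds the left by exactly \<kappa> times the
    squared ambient norm of \<open>w n - y n\<close>.\<close>
  have key: "(H.nrm (w n - y n))\<^sup>2 \<le> (Re (t (w n) (w n)) - m) - (Re (t (y n) (y n)) - m * (norm (y n))\<^sup>2)" for n
  proof -
    have 1: "(H.nrm (w n - y n))\<^sup>2 = (H.nrm (w n))\<^sup>2 - 2 * \<kappa> + (H.nrm (y n))\<^sup>2"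
      using H.Re_diag_diff[OF w(1)[of n] yD[of n]] y[OF w(1), of n n] w(2)[of n]
        H.nrm_power2[OF H.diff_mem[OF w(1)[of n] yD[of n]]] H.nrm_power2[OF w(1)[of n]] H.nrm_power2[OF yD[of n]]
      by (simp add: cinner_self del: H.diff_left H.diff_right)
    have 2: "(norm (w n - y n))\<^sup>2 = 1 - 2 * Re (cinner (y n) (w n)) + (norm (y n))\<^sup>2"
      using cinner.Re_diag_diff[of "w n" "y n"] w(2)[of n] cinner_commute[of "w n" "y n"]
      by (simp add: cinner_self del: cinner.diff_left cinner.diff_right)
    have 3: "(H.nrm (w n))\<^sup>2 = Re (t (w n) (w n)) + (c + 1)"
      using H.nrm_power2[OF w(1)[of n]] w(2)[of n] by (simp add: Re_form_shift_diag)
    have 4: "(H.nrm (y n))\<^sup>2 = Re (t (y n) (y n)) + (c + 1) * (norm (y n))\<^sup>2"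
      using H.nrm_power2[OF yD[of n]] by (simp add: Re_form_shift_diag)
    have "0 \<le> \<kappa> * (norm (w n - y n))\<^sup>2" using \<kappa> by simp
    then show ?thesis using 1 3 4 y_sq[of n] unfolding 2 by (simp add: \<kappa>_def algebra_simps)
  qed
  have "(\<lambda>n. H.nrm (w n - y n)) \<longlonglongrightarrow> 0" unfolding tendsto_iff
  proof (intro allI impI)
    fix e :: real assume e: "e > 0"
    define M where "M = \<kappa>\<^sup>2 + \<bar>c + 1\<bar> * \<kappa>\<^sup>2 + \<kappa>"
    have "y k \<in> D \<and> norm (y k) \<le> M \<and> Re (t (y k) (y k)) \<le> M" for k
    proof (intro conjI yD)
      have nk: "norm (y k) \<le> \<kappa>" using H.norm_le_nrm[OF yD[of k]] y_le[of k] by linarith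
      moreover have "0 \<le> \<kappa>\<^sup>2 + \<bar>c + 1\<bar> * \<kappa>\<^sup>2" by simp
      ultimately show "norm (y k) \<le> M" unfolding M_def by linarith
      have "\<bar>c + 1\<bar> * (norm (y k))\<^sup>2 \<le> \<bar>c + 1\<bar> * \<kappa>\<^sup>2"
        using nk by (intro mult_left_mono power_mono) auto
      moreover have "- (c + 1) * (norm (y k))\<^sup>2 \<le> \<bar>c + 1\<bar> * (norm (y k))\<^sup>2"
        by (intro mult_right_mono) auto
      moreover have "(H.nrm (y k))\<^sup>2 \<le> \<kappa>\<^sup>2" using y_le yD by (intro power_mono) auto
      moreover have "(H.nrm (y k))\<^sup>2 = Re (t (y k) (y k)) + (c + 1) * (norm (y k))\<^sup>2"
        using H.nrm_power2[OF yD[of k]] by (simp add: Re_form_shift_diag)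
      ultimately show "Re (t (y k) (y k)) \<le> M" using \<kappa> by (simp add: M_def algebra_simps)
    qed
    moreover have "e\<^sup>2 / 2 > 0" using e by simp
    ultimately have "\<forall>\<^sub>F k in sequentially. m * (norm (y k))\<^sup>2 - e\<^sup>2 / 2 \<le> Re (t (y k) (y k))"
      using good weak_y unfolding asymptotic_bound_def by blast
    moreover have "\<forall>\<^sub>F n in sequentially. 1 / real (Suc n) < e\<^sup>2 / 2"
      using lim1 e by (intro order_tendstoD(2)) auto
    ultimately show "\<forall>\<^sub>F n in sequentially. dist (H.nrm (w n - y n)) 0 < e"
    proof eventually_elim
      case (elim n)
      then have "(H.nrm (w n - y n))\<^sup>2 < e\<^sup>2" using key[of n] w(3)[of n] by linarith
      then have "H.nrm (w n - y n) < e" using e by (simp add: power_less_imp_less_base)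
      then show ?case using w yD by (simp del: H.diff_left)
    qed
  qed
  then have wy: "(\<lambda>n. norm (w n - y n)) \<longlonglongrightarrow> 0"
    by (rule Lim_null_comparison[rotated])
       (use H.norm_le_nrm H.diff_mem[OF w(1) yD] in \<open>auto intro!: always_eventually\<close>)
  have "\<forall>\<^sub>F n in sequentially. norm (w n - y n) < 1/2"
    using wy by (intro order_tendstoD(2)) auto
  then obtain N where N: "\<And>n. n \<ge> N \<Longrightarrow> norm (w n - y n) < 1/2"
    unfolding eventually_sequentially by blast
  have half: "norm (y (n + N)) > 1/2" for n
    using N[of "n + N"] norm_triangle_ineq2[of "w (n + N)" "y (n + N)"] w(2)[of "n + N"] by simp
  have inv_le: "1 / norm (y (n + N)) \<le> 2" for n
    using half[of n] by (simp add: divide_le_eq)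
  \<comment> \<open>From \<open>N\<close> on the norms of \<open>y\<close> exceed 1/2, so
    normalizing at most doubles every error.\<close>
  define z where "z n = (1 / norm (y (n + N))) *\<^sub>R y (n + N)" for n
  have zT: "z n \<in> DT \<and> T (z n) = (1 / norm (y (n + N))) *\<^sub>R T (y (n + N))" for n
    using linear_op yDT unfolding linear_operator_def csubspace_def z_def
    by (metis scaleC_of_real)
  have "norm (z n) = 1" for n using half[of n] by (auto simp: z_def)
  moreover have "weakly_tendsto_0 z" unfolding weakly_tendsto_0_def
  proof
    fix v
    have "(\<lambda>n. cinner (y n) v) \<longlonglongrightarrow> 0" using weak_y unfolding weakly_tendsto_0_def by blast
    then have "(\<lambda>n. cmod (cinner (y (n + N)) v)) \<longlonglongrightarrow> 0"
      by (intro tendsto_norm_zero LIMSEQ_ignore_initial_segment)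
    then have "(\<lambda>n. 2 * cmod (cinner (y (n + N)) v)) \<longlonglongrightarrow> 2 * 0" by (intro tendsto_intros)
    then have "(\<lambda>n. 2 * cmod (cinner (y (n + N)) v)) \<longlonglongrightarrow> 0" by simp
    then show "(\<lambda>n. cinner (z n) v) \<longlonglongrightarrow> 0"
    proof (rule Lim_null_comparison[rotated], intro always_eventually allI)
      fix n
      have "cmod (cinner (z n) v) = 1 / norm (y (n + N)) * cmod (cinner (y (n + N)) v)"
        by (simp add: z_def norm_mult norm_divide)
      then show "cmod (cinner (z n) v) \<le> 2 * cmod (cinner (y (n + N)) v)"
        using mult_right_mono[OF inv_le[of n], of "cmod (cinner (y (n + N)) v)"] by simp
    qed
  qed
  moreover have "(\<lambda>n. norm (T (z n) - complex_of_real m *\<^sub>C z n)) \<longlonglongrightarrow> 0"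
  proof -
    have "(\<lambda>n. 2 * \<kappa> * norm (w (n + N) - y (n + N))) \<longlonglongrightarrow> 2 * \<kappa> * 0"
      by (intro tendsto_intros LIMSEQ_ignore_initial_segment wy)
    then have lim: "(\<lambda>n. 2 * \<kappa> * norm (w (n + N) - y (n + N))) \<longlonglongrightarrow> 0" by simp
    show ?thesis
    proof (rule Lim_null_comparison[OF _ lim], intro always_eventually allI)
      fix n
      let ?y = "y (n + N)" and ?w = "w (n + N)"
      have "T ?y - m *\<^sub>R ?y = \<kappa> *\<^sub>R (?w - ?y)"
        using yDT[of "n + N"] by (simp add: \<kappa>_def algebra_simps)
      moreover have "T (z n) - m *\<^sub>R z n = (1 / norm ?y) *\<^sub>R (T ?y - m *\<^sub>R ?y)"
        using zT[of n] by (simp add: z_def scaleR_diff_right mult.commute)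
      ultimately have "norm (T (z n) - m *\<^sub>R z n) = 1 / norm ?y * (\<kappa> * norm (?w - ?y))"
        using \<kappa> by simp
      also have "\<dots> \<le> 2 * (\<kappa> * norm (?w - ?y))"
        using \<kappa> by (intro mult_right_mono inv_le) simp
      finally show "norm (norm (T (z n) - complex_of_real m *\<^sub>C z n)) \<le> 2 * \<kappa> * norm (?w - ?y)"
        by (simp add: scaleC_of_real)
    qed
  qed
  ultimately show ?thesis using zT unfolding essential_spectrum_def by blast
qed

text \<open>The valid bounds have a supremum that is itself valid and lies in the essential
  spectrum. If s were invalid, this supremum would be a spectral point below the minimum.\<close>

theorem essential_spectrum_lower_bound:
  assumes "is_min_essential_spectrum DT T s"
  shows "asymptotic_bound s"
proof (rule ccontr)
  assume not: "\<not> asymptotic_bound s"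
  obtain c where lower: "\<And>x. x \<in> D \<Longrightarrow> - c * (norm x)\<^sup>2 \<le> Re (t x x)"
    and hilb: "hilbert_form D (form_shift t (c + 1))" using shift_exists by blast
  define S where "S = {\<mu>. asymptotic_bound \<mu>}"
  have c: "- c \<in> S" unfolding S_def asymptotic_bound_def
    using lower by (auto intro!: always_eventually) (smt (verit))
  have less: "\<mu> < s" if "\<mu> \<in> S" for \<mu>
    using that not asymptotic_bound_antimono[of \<mu> s] unfolding S_def by force
  have bdd: "bdd_above S" using less less_imp_le by (intro bdd_aboveI[of _ s]) blast
  have good: "asymptotic_bound (Sup S)"
    by (rule asymptotic_bound_Sup) (use c bdd in \<open>auto simp: S_def\<close>)
  have "complex_of_real (Sup S) \<in> essential_spectrum DT T"
  proof (rule optimal_bound_in_essential_spectrum[OF lower hilb good])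
    show "- c \<le> Sup S" by (rule cSup_upper[OF c bdd])
    show "\<not> asymptotic_bound (Sup S + \<eta>)" if "\<eta> > 0" for \<eta>
      using cSup_upper[OF _ bdd, of "Sup S + \<eta>"] that by (auto simp: S_def)
  qed
  then have "s \<le> Sup S" using assms unfolding is_min_essential_spectrum_def by blast
  moreover have "Sup S < s" using less good by (simp add: S_def)
  ultimately show False by simp
qed

end

section \<open>Compactness of eigenvectors\<close>

lemma norm_diff_weak_limit:
  fixes x :: "nat \<Rightarrow> 'a::complex_hilbert_space"
  assumes "\<And>n. norm (x n) = 1" "\<And>y. (\<lambda>n. cinner (x n) y) \<longlonglongrightarrow> cinner u y"
  shows "(\<lambda>n. (norm (x n - u))\<^sup>2) \<longlonglongrightarrow> 1 - (norm u)\<^sup>2"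
proof -
  have "(norm (x n - u))\<^sup>2 = 1 - 2 * Re (cinner (x n) u) + (norm u)\<^sup>2" for n
    using cinner.Re_diag_diff[of "x n" u] assms(1)[of n]
    by (simp add: cinner_self del: cinner.diff_left cinner.diff_right)
  moreover have "(\<lambda>n. 1 - 2 * Re (cinner (x n) u) + (norm u)\<^sup>2) \<longlonglongrightarrow> 1 - 2 * Re (cinner u u) + (norm u)\<^sup>2"
    by (intro tendsto_intros assms)
  ultimately show ?thesis by (simp add: cinner_self)
qed

lemma weakly_null_diff:
  assumes "\<And>y. (\<lambda>n. cinner (x n) y) \<longlonglongrightarrow> cinner u y"
  shows "weakly_tendsto_0 (\<lambda>n. x n - u)"
  unfolding weakly_tendsto_0_def using LIM_zero[OF assms] by simp

lemma weak_limit_imp_strong_limit: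
  fixes x :: "nat \<Rightarrow> 'a::complex_hilbert_space"
  assumes "\<And>n. norm (x n) = 1" "\<And>y. (\<lambda>n. cinner (x n) y) \<longlonglongrightarrow> cinner u y" "1 \<le> (norm u)\<^sup>2"
  shows "norm u = 1" "x \<longlonglongrightarrow> u"
proof -
  note lim = norm_diff_weak_limit[OF assms(1,2)]
  have "0 \<le> 1 - (norm u)\<^sup>2" using lim by (rule LIMSEQ_le_const) auto
  then have nu: "(norm u)\<^sup>2 = 1" using assms(3) by linarith
  then show "norm u = 1" using power2_eq_iff_nonneg[of "norm u" 1] by simp
  have "(\<lambda>n. norm (x n - u)) \<longlonglongrightarrow> 0" using tendsto_real_sqrt[OF lim] nu by simp
  then show "x \<longlonglongrightarrow> u" by (rule LIM_zero_cancel[OF tendsto_norm_zero_cancel])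
qed

text \<open>All estimates use the norm of the shifted form at time 0. The factor (s + t) in
  \<open>taylor\<close> serves two purposes: with t = 0 the remainder is quadratic, and for two
  nearby times around t > 0 the difference quotient is compared with the time-0 coefficient
  \<open>a1\<close> up to O(t). \<open>coercive\<close> bounds this norm by form values at any
  time.\<close>

locale form_family = hilbert_form D "form_shift (a 0) c"
  for D :: "'a::complex_hilbert_space set" and a :: "real \<Rightarrow> 'a \<Rightarrow> 'a \<Rightarrow> complex" and c :: real +
  fixes a1 :: "'a \<Rightarrow> 'a \<Rightarrow> complex" and \<rho> K :: real
  assumes rho: "\<rho> > 0" and K: "K \<ge> 0"
    and a_sym: "\<And>t. 0 \<le> t \<Longrightarrow> t < \<rho> \<Longrightarrow> symmetric_sesquilinear D (a t)"
    and a1_sym: "symmetric_sesquilinear D a1"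
    and a1_bdd: "\<And>x y. x \<in> D \<Longrightarrow> y \<in> D \<Longrightarrow> cmod (a1 x y) \<le> K * nrm x * nrm y"
    and taylor: "\<And>s t x y. 0 \<le> s \<Longrightarrow> s < \<rho> \<Longrightarrow> 0 \<le> t \<Longrightarrow> t < \<rho> \<Longrightarrow> x \<in> D \<Longrightarrow> y \<in> D \<Longrightarrow>
      cmod (a s x y - a t x y - of_real (s - t) * a1 x y) \<le> K * \<bar>s - t\<bar> * (s + t) * nrm x * nrm y"
    and coercive: "\<And>t x. 0 \<le> t \<Longrightarrow> t < \<rho> \<Longrightarrow> x \<in> D \<Longrightarrow>
      (nrm x)\<^sup>2 / 2 \<le> Re (a t x x) + c * (norm x)\<^sup>2"
begin

section \<open>Lipschitz and Taylor estimates in the form norm\<close>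

sublocale a1: symmetric_sesquilinear D a1 by (rule a1_sym)

definition N :: "'a set" where "N = {u\<in>D. \<forall>y\<in>D. a 0 u y = 0}"

lemma a_lipschitz:
  assumes st: "0 \<le> s" "s < \<rho>" "0 \<le> t" "t < \<rho>" and xy: "x \<in> D" "y \<in> D"
  shows "cmod (a s x y - a t x y) \<le> K * (1 + 2 * \<rho>) * \<bar>s - t\<bar> * nrm x * nrm y"
proof -
  have "cmod (a s x y - a t x y) \<le> cmod (a s x y - a t x y - of_real (s - t) * a1 x y)
      + cmod (of_real (s - t) * a1 x y)"
    using norm_triangle_ineq[of "a s x y - a t x y - of_real (s - t) * a1 x y" "of_real (s - t) * a1 x y"]
    by simp
  also have "cmod (of_real (s - t) * a1 x y) \<le> \<bar>s - t\<bar> * (K * nrm x * nrm y)"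
    unfolding norm_mult norm_of_real using a1_bdd[OF xy] by (intro mult_left_mono) auto
  also have "cmod (a s x y - a t x y - of_real (s - t) * a1 x y) \<le> K * \<bar>s - t\<bar> * (s + t) * nrm x * nrm y"
    by (rule taylor[OF st xy])
  also have "\<dots> \<le> K * \<bar>s - t\<bar> * (2 * \<rho>) * nrm x * nrm y"
    using st xy K by (intro mult_right_mono mult_left_mono) auto
  finally show ?thesis by (simp add: algebra_simps)
qed

lemma a_bdd:
  assumes t: "0 \<le> t" "t < \<rho>" and xy: "x \<in> D" "y \<in> D"
  shows "cmod (a t x y) \<le> (1 + \<bar>c\<bar> + K * (1 + 2 * \<rho>) * \<rho>) * nrm x * nrm y"
proof -
  have 1: "cmod (a 0 x y) \<le> (1 + \<bar>c\<bar>) * (nrm x * nrm y)"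
    by (rule form_bound[OF hilbert_form_axioms xy])
  have "cmod (a t x y - a 0 x y) \<le> K * (1 + 2 * \<rho>) * \<bar>t - 0\<bar> * nrm x * nrm y"
    using t xy rho by (intro a_lipschitz) auto
  also have "\<dots> \<le> K * (1 + 2 * \<rho>) * \<rho> * nrm x * nrm y"
    using t xy K rho by (intro mult_right_mono mult_left_mono) auto
  finally have "cmod (a t x y) \<le> cmod (a 0 x y) + K * (1 + 2 * \<rho>) * \<rho> * nrm x * nrm y"
    using norm_triangle_ineq2[of "a t x y" "a 0 x y"] by linarith
  with 1 show ?thesis by (simp add: algebra_simps)
qed

lemma a_diag_lipschitz:
  assumes st: "0 \<le> s" "s < \<rho>" "0 \<le> t" "t < \<rho>" and x: "x \<in> D" and M: "nrm x \<le> M"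
  shows "\<bar>Re (a s x x) - Re (a t x x)\<bar> \<le> K * (1 + 2 * \<rho>) * M\<^sup>2 * \<bar>s - t\<bar>"
proof -
  have "\<bar>Re (a s x x - a t x x)\<bar> \<le> K * (1 + 2 * \<rho>) * \<bar>s - t\<bar> * nrm x * nrm x"
    by (rule order_trans[OF abs_Re_le_cmod a_lipschitz[OF st x x]])
  also have "\<dots> = (K * (1 + 2 * \<rho>) * \<bar>s - t\<bar>) * (nrm x)\<^sup>2" by (simp add: power2_eq_square)
  also have "\<dots> \<le> (K * (1 + 2 * \<rho>) * \<bar>s - t\<bar>) * M\<^sup>2"
    using K rho x M by (intro mult_left_mono power_mono) auto
  finally show ?thesis by (simp add: mult_ac)
qed

lemma taylor_diag:
  assumes t: "0 \<le> t" "t < \<rho>" and x: "x \<in> D" and M: "nrm x \<le> M"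
  shows "\<bar>Re (a t x x) - Re (a 0 x x) - t * Re (a1 x x)\<bar> \<le> K * t\<^sup>2 * M\<^sup>2"
proof -
  have "\<bar>Re (a t x x - a 0 x x - of_real (t - 0) * a1 x x)\<bar> \<le> K * \<bar>t - 0\<bar> * (t + 0) * nrm x * nrm x"
    using t rho x by (intro order_trans[OF abs_Re_le_cmod] taylor) auto
  also have "\<dots> = K * t\<^sup>2 * (nrm x)\<^sup>2" using t by (simp add: power2_eq_square)
  also have "\<dots> \<le> K * t\<^sup>2 * M\<^sup>2" using K x M by (intro mult_left_mono power_mono) auto
  finally show ?thesis by simp
qed

end

text \<open>\<open>ess_bound\<close> and \<open>weyl\<close> are the two halves of \<Sigma> being
  the minimum of the essential spectrum, put in terms of forms: no weakly null sequence does better,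
  and some sequence attains it. \<open>ev_le\<close> yields one form-norm bound for all unit
  eigenvectors; \<open>gap\<close> is the negative lower limit.\<close>

locale threshold_family = form_family +
  fixes \<Sigma> ev :: "real \<Rightarrow> real"
  assumes ess_bound: "\<And>t u M \<delta>. 0 \<le> t \<Longrightarrow> t < \<rho> \<Longrightarrow>
      (\<And>k::nat. u k \<in> D \<and> norm (u k) \<le> M \<and> Re (a t (u k) (u k)) \<le> M) \<Longrightarrow>
      weakly_tendsto_0 u \<Longrightarrow> \<delta> > 0 \<Longrightarrow>
      \<forall>\<^sub>F k in sequentially. \<Sigma> t * (norm (u k))\<^sup>2 - \<delta> \<le> Re (a t (u k) (u k))"
    and weyl: "\<And>t. 0 \<le> t \<Longrightarrow> t < \<rho> \<Longrightarrow>
      \<exists>z. (\<forall>n. z n \<in> D \<and> norm (z n) = 1 \<and> Re (a t (z n) (z n)) \<le> \<Sigma> t + 1) \<and>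
        weakly_tendsto_0 z \<and> (\<lambda>n. Re (a t (z n) (z n))) \<longlonglongrightarrow> \<Sigma> t"
    and Sigma_0: "\<Sigma> 0 = 0"
    and eigenvector: "\<And>t. 0 < t \<Longrightarrow> t < \<rho> \<Longrightarrow>
      \<exists>x\<in>D. norm x = 1 \<and> (\<forall>y\<in>D. a t x y = of_real (ev t) * cinner x y)"
    and below: "\<And>t. 0 < t \<Longrightarrow> t < \<rho> \<Longrightarrow> ev t < \<Sigma> t"
    and ev_le: "\<And>t. 0 < t \<Longrightarrow> t < \<rho> \<Longrightarrow> ev t \<le> 1"
    and cont: "continuous_on {0<..<\<rho>} ev"
    and lim: "(ev \<longlongrightarrow> 0) (at_right 0)"
    and gap: "\<exists>\<gamma>>0. \<exists>\<^sub>F t in at_right 0. ev t < \<Sigma> t - \<gamma> * t"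
begin

section \<open>The threshold near time 0\<close>

lemma ess_bound_nrm:
  assumes t: "0 \<le> t" "t < \<rho>" and u: "\<And>k::nat. u k \<in> D" "\<And>k. nrm (u k) \<le> M"
    and weak: "weakly_tendsto_0 u" and \<delta>: "\<delta> > 0"
  shows "\<forall>\<^sub>F k in sequentially. \<Sigma> t * (norm (u k))\<^sup>2 - \<delta> \<le> Re (a t (u k) (u k))"
proof (rule ess_bound[OF t _ weak \<delta>])
  fix k
  define C where "C = 1 + \<bar>c\<bar> + K * (1 + 2 * \<rho>) * \<rho>"
  have C: "C \<ge> 0" using K rho by (simp add: C_def)
  have M: "M \<ge> 0" using u(2)[of 0] nrm_nonneg[OF u(1)[of 0]] by linarith
  have "Re (a t (u k) (u k)) \<le> C * nrm (u k) * nrm (u k)"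
    using a_bdd[OF t u(1) u(1), of k k] complex_Re_le_cmod[of "a t (u k) (u k)"]
    unfolding C_def by linarith
  also have "\<dots> \<le> C * M * M" using C u M by (intro mult_mono) auto
  finally have "Re (a t (u k) (u k)) \<le> C * M * M" .
  moreover have "norm (u k) \<le> M" using norm_le_nrm[OF u(1)[of k]] u(2)[of k] by linarith
  moreover have "0 \<le> C * M * M" using C M by simp
  ultimately show "u k \<in> D \<and> norm (u k) \<le> C * M * M + M \<and> Re (a t (u k) (u k)) \<le> C * M * M + M"
    using u(1)[of k] M by linarith
qed

lemma nrm_le_of_form_le:
  assumes "0 \<le> t" "t < \<rho>" "x \<in> D" "norm x = 1" "Re (a t x x) \<le> b"
  shows "nrm x \<le> sqrt (2 * (b + \<bar>c\<bar>))"
  using coercive[OF assms(1-3)] assms(4,5) by (intro real_le_rsqrt) simp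

text \<open>A Weyl sequence of time 0 is a trial sequence at time t, where its form values have
  moved by O(t).\<close>

lemma Sigma_upper: "\<exists>C. \<forall>t. 0 < t \<longrightarrow> t < \<rho> \<longrightarrow> \<Sigma> t \<le> C * t"
proof -
  obtain z where z: "\<And>n. z n \<in> D" "\<And>n. norm (z n) = 1" "\<And>n. Re (a 0 (z n) (z n)) \<le> 1"
    and weak: "weakly_tendsto_0 z" and z0: "(\<lambda>n. Re (a 0 (z n) (z n))) \<longlonglongrightarrow> 0"
    using weyl[of 0] rho Sigma_0 by auto
  define M where "M = sqrt (2 * (1 + \<bar>c\<bar>))"
  have zM: "nrm (z n) \<le> M" for n
    unfolding M_def by (rule nrm_le_of_form_le[OF _ rho z(1-3)]) simp
  have "\<Sigma> t \<le> K * (1 + 2 * \<rho>) * M\<^sup>2 * t" if t: "0 < t" "t < \<rho>" for t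
  proof (rule field_le_epsilon)
    fix e :: real assume e: "e > 0"
    have "\<forall>\<^sub>F n in sequentially. \<Sigma> t * (norm (z n))\<^sup>2 - e/2 \<le> Re (a t (z n) (z n))"
      using t e by (intro ess_bound_nrm[OF _ _ z(1) zM weak]) auto
    moreover have "\<forall>\<^sub>F n in sequentially. Re (a 0 (z n) (z n)) < e/2"
      using z0 e by (intro order_tendstoD(2)) auto
    ultimately obtain n where n: "\<Sigma> t - e/2 \<le> Re (a t (z n) (z n))" "Re (a 0 (z n) (z n)) < e/2"
      using eventually_happens[OF eventually_conj] z(2) by fastforce
    then show "\<Sigma> t \<le> K * (1 + 2 * \<rho>) * M\<^sup>2 * t + e"
      using a_diag_lipschitz[OF less_imp_le[OF t(1)] t(2) order_refl rho z(1) zM, of n] t(1) by simp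
  qed
  then show ?thesis by blast
qed

text \<open>The roles are exchanged: Weyl sequences of time t are tested at time 0. The linear upper
  bound comes first because it keeps these sequences form-bounded uniformly in t.\<close>

lemma Sigma_lower: "\<exists>C. \<forall>t. 0 < t \<longrightarrow> t < \<rho> \<longrightarrow> - C * t \<le> \<Sigma> t"
proof -
  obtain C where C: "\<And>t. 0 < t \<Longrightarrow> t < \<rho> \<Longrightarrow> \<Sigma> t \<le> C * t" using Sigma_upper by blast
  define M where "M = sqrt (2 * (\<bar>C\<bar> * \<rho> + 1 + \<bar>c\<bar>))"
  have "- (K * (1 + 2 * \<rho>) * M\<^sup>2) * t \<le> \<Sigma> t" if t: "0 < t" "t < \<rho>" for t
  proof (rule field_le_epsilon)
    fix e :: real assume e: "e > 0"
    obtain z where z: "\<And>n. z n \<in> D" "\<And>n. norm (z n) = 1" "\<And>n. Re (a t (z n) (z n)) \<le> \<Sigma> t + 1"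
      and weak: "weakly_tendsto_0 z" and zt: "(\<lambda>n. Re (a t (z n) (z n))) \<longlonglongrightarrow> \<Sigma> t"
      using weyl[of t] t by auto
    have "C * t \<le> \<bar>C\<bar> * \<rho>" using t by (intro mult_mono) auto
    then have zM: "nrm (z n) \<le> M" for n
      using nrm_le_of_form_le[of t "z n" "\<bar>C\<bar> * \<rho> + 1"] t z(1,2) z(3)[of n] C[OF t] by (simp add: M_def)
    have "\<forall>\<^sub>F n in sequentially. \<Sigma> 0 * (norm (z n))\<^sup>2 - e/2 \<le> Re (a 0 (z n) (z n))"
      using rho e by (intro ess_bound_nrm[OF _ _ z(1) zM weak]) auto
    moreover have "\<forall>\<^sub>F n in sequentially. Re (a t (z n) (z n)) < \<Sigma> t + e/2"
      using zt e by (intro order_tendstoD(2)) auto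
    ultimately obtain n where n: "- e/2 \<le> Re (a 0 (z n) (z n))" "Re (a t (z n) (z n)) < \<Sigma> t + e/2"
      using eventually_happens[OF eventually_conj] z(2) Sigma_0 by fastforce
    then show "- (K * (1 + 2 * \<rho>) * M\<^sup>2) * t \<le> \<Sigma> t + e"
      using a_diag_lipschitz[OF less_imp_le[OF t(1)] t(2) order_refl rho z(1) zM, of n] t(1) by simp
  qed
  then show ?thesis by blast
qed

text \<open>The linear bounds confine \<Sigma>(t)/t to a compact interval, so its values converge
  along a subsequence of times at which the gap holds.\<close>

lemma slope_sequence:
  "\<exists>s \<sigma> \<gamma>. \<gamma> > 0 \<and> (\<forall>k::nat. 0 < s k \<and> s k < \<rho> \<and> ev (s k) < \<Sigma> (s k) - \<gamma> * s k) \<and>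
     s \<longlonglongrightarrow> 0 \<and> (\<lambda>k. \<Sigma> (s k) / s k) \<longlonglongrightarrow> \<sigma>"
proof -
  obtain \<gamma> where \<gamma>: "\<gamma> > 0" "\<exists>\<^sub>F t in at_right 0. ev t < \<Sigma> t - \<gamma> * t" using gap by blast
  have "\<exists>t. 0 < t \<and> t < \<rho> \<and> t < 1 / Suc k \<and> ev t < \<Sigma> t - \<gamma> * t" for k :: nat
  proof -
    have "\<forall>\<^sub>F t in at_right 0. 0 < t \<and> t < min \<rho> (1 / Suc k)"
      using eventually_at_right_real[of 0 "min \<rho> (1 / Suc k)"] rho by (auto elim: eventually_mono)
    from frequently_ex[OF frequently_eventually_frequently[OF \<gamma>(2) this]] show ?thesis by auto
  qed
  then obtain s where s: "\<And>k. 0 < s k" "\<And>k. s k < \<rho>" "\<And>k::nat. s k < 1 / Suc k"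
    "\<And>k. ev (s k) < \<Sigma> (s k) - \<gamma> * s k" by metis
  have s0: "s \<longlonglongrightarrow> 0"
    by (rule tendsto_sandwich[OF _ _ tendsto_const LIMSEQ_Suc[OF lim_1_over_n]])
       (use s in \<open>auto intro!: always_eventually less_imp_le\<close>)
  obtain C where C: "\<And>t. 0 < t \<Longrightarrow> t < \<rho> \<Longrightarrow> \<Sigma> t \<le> C * t" using Sigma_upper by blast
  obtain C' where C': "\<And>t. 0 < t \<Longrightarrow> t < \<rho> \<Longrightarrow> - C' * t \<le> \<Sigma> t" using Sigma_lower by blast
  have "\<Sigma> (s k) / s k \<in> {- C'..C}" for k
    using C[OF s(1,2), of k] C'[OF s(1,2), of k] s(1)[of k] by (simp add: field_simps)
  then obtain \<sigma> r where r: "strict_mono (r::nat\<Rightarrow>nat)" "((\<lambda>k. \<Sigma> (s k) / s k) \<circ> r) \<longlonglongrightarrow> \<sigma>"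
    using compact_Icc[of "-C'" C] unfolding compact_def by (metis (no_types, lifting))
  show ?thesis
    using \<gamma>(1) s(1,2,4) r(2) LIMSEQ_subseq_LIMSEQ[OF s0 r(1)]
    by (intro exI[of _ "s \<circ> r"] exI[of _ \<sigma>] exI[of _ \<gamma>]) (auto simp: o_def)
qed

text \<open>\<Sigma> has slope about \<sigma> at a suitable small time, while the sequence has
  vanishing energy at time 0; the difference of the two energies must be carried by
  \<open>a1\<close>.\<close>

lemma a1_asymptotic_bound:
  assumes s: "\<And>k::nat. 0 < s k" "\<And>k. s k < \<rho>" "s \<longlonglongrightarrow> 0" "(\<lambda>k. \<Sigma> (s k) / s k) \<longlonglongrightarrow> \<sigma>"
    and z: "\<And>n::nat. z n \<in> D" "\<And>n. nrm (z n) \<le> M" "weakly_tendsto_0 z"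
      "(\<lambda>n. Re (a 0 (z n) (z n))) \<longlonglongrightarrow> 0" and \<delta>: "\<delta> > 0"
  shows "\<forall>\<^sub>F n in sequentially. \<sigma> * (norm (z n))\<^sup>2 - \<delta> \<le> Re (a1 (z n) (z n))"
proof -
  \<comment> \<open>Chosen so that both d M^2 and K d M^2 are at most \<delta>/4; the added ones
    exclude division by 0.\<close>
  define d where "d = \<delta> / (4 * (M\<^sup>2 + 1) * (K + 1))"
  have M1: "M\<^sup>2 + 1 > 0" by (simp add: add_nonneg_pos)
  have d: "d > 0" using \<delta> K M1 by (simp add: d_def)
  have d_eq: "(M\<^sup>2 + 1) * ((K + 1) * d) = \<delta> / 4"
  proof -
    have "(K + 1) \<noteq> 0" "M\<^sup>2 + 1 \<noteq> 0" using M1 K by auto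
    then show ?thesis unfolding d_def by (simp only: times_divide_eq_right) (simp add: divide_eq_eq)
  qed
  have dM: "d * M\<^sup>2 \<le> \<delta> / 4" "K * d * M\<^sup>2 \<le> \<delta> / 4"
  proof -
    have "M\<^sup>2 * (1 * d) \<le> (M\<^sup>2 + 1) * ((K + 1) * d)" using K d by (intro mult_mono) auto
    then show "d * M\<^sup>2 \<le> \<delta> / 4" unfolding d_eq by (simp add: mult.commute)
    have "M\<^sup>2 * (K * d) \<le> (M\<^sup>2 + 1) * ((K + 1) * d)" using K d by (intro mult_mono) auto
    then show "K * d * M\<^sup>2 \<le> \<delta> / 4" unfolding d_eq by (simp add: mult.commute)
  qed
  have "\<forall>\<^sub>F k in sequentially. s k < d" using s(3) d by (intro order_tendstoD(2))
  moreover have "\<forall>\<^sub>F k in sequentially. \<sigma> - d < \<Sigma> (s k) / s k"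
    using s(4) d by (intro order_tendstoD(1)) auto
  \<comment> \<open>The time is fixed here, before n grows, so that the o(1) errors in n may
    afterwards be taken small relative to it.\<close>
  ultimately obtain k where k: "s k < d" "\<sigma> - d < \<Sigma> (s k) / s k"
    using eventually_happens[OF eventually_conj] by fastforce
  define r where "r = s k"
  have r: "0 < r" "r < \<rho>" "r < d" "(\<sigma> - d) * r < \<Sigma> r"
    using s(1,2) k by (auto simp: r_def pos_less_divide_eq)
  have "\<forall>\<^sub>F n in sequentially. \<Sigma> r * (norm (z n))\<^sup>2 - r * \<delta> / 4 \<le> Re (a r (z n) (z n))"
    using r \<delta> by (intro ess_bound_nrm[OF _ _ z(1,2,3)]) auto
  moreover have "\<forall>\<^sub>F n in sequentially. Re (a 0 (z n) (z n)) < r * \<delta> / 4"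
    using z(4) r \<delta> by (intro order_tendstoD(2)) auto
  ultimately show ?thesis
  proof eventually_elim
    case (elim n)
    have nz: "(norm (z n))\<^sup>2 \<le> M\<^sup>2"
      using norm_le_nrm[OF z(1)[of n]] z(2)[of n] by (intro power_mono) auto
    have "r * (\<sigma> * (norm (z n))\<^sup>2) - r * (\<delta> / 4) \<le> r * (\<sigma> * (norm (z n))\<^sup>2) - r * (d * (norm (z n))\<^sup>2)"
    proof -
      have "d * (norm (z n))\<^sup>2 \<le> d * M\<^sup>2" using nz d by (intro mult_left_mono) auto
      then show ?thesis using dM(1) r(1) by simp
    qed
    also have "\<dots> = (\<sigma> - d) * r * (norm (z n))\<^sup>2" by (simp add: algebra_simps)
    also have "\<dots> \<le> \<Sigma> r * (norm (z n))\<^sup>2" using r by (intro mult_right_mono) auto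
    finally have 1: "r * (\<sigma> * (norm (z n))\<^sup>2) - r * (\<delta> / 4) \<le> \<Sigma> r * (norm (z n))\<^sup>2" .
    have "K * r\<^sup>2 * M\<^sup>2 = r * (K * r * M\<^sup>2)" by (simp add: power2_eq_square)
    also have "\<dots> \<le> r * (K * d * M\<^sup>2)"
      using r K by (intro mult_left_mono mult_right_mono) auto
    also have "\<dots> \<le> r * (\<delta> / 4)" using dM(2) r by (intro mult_left_mono) auto
    finally have 2: "K * r\<^sup>2 * M\<^sup>2 \<le> r * (\<delta> / 4)" .
    \<comment> \<open>Four errors of r \<delta>/4 add up: slope of \<Sigma>, essential bound, energy
      at time 0, Taylor remainder.\<close>
    have "r * (\<sigma> * (norm (z n))\<^sup>2 - \<delta>) \<le> r * Re (a1 (z n) (z n))"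
      using 1 2 elim taylor_diag[OF _ r(2) z(1) z(2), of n] r(1) by (simp add: algebra_simps)
    then show ?case using r(1) by simp
  qed
qed

section \<open>Limits of eigenvectors\<close>

definition eig :: "real \<Rightarrow> 'a \<Rightarrow> bool" where
  "eig t x \<longleftrightarrow> x \<in> D \<and> norm x = 1 \<and> (\<forall>y\<in>D. a t x y = of_real (ev t) * cinner x y)"

lemma eig_exists: "0 < t \<Longrightarrow> t < \<rho> \<Longrightarrow> \<exists>x. eig t x"
  using eigenvector unfolding eig_def by blast

text \<open>Common form-norm bound of the unit eigenvectors, from coercivity with form value at most
  1.\<close>

definition M0 :: real where "M0 = sqrt (2 * (1 + \<bar>c\<bar>))"

lemma M0: "M0 \<ge> 0" by (simp add: M0_def)

lemma eig_nrm: "0 < t \<Longrightarrow> t < \<rho> \<Longrightarrow> eig t x \<Longrightarrow> nrm x \<le> M0"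
  using nrm_le_of_form_le[of t x 1] ev_le[of t] unfolding eig_def M0_def
  by (auto simp: cinner_self)

lemma eig_weak_limit:
  assumes t: "\<And>n::nat. 0 < t n" "\<And>n. t n < \<rho>" "t \<longlonglongrightarrow> t'" "t' < \<rho>"
    and x: "\<And>n. eig (t n) (x n)" and ev: "(\<lambda>n. ev (t n)) \<longlonglongrightarrow> l"
  shows "\<exists>r u. strict_mono (r::nat\<Rightarrow>nat) \<and> u \<in> D \<and>
    (\<forall>y\<in>D. (\<lambda>n. form_shift (a 0) c (x (r n)) y) \<longlonglongrightarrow> form_shift (a 0) c u y) \<and>
    (\<forall>y\<in>D. a t' u y = of_real l * cinner u y)"
proof -
  have t'0: "0 \<le> t'" using t(1) less_imp_le by (intro LIMSEQ_le_const[OF t(3)]) blast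
  have xD: "x n \<in> D" for n using x by (simp add: eig_def)
  have xM: "nrm (x n) \<le> M0" for n using eig_nrm[OF t(1,2) x] .
  obtain r u where r: "strict_mono (r::nat\<Rightarrow>nat)" and u: "u \<in> D"
    and w: "\<And>y. y \<in> D \<Longrightarrow> (\<lambda>n. form_shift (a 0) c (x (r n)) y) \<longlonglongrightarrow> form_shift (a 0) c u y"
    using weak_compactness[of x M0] xD xM by blast
  have "a t' u y = of_real l * cinner u y" if y: "y \<in> D" for y
  proof -
    interpret at: symmetric_sesquilinear D "a t'" using a_sym[OF t'0 t(4)] .
    have 1: "(\<lambda>n. a t' (x (r n)) y) \<longlonglongrightarrow> a t' u y"
      by (rule weak_tendsto_sesquilinear[OF xD u w at.sesq a_bdd[OF t'0 t(4)] y])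
    have tr: "(\<lambda>n. t (r n)) \<longlonglongrightarrow> t'" using LIMSEQ_subseq_LIMSEQ[OF t(3) r] by (simp add: o_def)
    have "(\<lambda>n. K * (1 + 2 * \<rho>) * \<bar>t (r n) - t'\<bar> * M0 * nrm y) \<longlonglongrightarrow> 0"
      by (intro tendsto_mult_left_zero tendsto_mult_right_zero tendsto_rabs_zero LIM_zero tr)
    then have 2: "(\<lambda>n. a (t (r n)) (x (r n)) y - a t' (x (r n)) y) \<longlonglongrightarrow> 0"
    proof (rule Lim_null_comparison[rotated], intro always_eventually allI)
      fix n
      have "cmod (a (t (r n)) (x (r n)) y - a t' (x (r n)) y) \<le> K * (1 + 2 * \<rho>) * \<bar>t (r n) - t'\<bar> * nrm (x (r n)) * nrm y"
        using a_lipschitz[OF _ t(2) t'0 t(4) xD y] t(1) less_imp_le by blast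
      also have "\<dots> \<le> K * (1 + 2 * \<rho>) * \<bar>t (r n) - t'\<bar> * M0 * nrm y"
        using xM K rho y by (intro mult_right_mono mult_left_mono) auto
      finally show "cmod (a (t (r n)) (x (r n)) y - a t' (x (r n)) y) \<le> K * (1 + 2 * \<rho>) * \<bar>t (r n) - t'\<bar> * M0 * nrm y" .
    qed
    have "(\<lambda>n. ev (t (r n))) \<longlonglongrightarrow> l" using LIMSEQ_subseq_LIMSEQ[OF ev r] by (simp add: o_def)
    then have "(\<lambda>n. of_real (ev (t (r n))) * cinner (x (r n)) y) \<longlonglongrightarrow> of_real l * cinner u y"
      by (intro tendsto_intros weak_imp_weak_cinner[OF xD u w])
    moreover have "a (t n) (x n) y = of_real (ev (t n)) * cinner (x n) y" for n
      using x y by (simp add: eig_def)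
    ultimately have "(\<lambda>n. a (t (r n)) (x (r n)) y) \<longlonglongrightarrow> of_real l * cinner u y" by simp
    from tendsto_diff[OF this 2] have "(\<lambda>n. a t' (x (r n)) y) \<longlonglongrightarrow> of_real l * cinner u y" by simp
    then show ?thesis using 1 LIMSEQ_unique by blast
  qed
  then show ?thesis using r u w by blast
qed

text \<open>At t' > 0 no mass can be lost: the part that escapes weakly has form value ev(t') per
  unit of mass, whereas the essential bound demands at least \<Sigma>(t'), which is larger.\<close>

lemma eig_strong_limit:
  assumes t: "\<And>n::nat. 0 < t n" "\<And>n. t n < \<rho>" "t \<longlonglongrightarrow> t'" "0 < t'" "t' < \<rho>"
    and x: "\<And>n. eig (t n) (x n)"
  shows "\<exists>r u. strict_mono (r::nat\<Rightarrow>nat) \<and> eig t' u \<and> (\<lambda>n. x (r n)) \<longlonglongrightarrow> u \<and>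
    (\<forall>y\<in>D. (\<lambda>n. a1 (x (r n)) y) \<longlonglongrightarrow> a1 u y)"
proof -
  have ev: "(\<lambda>n. ev (t n)) \<longlonglongrightarrow> ev t'"
  proof (rule isCont_tendsto_compose[OF _ t(3)])
    show "isCont ev t'" using cont t(4,5) by (simp add: continuous_on_eq_continuous_at)
  qed
  obtain r u where r: "strict_mono (r::nat\<Rightarrow>nat)" and u: "u \<in> D"
    and w: "\<And>y. y \<in> D \<Longrightarrow> (\<lambda>n. form_shift (a 0) c (x (r n)) y) \<longlonglongrightarrow> form_shift (a 0) c u y"
    and eq: "\<And>y. y \<in> D \<Longrightarrow> a t' u y = of_real (ev t') * cinner u y"
    using eig_weak_limit[OF t(1-3,5) x ev] by blast
  have xD: "x n \<in> D" and x1: "norm (x n) = 1" for n using x by (auto simp: eig_def)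
  have xM: "nrm (x n) \<le> M0" for n using eig_nrm[OF t(1,2) x] .
  have t'0: "0 \<le> t'" using t(4) by simp
  interpret at: symmetric_sesquilinear D "a t'" using a_sym[OF t'0 t(5)] .
  have wc: "(\<lambda>n. cinner (x (r n)) y) \<longlonglongrightarrow> cinner u y" for y
    by (rule weak_imp_weak_cinner[OF xD u w])
  define z where "z n = x (r n) - u" for n
  have zD: "z n \<in> D" for n using xD u by (simp add: z_def)
  have zM: "nrm (z n) \<le> M0 + nrm u" for n
    using nrm_diff_le[OF xD u, of "r n"] xM[of "r n"] by (simp add: z_def)
  have nz: "(\<lambda>n. (norm (z n))\<^sup>2) \<longlonglongrightarrow> 1 - (norm u)\<^sup>2"
    unfolding z_def by (rule norm_diff_weak_limit[OF x1 wc])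
  have weak_z: "weakly_tendsto_0 z" unfolding z_def by (rule weakly_null_diff[OF wc])
  have tr: "(\<lambda>n. t (r n)) \<longlonglongrightarrow> t'" using LIMSEQ_subseq_LIMSEQ[OF t(3) r] by (simp add: o_def)
  have evr: "(\<lambda>n. ev (t (r n))) \<longlonglongrightarrow> ev t'" using LIMSEQ_subseq_LIMSEQ[OF ev r] by (simp add: o_def)
  have "(\<lambda>n. Re (a t' (x (r n)) (x (r n)))) \<longlonglongrightarrow> ev t'"
  proof -
    have "(\<lambda>n. K * (1 + 2 * \<rho>) * M0\<^sup>2 * \<bar>t (r n) - t'\<bar>) \<longlonglongrightarrow> 0"
      by (intro tendsto_mult_right_zero tendsto_rabs_zero LIM_zero tr)
    then have 1: "(\<lambda>n. Re (a (t (r n)) (x (r n)) (x (r n))) - Re (a t' (x (r n)) (x (r n)))) \<longlonglongrightarrow> 0"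
    proof (rule Lim_null_comparison[rotated], intro always_eventually allI)
      show "norm (Re (a (t (r n)) (x (r n)) (x (r n))) - Re (a t' (x (r n)) (x (r n))))
          \<le> K * (1 + 2 * \<rho>) * M0\<^sup>2 * \<bar>t (r n) - t'\<bar>" for n
        using a_diag_lipschitz[OF less_imp_le[OF t(1)] t(2) t'0 t(5) xD xM] by simp
    qed
    have "Re (a (t n) (x n) (x n)) = ev (t n)" for n
      using x[of n] by (simp add: eig_def cinner_self)
    with evr have "(\<lambda>n. Re (a (t (r n)) (x (r n)) (x (r n)))) \<longlonglongrightarrow> ev t'" by simp
    from tendsto_diff[OF this 1] show ?thesis by simp
  qed
  moreover have "(\<lambda>n. a t' (x (r n)) u) \<longlonglongrightarrow> a t' u u"
    by (rule weak_tendsto_sesquilinear[OF xD u w at.sesq a_bdd[OF t'0 t(5)] u])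
  moreover have "Re (a t' (z n) (z n)) = Re (a t' (x (r n)) (x (r n))) - 2 * Re (a t' (x (r n)) u) + Re (a t' u u)" for n
    unfolding z_def by (rule at.Re_diag_diff[OF xD u])
  ultimately have "(\<lambda>n. Re (a t' (z n) (z n))) \<longlonglongrightarrow> ev t' - 2 * Re (a t' u u) + Re (a t' u u)"
    by (simp only:) (intro tendsto_intros)
  moreover have "Re (a t' u u) = ev t' * (norm u)\<^sup>2"
    using eq[OF u] by (simp add: cinner_self del: of_real_power)
  ultimately have az: "(\<lambda>n. Re (a t' (z n) (z n))) \<longlonglongrightarrow> ev t' * (1 - (norm u)\<^sup>2)"
    by (simp add: algebra_simps)
  have "\<Sigma> t' * (1 - (norm u)\<^sup>2) \<le> ev t' * (1 - (norm u)\<^sup>2)"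
  proof (rule field_le_epsilon)
    fix e :: real assume e: "e > 0"
    have "\<forall>\<^sub>F n in sequentially. \<Sigma> t' * (norm (z n))\<^sup>2 - e \<le> Re (a t' (z n) (z n))"
      using ess_bound_nrm[OF t'0 t(5) zD zM weak_z e] .
    then have "\<Sigma> t' * (1 - (norm u)\<^sup>2) - e \<le> ev t' * (1 - (norm u)\<^sup>2)"
      by (intro tendsto_le[OF _ az, of "\<lambda>n. \<Sigma> t' * (norm (z n))\<^sup>2 - e"] tendsto_intros nz) auto
    then show "\<Sigma> t' * (1 - (norm u)\<^sup>2) \<le> ev t' * (1 - (norm u)\<^sup>2) + e" by simp
  qed
  then have "(\<Sigma> t' - ev t') * (1 - (norm u)\<^sup>2) \<le> 0" by (simp add: algebra_simps)
  then have "1 - (norm u)\<^sup>2 \<le> 0" using below[OF t(4,5)] by (simp add: mult_le_0_iff)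
  then have "1 \<le> (norm u)\<^sup>2" by simp
  note strong = weak_limit_imp_strong_limit[OF x1 wc this]
  have "(\<lambda>n. a1 (x (r n)) y) \<longlonglongrightarrow> a1 u y" if y: "y \<in> D" for y
    by (rule weak_tendsto_sesquilinear[OF xD u w a1.sesq a1_bdd y])
  then show ?thesis using r strong u eq unfolding eig_def by blast
qed

end

section \<open>First-order perturbation theory\<close>

lemma at_right_frequently_ex:
  assumes "\<exists>\<^sub>F t in at_right (0::real). P t" "d > 0"
  shows "\<exists>t. 0 < t \<and> t < d \<and> P t"
proof -
  have "\<forall>\<^sub>F t in at_right 0. t \<in> {0<..<d}" using assms(2) by (rule eventually_at_right_real)
  from frequently_ex[OF frequently_eventually_frequently[OF assms(1) this]] show ?thesis by auto
qed

context threshold_family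
begin

text \<open>The factor s + t of the Taylor remainder tends to 2 t as s approaches t, and both
  eigenvectors have form norm at most \<open>M0\<close>.\<close>

definition \<kappa> :: real where "\<kappa> = 2 * K * M0\<^sup>2"

text \<open>
  At the last time \<open>t\<close> in \<open>[p, q]\<close> at which \<open>ev t - r t \<ge> \<eta>\<close>, the right difference quotients of
  \<open>ev\<close> are below \<open>r\<close>, and by first-order perturbation theory they accumulate at \<open>a1 x x + O(t)\<close>
  for some eigenvector \<open>x\<close>.
\<close>

lemma crossing:
  assumes p: "0 < p" "p < q" "q < \<rho>" and \<eta>: "\<eta> \<le> ev p - r * p" "ev q - r * q < \<eta>"
  shows "\<exists>t x. p \<le> t \<and> t < q \<and> ev t - r * t = \<eta> \<and> eig t x \<and> Re (a1 x x) \<le> r + \<kappa> * t"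
proof -
  define h where "h t = ev t - r * t" for t
  have conth: "continuous_on {p..q} h" unfolding h_def
    by (intro continuous_intros continuous_on_subset[OF cont]) (use p in auto)
  have "closed ({p..q} \<inter> h -` {\<eta>..})"
    by (intro continuous_closed_preimage[OF conth]) auto
  then have "compact ({p..q} \<inter> h -` {\<eta>..})"
    using compact_Int_closed[of "{p..q}"] by (metis Int_assoc Int_absorb compact_Icc)
  moreover have "{p..q} \<inter> h -` {\<eta>..} \<noteq> {}" using p \<eta> by (force simp: h_def)
  ultimately obtain t where "t \<in> {p..q} \<inter> h -` {\<eta>..}" "\<forall>s\<in>{p..q} \<inter> h -` {\<eta>..}. s \<le> t"
    using compact_attains_sup by blast
  then have t: "t \<in> {p..q}" "\<eta> \<le> h t" and max: "\<And>s. s \<in> {p..q} \<Longrightarrow> \<eta> \<le> h s \<Longrightarrow> s \<le> t"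
    by auto
  have tq: "t < q" using t \<eta>(2) unfolding h_def by (cases "t = q") auto
  have t0: "0 < t" "t < \<rho>" using t p tq by auto
  \<comment> \<open>The offset \<open>n + 2\<close> keeps every time strictly between
    \<open>t\<close> and \<open>q\<close>, where \<open>h\<close> is below \<eta> by the choice of
    \<open>t\<close>.\<close>
  define s where "s n = t + (q - t) / real (n + 2)" for n
  have "(\<lambda>n. t + (q - t) * inverse (real (n + 2))) \<longlonglongrightarrow> t + (q - t) * 0"
    by (intro tendsto_intros LIMSEQ_ignore_initial_segment[OF lim_inverse_n])
  then have s_lim: "s \<longlonglongrightarrow> t" by (simp add: s_def[abs_def] divide_inverse)
  have st: "t < s n" "s n < q" for n
  proof -
    show "t < s n" using tq by (simp add: s_def)
    have "(q - t) / real (n + 2) < q - t" using tq by (simp add: divide_less_eq)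
    then show "s n < q" by (simp add: s_def)
  qed
  have s0: "0 < s n" "s n < \<rho>" for n using st[of n] t0 p by auto
  have hs: "h (s n) < \<eta>" for n using max[of "s n"] st[of n] t p by fastforce
  have "isCont ev t" using cont t0 by (simp add: continuous_on_eq_continuous_at)
  then have "isCont h t" unfolding h_def by (intro continuous_intros)
  from isCont_tendsto_compose[OF this s_lim] have "h t \<le> \<eta>"
    using hs less_imp_le by (intro LIMSEQ_le_const2) blast+
  then have ht: "h t = \<eta>" using t by simp
  have "\<exists>x. eig (s n) x" for n using eig_exists s0 by blast
  then obtain x where x: "\<And>n. eig (s n) (x n)" by metis
  obtain R u where R: "strict_mono (R::nat\<Rightarrow>nat)" and u: "eig t u" and xu: "(\<lambda>n. x (R n)) \<longlonglongrightarrow> u"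
    and a1u: "\<And>y. y \<in> D \<Longrightarrow> (\<lambda>n. a1 (x (R n)) y) \<longlonglongrightarrow> a1 u y"
    using eig_strong_limit[OF s0 s_lim t0 x] by blast
  have uD: "u \<in> D" and nu: "norm u = 1" using u by (auto simp: eig_def)
  have xD: "x n \<in> D" for n using x by (simp add: eig_def)
  have cu: "(\<lambda>n. Re (cinner (x (R n)) u)) \<longlonglongrightarrow> 1"
  proof -
    have "(\<lambda>n. cinner (x (R n)) u) \<longlonglongrightarrow> cinner u u"
      by (intro tendsto_cinner_left tendsto_norm_zero LIM_zero xu)
    from tendsto_Re[OF this] show ?thesis using nu by (simp add: cinner_self)
  qed
  \<comment> \<open>Pairing the eigenvectors of the two times with each other turns the difference
    of the forms into (ev s - ev t) times their overlap. The overlap must have positive real part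
    for the bound \<open>r\<close> on the difference quotient to be inserted.\<close>
  have ineq: "Re (a1 (x n) u) \<le> r * Re (cinner (x n) u) + K * (s n + t) * M0\<^sup>2"
    if pos: "Re (cinner (x n) u) > 0" for n
  proof -
    interpret at: symmetric_sesquilinear D "a t" using a_sym t0 by auto
    define Q where "Q = (ev (s n) - ev t) / (s n - t)"
    have d: "s n - t > 0" using st[of n] by simp
    have "h (s n) < h t" using hs[of n] ht by simp
    then have "ev (s n) - ev t < r * (s n - t)" by (simp add: h_def algebra_simps)
    then have Qr: "Q < r" using d by (simp add: Q_def pos_divide_less_eq)
    have "a t (x n) u = cnj (a t u (x n))" using at.swap[OF uD xD] .
    also have "a t u (x n) = of_real (ev t) * cinner u (x n)" using u xD by (simp add: eig_def)
    also have "cnj \<dots> = of_real (ev t) * cinner (x n) u" by (simp add: cinner_commute[of u])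
    finally have "a (s n) (x n) u - a t (x n) u = of_real (ev (s n) - ev t) * cinner (x n) u"
      using x[of n] uD by (simp add: eig_def algebra_simps)
    also have "ev (s n) - ev t = (s n - t) * Q" using d by (simp add: Q_def)
    finally have eq: "a (s n) (x n) u - a t (x n) u - of_real (s n - t) * a1 (x n) u
        = of_real (s n - t) * (of_real Q * cinner (x n) u - a1 (x n) u)"
      by (simp add: algebra_simps)
    have "(s n - t) * cmod (of_real Q * cinner (x n) u - a1 (x n) u)
        = cmod (a (s n) (x n) u - a t (x n) u - of_real (s n - t) * a1 (x n) u)"
      unfolding eq norm_mult norm_of_real using d by simp
    also have "\<dots> \<le> K * \<bar>s n - t\<bar> * (s n + t) * nrm (x n) * nrm u"
      using s0[of n] t0 uD xD by (intro taylor) auto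
    also have "\<dots> \<le> K * \<bar>s n - t\<bar> * (s n + t) * M0 * M0"
      using eig_nrm[OF s0 x] eig_nrm[OF t0 u] K s0[of n] t0 xD uD M0 by (intro mult_mono) auto
    also have "\<dots> = (s n - t) * (K * (s n + t) * M0\<^sup>2)" using d by (simp add: power2_eq_square)
    finally have "cmod (of_real Q * cinner (x n) u - a1 (x n) u) \<le> K * (s n + t) * M0\<^sup>2"
      using d by simp
    then have "Re (a1 (x n) u) - Q * Re (cinner (x n) u) \<le> K * (s n + t) * M0\<^sup>2"
      using abs_Re_le_cmod[of "of_real Q * cinner (x n) u - a1 (x n) u"] by simp
    moreover have "Q * Re (cinner (x n) u) \<le> r * Re (cinner (x n) u)"
      using Qr pos by (intro mult_right_mono) auto
    ultimately show ?thesis by linarith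
  qed
  have "(\<lambda>n. s (R n)) \<longlonglongrightarrow> t" using LIMSEQ_subseq_LIMSEQ[OF s_lim R] by (simp add: o_def)
  then have "(\<lambda>n. r * Re (cinner (x (R n)) u) + K * (s (R n) + t) * M0\<^sup>2) \<longlonglongrightarrow> r * 1 + K * (t + t) * M0\<^sup>2"
    by (intro tendsto_intros cu)
  moreover have "(\<lambda>n. Re (a1 (x (R n)) u)) \<longlonglongrightarrow> Re (a1 u u)" by (intro tendsto_intros a1u uD)
  moreover have "\<forall>\<^sub>F n in sequentially. Re (cinner (x (R n)) u) > 0"
    using cu by (intro order_tendstoD(1)) auto
  then have "\<forall>\<^sub>F n in sequentially. Re (a1 (x (R n)) u) \<le> r * Re (cinner (x (R n)) u) + K * (s (R n) + t) * M0\<^sup>2"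
    by eventually_elim (rule ineq)
  ultimately have "Re (a1 u u) \<le> r * 1 + K * (t + t) * M0\<^sup>2"
    by (intro tendsto_le) auto
  then show ?thesis using t tq ht u by (intro exI[of _ t] exI[of _ u]) (simp add: h_def \<kappa>_def algebra_simps)
qed

text \<open>Eigenvector equation of \<open>a1\<close> compressed to the kernel of time 0. The zero
  vector satisfies it, so being nonzero is asserted separately.\<close>

definition slope_vector :: "real \<Rightarrow> 'a \<Rightarrow> bool" where
  "slope_vector \<nu> u \<longleftrightarrow> u \<in> N \<and> (\<forall>y\<in>N. a1 u y = of_real \<nu> * cinner u y)"

text \<open>The slope bound splits between the weak limit u and the lost part z. As
  \<open>a1\<close> is at least \<sigma> per unit of lost mass and r < \<sigma>, not all mass is
  lost; in the borderline case that u itself has slope r, none is.\<close>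

lemma small_time_limit:
  assumes s: "\<And>k::nat. 0 < s k" "\<And>k. s k < \<rho>" "s \<longlonglongrightarrow> 0" "(\<lambda>k. \<Sigma> (s k) / s k) \<longlonglongrightarrow> \<sigma>"
    and r: "r < \<sigma>"
    and t: "\<And>n::nat. 0 < t n" "\<And>n. t n < \<rho>" "t \<longlonglongrightarrow> 0"
    and x: "\<And>n. eig (t n) (x n)" "\<And>n. Re (a1 (x n) (x n)) \<le> r + \<kappa> * t n"
  shows "\<exists>R u \<nu>. strict_mono (R::nat\<Rightarrow>nat) \<and> u \<noteq> 0 \<and> slope_vector \<nu> u \<and> \<nu> < \<sigma> \<and>
    (\<lambda>n. ev (t (R n)) / t (R n)) \<longlonglongrightarrow> \<nu> \<and>
    (\<nu> = r \<longrightarrow> norm u = 1 \<and> (\<lambda>n. x (R n)) \<longlonglongrightarrow> u)"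
proof -
  have tf: "filterlim t (at_right 0) sequentially"
    using t t(1)[THEN less_imp_neq, symmetric] by (auto simp: filterlim_at intro!: always_eventually)
  have ev0: "(\<lambda>n. ev (t n)) \<longlonglongrightarrow> 0" using filterlim_compose[OF lim tf] .
  obtain R u where R: "strict_mono (R::nat\<Rightarrow>nat)" and u: "u \<in> D"
    and w: "\<And>y. y \<in> D \<Longrightarrow> (\<lambda>n. form_shift (a 0) c (x (R n)) y) \<longlonglongrightarrow> form_shift (a 0) c u y"
    and eq: "\<And>y. y \<in> D \<Longrightarrow> a 0 u y = of_real 0 * cinner u y"
    using eig_weak_limit[OF t rho x(1) ev0] by blast
  have uN: "u \<in> N" using u eq by (simp add: N_def)
  have xD: "x n \<in> D" and x1: "norm (x n) = 1" for n using x by (auto simp: eig_def)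
  have xM: "nrm (x n) \<le> M0" for n using eig_nrm[OF t(1,2) x(1)] .
  interpret a0: symmetric_sesquilinear D "a 0" using a_sym rho by auto
  have wc: "(\<lambda>n. cinner (x (R n)) y) \<longlonglongrightarrow> cinner u y" for y
    by (rule weak_imp_weak_cinner[OF xD u w])
  have a1u: "(\<lambda>n. a1 (x (R n)) y) \<longlonglongrightarrow> a1 u y" if y: "y \<in> D" for y
    by (rule weak_tendsto_sesquilinear[OF xD u w a1.sesq a1_bdd y])
  have tR: "(\<lambda>n. t (R n)) \<longlonglongrightarrow> 0" using LIMSEQ_subseq_LIMSEQ[OF t(3) R] by (simp add: o_def)
  have a0x: "(\<lambda>n. Re (a 0 (x (R n)) (x (R n)))) \<longlonglongrightarrow> 0"
  proof -
    define L where "L = K * (1 + 2 * \<rho>) * M0\<^sup>2"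
    have "(\<lambda>n. \<bar>ev (t (R n))\<bar> + L * t (R n)) \<longlonglongrightarrow> \<bar>0\<bar> + L * 0"
      using LIMSEQ_subseq_LIMSEQ[OF ev0 R] by (intro tendsto_intros tR) (simp add: o_def)
    then have "(\<lambda>n. \<bar>ev (t (R n))\<bar> + L * t (R n)) \<longlonglongrightarrow> 0" by simp
    then show ?thesis
    proof (rule Lim_null_comparison[rotated], intro always_eventually allI)
      fix n
      let ?x = "x (R n)" and ?t = "t (R n)"
      have tn: "0 < ?t" "?t < \<rho>" using t by auto
      have "\<bar>Re (a ?t ?x ?x) - Re (a 0 ?x ?x)\<bar> \<le> L * ?t"
        using a_diag_lipschitz[OF less_imp_le[OF tn(1)] tn(2) order_refl rho xD xM] tn(1) by (simp add: L_def)
      moreover have "Re (a ?t ?x ?x) = ev ?t"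
        using x(1)[of "R n"] by (simp add: eig_def cinner_self)
      ultimately show "norm (Re (a 0 ?x ?x)) \<le> \<bar>ev ?t\<bar> + L * ?t" by simp
    qed
  qed
  define z where "z n = x (R n) - u" for n
  have zD: "z n \<in> D" for n using xD u by (simp add: z_def)
  have zM: "nrm (z n) \<le> M0 + nrm u" for n
    using nrm_diff_le[OF xD u, of "R n"] xM[of "R n"] by (simp add: z_def)
  have nz: "(\<lambda>n. (norm (z n))\<^sup>2) \<longlonglongrightarrow> 1 - (norm u)\<^sup>2"
    unfolding z_def by (rule norm_diff_weak_limit[OF x1 wc])
  have weak_z: "weakly_tendsto_0 z" unfolding z_def by (rule weakly_null_diff[OF wc])
  have "Re (a 0 (z n) (z n)) = Re (a 0 (x (R n)) (x (R n)))" for n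
    unfolding z_def using a0.Re_diag_diff[OF xD u, of "R n"] a0.swap[OF u xD] eq xD u by simp
  then have a0z: "(\<lambda>n. Re (a 0 (z n) (z n))) \<longlonglongrightarrow> 0" using a0x by simp
  have a1z: "Re (a1 (z n) (z n)) \<le> r + \<kappa> * t (R n) - 2 * Re (a1 (x (R n)) u) + Re (a1 u u)" for n
    unfolding z_def using a1.Re_diag_diff[OF xD u, of "R n"] x(2)[of "R n"] by linarith
  \<comment> \<open>Both sides bound the limiting \<open>a1\<close>-energy of the lost part
    \<open>z\<close>: from below by the threshold slope, from above by \<open>r\<close> minus the
    share of \<open>u\<close>. The mixed terms converge to Re (a1 u u) by weak convergence.\<close>
  have key: "\<sigma> * (1 - (norm u)\<^sup>2) \<le> r - Re (a1 u u)"
  proof (rule field_le_epsilon)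
    fix e :: real assume e: "e > 0"
    have "\<forall>\<^sub>F n in sequentially. \<sigma> * (norm (z n))\<^sup>2 - e \<le> Re (a1 (z n) (z n))"
      using a1_asymptotic_bound[OF s zD zM weak_z a0z e] .
    then have "\<forall>\<^sub>F n in sequentially. \<sigma> * (norm (z n))\<^sup>2 - e
        \<le> r + \<kappa> * t (R n) - 2 * Re (a1 (x (R n)) u) + Re (a1 u u)"
      by eventually_elim (use a1z order_trans in blast)
    moreover have "(\<lambda>n. r + \<kappa> * t (R n) - 2 * Re (a1 (x (R n)) u) + Re (a1 u u))
        \<longlonglongrightarrow> r + \<kappa> * 0 - 2 * Re (a1 u u) + Re (a1 u u)"
      by (intro tendsto_intros tR a1u u)
    moreover have "(\<lambda>n. \<sigma> * (norm (z n))\<^sup>2 - e) \<longlonglongrightarrow> \<sigma> * (1 - (norm u)\<^sup>2) - e"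
      by (intro tendsto_intros nz)
    ultimately have "\<sigma> * (1 - (norm u)\<^sup>2) - e \<le> r + \<kappa> * 0 - 2 * Re (a1 u u) + Re (a1 u u)"
      by (intro tendsto_le) auto
    then show "\<sigma> * (1 - (norm u)\<^sup>2) \<le> r - Re (a1 u u) + e" by simp
  qed
  have u0: "u \<noteq> 0" using key r by auto
  \<comment> \<open>The only possible eigenvalue for \<open>u\<close>, namely its Rayleigh
    quotient.\<close>
  define \<nu> where "\<nu> = Re (a1 u u) / (norm u)\<^sup>2"
  have a1uu: "Re (a1 u u) = \<nu> * (norm u)\<^sup>2" using u0 by (simp add: \<nu>_def)
  have \<nu>\<sigma>: "\<nu> < \<sigma>"
  proof -
    have "\<nu> * (norm u)\<^sup>2 < \<sigma> * (norm u)\<^sup>2" using key r by (simp add: a1uu algebra_simps)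
    then show ?thesis using u0 by simp
  qed
  define g where "g n = ev (t (R n)) / t (R n)" for n
  \<comment> \<open>Tested against a kernel vector the time-0 form drops out, and the eigenvalue
    equation divided by t leaves \<open>a1\<close> up to O(t).\<close>
  have first_order: "(\<lambda>n. of_real (g n) * cinner (x (R n)) y) \<longlonglongrightarrow> a1 u y" if y: "y \<in> N" for y
  proof -
    have yD: "y \<in> D" using y by (simp add: N_def)
    have "(\<lambda>n. K * t (R n) * M0 * nrm y) \<longlonglongrightarrow> K * 0 * M0 * nrm y" by (intro tendsto_intros tR)
    then have "(\<lambda>n. K * t (R n) * M0 * nrm y) \<longlonglongrightarrow> 0" by simp
    then have "(\<lambda>n. of_real (g n) * cinner (x (R n)) y - a1 (x (R n)) y) \<longlonglongrightarrow> 0"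
    proof (rule Lim_null_comparison[rotated], intro always_eventually allI)
      fix n
      let ?x = "x (R n)" and ?t = "t (R n)"
      have tn: "0 < ?t" "?t < \<rho>" using t by auto
      have "a 0 ?x y = 0" using a0.swap[OF yD xD] y xD by (simp add: N_def)
      moreover have "a ?t ?x y = of_real ?t * (of_real (g n) * cinner ?x y)"
        using x(1)[of "R n"] yD tn by (simp add: eig_def g_def)
      ultimately have eq2: "a ?t ?x y - a 0 ?x y - of_real (?t - 0) * a1 ?x y
          = of_real ?t * (of_real (g n) * cinner ?x y - a1 ?x y)" by (simp add: algebra_simps)
      have "?t * cmod (of_real (g n) * cinner ?x y - a1 ?x y)
          = cmod (a ?t ?x y - a 0 ?x y - of_real (?t - 0) * a1 ?x y)"
        unfolding eq2 norm_mult norm_of_real using tn by simp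
      also have "\<dots> \<le> K * \<bar>?t - 0\<bar> * (?t + 0) * nrm ?x * nrm y"
        using tn rho xD yD by (intro taylor) auto
      also have "\<dots> \<le> K * \<bar>?t - 0\<bar> * (?t + 0) * M0 * nrm y"
        using tn K yD xM by (intro mult_right_mono mult_left_mono) auto
      also have "\<dots> = ?t * (K * ?t * M0 * nrm y)" using tn by simp
      finally show "cmod (of_real (g n) * cinner ?x y - a1 ?x y) \<le> K * ?t * M0 * nrm y"
        using tn by simp
    qed
    from tendsto_add[OF this a1u[OF yD]] show ?thesis by simp
  qed
  have g: "g \<longlonglongrightarrow> \<nu>"
  proof -
    have nu2: "Re (cinner u u) = (norm u)\<^sup>2" by (simp add: cinner_self del: of_real_power)
    have 1: "(\<lambda>n. Re (cinner (x (R n)) u)) \<longlonglongrightarrow> (norm u)\<^sup>2"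
      using tendsto_Re[OF wc[of u]] unfolding nu2 .
    have "(\<lambda>n. g n * Re (cinner (x (R n)) u)) \<longlonglongrightarrow> Re (a1 u u)"
      using tendsto_Re[OF first_order[OF uN]] by simp
    from tendsto_divide[OF this 1] u0
    have "(\<lambda>n. g n * Re (cinner (x (R n)) u) / Re (cinner (x (R n)) u)) \<longlonglongrightarrow> \<nu>"
      by (simp add: \<nu>_def)
    moreover have "\<forall>\<^sub>F n in sequentially. Re (cinner (x (R n)) u) > 0"
      using u0 by (intro order_tendstoD(1)[OF 1]) simp
    then have "\<forall>\<^sub>F n in sequentially. g n * Re (cinner (x (R n)) u) / Re (cinner (x (R n)) u) = g n"
      by eventually_elim simp
    ultimately show ?thesis using tendsto_cong by force
  qed
  have "a1 u y = of_real \<nu> * cinner u y" if y: "y \<in> N" for y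
    using LIMSEQ_unique[OF first_order[OF y] tendsto_mult[OF tendsto_of_real[OF g] wc]] .
  then have sv: "slope_vector \<nu> u" using uN by (simp add: slope_vector_def)
  \<comment> \<open>For \<nu> = r the mass balance \<open>key\<close> reads (\<sigma> - r)(1 -
    |u|^2) <= 0 with a positive first factor.\<close>
  have "norm u = 1 \<and> (\<lambda>n. x (R n)) \<longlonglongrightarrow> u" if "\<nu> = r"
  proof -
    have "(\<sigma> - r) * (1 - (norm u)\<^sup>2) \<le> 0" using key that by (simp add: a1uu algebra_simps)
    then have "1 - (norm u)\<^sup>2 \<le> 0" using r by (simp add: mult_le_0_iff)
    then have "1 \<le> (norm u)\<^sup>2" by simp
    then show ?thesis using weak_limit_imp_strong_limit[OF x1 wc] by blast
  qed
  then show ?thesis using R u0 sv \<nu>\<sigma> g unfolding g_def by blast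
qed

lemma sequence_at_right:
  assumes "\<And>d. d > 0 \<Longrightarrow> \<exists>t x. 0 < t \<and> t < d \<and> P t x"
  shows "\<exists>t x. (\<forall>n::nat. 0 < t n \<and> t n < \<rho> \<and> P (t n) (x n)) \<and> t \<longlonglongrightarrow> (0::real)"
proof -
  have "\<exists>t x. 0 < t \<and> t < \<rho> \<and> t < 1 / Suc n \<and> P t x" for n :: nat
    using assms[of "min \<rho> (1 / Suc n)"] rho by auto
  then obtain t x where t: "\<And>n. 0 < t n" "\<And>n. t n < \<rho>" "\<And>n::nat. t n < 1 / Suc n" "\<And>n. P (t n) (x n)"
    by metis
  have "t \<longlonglongrightarrow> 0"
    by (rule tendsto_sandwich[OF _ _ tendsto_const LIMSEQ_Suc[OF lim_1_over_n]])
       (use t in \<open>auto intro!: always_eventually less_imp_le\<close>)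
  then show ?thesis using t by blast
qed

section \<open>Excluding oscillation of the slope\<close>

lemma slope_vectors_orthogonal:
  assumes "slope_vector r u" "slope_vector r' u'" "r \<noteq> r'" shows "cinner u u' = 0"
proof -
  have D: "u \<in> D" "u' \<in> D" using assms by (auto simp: slope_vector_def N_def)
  have "of_real r * cinner u u' = a1 u u'" using assms by (simp add: slope_vector_def)
  also have "\<dots> = cnj (a1 u' u)" using a1.swap[OF D(2,1)] .
  also have "\<dots> = cnj (of_real r' * cinner u' u)" using assms by (simp add: slope_vector_def)
  also have "\<dots> = of_real r' * cinner u u'" by (simp add: cinner_commute[of u'])
  finally show ?thesis using assms(3) by simp
qed

text \<open>An uncountable set of times has infinitely many members bounded away from 0, and these
  accumulate at a positive time. The cap \<rho>/2 keeps that time below \<rho>, so eigenvectors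
  converge strongly along a subsequence.\<close>

lemma eigenvectors_not_separated:
  assumes T: "uncountable T" "T \<subseteq> {0<..<\<rho>/2}"
    and x: "\<And>t. t \<in> T \<Longrightarrow> eig t (x t)" and e: "e > 0"
  shows "\<exists>t\<in>T. \<exists>t'\<in>T. t \<noteq> t' \<and> norm (x t - x t') < e"
proof -
  have "T = (\<Union>n. T \<inter> {1 / Suc n .. \<rho>/2})"
  proof
    show "T \<subseteq> (\<Union>n. T \<inter> {1 / Suc n .. \<rho>/2})"
    proof
      fix t assume t: "t \<in> T"
      then have t0: "0 < t" "t < \<rho>/2" using T(2) by auto
      then obtain n where "1 / Suc n < t" using nat_approx_posE by blast
      then show "t \<in> (\<Union>n. T \<inter> {1 / Suc n .. \<rho>/2})" using t t0 by (auto intro!: exI[of _ n])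
    qed
  qed auto
  then obtain n where n: "uncountable (T \<inter> {1 / real (Suc n) .. \<rho>/2})"
    using T(1) countable_UN[of UNIV "\<lambda>n. T \<inter> {1 / real (Suc n) .. \<rho>/2}"] by auto
  then have "infinite (T \<inter> {1 / real (Suc n) .. \<rho>/2})" using countable_finite by blast
  then obtain f :: "nat \<Rightarrow> real" where f: "inj f" "range f \<subseteq> T \<inter> {1 / real (Suc n) .. \<rho>/2}"
    using infinite_countable_subset by blast
  have "\<forall>k. f k \<in> {1 / real (Suc n) .. \<rho>/2}" using f by blast
  then obtain t' R where t': "t' \<in> {1 / real (Suc n) .. \<rho>/2}" and R: "strict_mono (R::nat\<Rightarrow>nat)" and lim: "(f \<circ> R) \<longlonglongrightarrow> t'"
    using compact_Icc[of "1 / real (Suc n)" "\<rho>/2"] unfolding compact_def by meson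
  have pos: "0 < 1 / real (Suc n)" by simp
  have fT: "f k \<in> T" for k using f by blast
  have f0: "0 < (f \<circ> R) k" "(f \<circ> R) k < \<rho>" for k
    using T(2) fT[of "R k"] rho by (auto dest!: subsetD)
  have t'0: "0 < t'" "t' < \<rho>" using t' pos rho unfolding atLeastAtMost_iff by linarith+
  obtain R' u where R': "strict_mono (R'::nat\<Rightarrow>nat)" and u: "(\<lambda>k. x ((f \<circ> R) (R' k))) \<longlonglongrightarrow> u"
    using eig_strong_limit[OF f0 lim t'0, of "\<lambda>k. x ((f \<circ> R) k)"] x fT by auto
  have "e / 2 > 0" using e by simp
  from LIMSEQ_D[OF u this] obtain k where
    k: "\<And>j. j \<ge> k \<Longrightarrow> norm (x ((f \<circ> R) (R' j)) - u) < e / 2" by blast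
  define t1 t2 where "t1 = f (R (R' k))" and "t2 = f (R (R' (Suc k)))"
  have "R (R' k) < R (R' (Suc k))" using R R' by (simp add: strict_mono_less)
  then have "t1 \<noteq> t2" using f(1) by (auto simp: t1_def t2_def dest: injD)
  moreover have "norm (x t1 - x t2) < e"
    using norm_triangle_ineq4[of "x t1 - u" "x t2 - u"] k[of k] k[of "Suc k"]
    by (simp add: t1_def t2_def)
  ultimately show ?thesis using fT unfolding t1_def t2_def by blast
qed

lemma slope_not_oscillating:
  assumes s: "\<And>k::nat. 0 < s k" "\<And>k. s k < \<rho>" "s \<longlonglongrightarrow> 0" "(\<lambda>k. \<Sigma> (s k) / s k) \<longlonglongrightarrow> \<sigma>"
    and \<alpha>: "\<alpha> < \<beta>" "\<beta> \<le> \<sigma>"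
    and osc: "\<exists>\<^sub>F t in at_right 0. ev t / t \<le> \<alpha>" "\<exists>\<^sub>F t in at_right 0. \<beta> \<le> ev t / t"
  shows False
proof -
  have "\<exists>t x u. 0 < t \<and> t < \<rho>/2 \<and> ev t / t = r \<and> eig t x \<and> norm u = 1 \<and> slope_vector r u \<and> norm (x - u) < 1/4"
    if r: "r \<in> {\<alpha><..<\<beta>}" for r
  proof -
    have "\<exists>t x. 0 < t \<and> t < d \<and> ev t / t = r \<and> eig t x \<and> Re (a1 x x) \<le> r + \<kappa> * t" if "d > 0" for d
    proof -
      obtain q where q: "0 < q" "q < min d \<rho>" "ev q / q \<le> \<alpha>"
        using at_right_frequently_ex[OF osc(1), of "min d \<rho>"] \<open>d > 0\<close> rho by auto
      obtain p where p: "0 < p" "p < q" "\<beta> \<le> ev p / p"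
        using at_right_frequently_ex[OF osc(2), of q] q by auto
      have "r \<le> ev p / p" "ev q / q < r" using p q r by auto
      then have "0 \<le> ev p - r * p" "ev q - r * q < 0"
        using p(1) q(1) by (auto simp: pos_le_divide_eq pos_divide_less_eq)
      \<comment> \<open>Crossing is applied at level 0 of ev t - r t, so the ratio ev t / t equals r
        exactly at the times found.\<close>
      then obtain t x where t: "p \<le> t" "t < q" "ev t - r * t = 0" "eig t x" "Re (a1 x x) \<le> r + \<kappa> * t"
        using crossing[OF p(1,2)] q by (metis min_less_iff_conj)
      then show ?thesis using p q by (intro exI[of _ t] exI[of _ x]) (auto simp: field_simps)
    qed
    then obtain t x where t: "\<forall>n::nat. 0 < t n \<and> t n < \<rho> \<and>
        (ev (t n) / t n = r \<and> eig (t n) (x n) \<and> Re (a1 (x n) (x n)) \<le> r + \<kappa> * t n)"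
      and t0: "t \<longlonglongrightarrow> 0"
      using sequence_at_right[of "\<lambda>t x. ev t / t = r \<and> eig t x \<and> Re (a1 x x) \<le> r + \<kappa> * t"] by blast
    have "r < \<sigma>" using r \<alpha> by simp
    then obtain R u \<nu> where R: "strict_mono (R::nat\<Rightarrow>nat)" and u: "slope_vector \<nu> u"
      and \<nu>: "(\<lambda>n. ev (t (R n)) / t (R n)) \<longlonglongrightarrow> \<nu>"
      and conv: "\<nu> = r \<longrightarrow> norm u = 1 \<and> (\<lambda>n. x (R n)) \<longlonglongrightarrow> u"
      using small_time_limit[OF s _ _ _ t0, of r x] t by blast
    \<comment> \<open>The ratios are constantly \<open>r\<close>, which puts the limit into the
      borderline case where convergence is strong.\<close>
    have "\<nu> = r" using \<nu> t by (simp add: LIMSEQ_const_iff)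
    then have u1: "norm u = 1" and xu: "(\<lambda>n. x (R n)) \<longlonglongrightarrow> u" using conv by auto
    have "(\<lambda>n. t (R n)) \<longlonglongrightarrow> 0" using LIMSEQ_subseq_LIMSEQ[OF t0 R] by (simp add: o_def)
    then have "\<forall>\<^sub>F n in sequentially. t (R n) < \<rho>/2" using rho by (intro order_tendstoD(2)) auto
    moreover have "\<forall>\<^sub>F n in sequentially. norm (x (R n) - u) < 1/4"
      using tendsto_norm_zero[OF LIM_zero[OF xu]] by (intro order_tendstoD(2)) auto
    ultimately obtain n where "t (R n) < \<rho>/2" "norm (x (R n) - u) < 1/4"
      using eventually_happens[OF eventually_conj] by fastforce
    then show ?thesis using t u u1 \<open>\<nu> = r\<close> by blast
  qed
  then obtain \<tau> X u where \<tau>: "\<And>r. r \<in> {\<alpha><..<\<beta>} \<Longrightarrow> 0 < \<tau> r \<and> \<tau> r < \<rho>/2 \<and> ev (\<tau> r) / \<tau> r = r \<and>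
      eig (\<tau> r) (X r) \<and> norm (u r) = 1 \<and> slope_vector r (u r) \<and> norm (X r - u r) < 1/4"
    by metis
  define T where "T = \<tau> ` {\<alpha><..<\<beta>}"
  \<comment> \<open>The level is recovered from the time as ev t / t; this gives injectivity and
    lets the eigenvectors be indexed by times.\<close>
  have "inj_on \<tau> {\<alpha><..<\<beta>}" using \<tau> by (metis inj_onI)
  then have "uncountable T"
    unfolding T_def using uncountable_open_interval[of \<alpha> \<beta>] \<alpha>(1) countable_image_inj_on by blast
  moreover have "T \<subseteq> {0<..<\<rho>/2}" using \<tau> by (auto simp: T_def)
  moreover have "eig t (X (ev t / t))" if "t \<in> T" for t using \<tau> that by (force simp: T_def)
  ultimately obtain t t' where tt: "t \<in> T" "t' \<in> T" "t \<noteq> t'" "norm (X (ev t / t) - X (ev t' / t')) < 1/2"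
    using eigenvectors_not_separated[of T "\<lambda>t. X (ev t / t)" "1/2"] by auto
  obtain r r' where r: "r \<in> {\<alpha><..<\<beta>}" "t = \<tau> r" "r' \<in> {\<alpha><..<\<beta>}" "t' = \<tau> r'"
    using tt by (auto simp: T_def)
  have "r \<noteq> r'" using r tt by auto
  then have "cinner (u r) (u r') = 0" using slope_vectors_orthogonal \<tau> r by blast
  then have "(norm (u r - u r'))\<^sup>2 = 2"
    using cinner.Re_diag_diff[of "u r" "u r'"] \<tau> r(1,3)
    by (simp add: cinner_self del: cinner.diff_left cinner.diff_right)
  \<comment> \<open>1/4 + 1/4 + 1/2 = 1, short of the distance sqrt 2 between orthonormal
    vectors.\<close>
  moreover have "norm (u r - u r') < 1"
  proof -
    have "norm (X r - X r') < 1/2" using tt(4) \<tau> r by simp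
    moreover have "norm (X r - u r) < 1/4" "norm (X r' - u r') < 1/4" using \<tau> r by auto
    moreover have "u r - u r' = ((X r - X r') - (X r - u r)) + (X r' - u r')" by simp
    then have "norm (u r - u r') = norm (((X r - X r') - (X r - u r)) + (X r' - u r'))" by simp
    moreover note norm_triangle_ineq[of "(X r - X r') - (X r - u r)" "X r' - u r'"]
      norm_triangle_ineq4[of "X r - X r'" "X r - u r"]
    ultimately show ?thesis by linarith
  qed
  then have "(norm (u r - u r'))\<^sup>2 < 1" by (simp add: abs_square_less_1)
  ultimately show False by simp
qed

theorem threshold_slope:
  "\<exists>\<nu> u. u \<noteq> 0 \<and> slope_vector \<nu> u \<and> ((\<lambda>t. ev t / t) \<longlongrightarrow> \<nu>) (at_right 0)"
proof -
  obtain s \<sigma> \<gamma> where \<gamma>: "\<gamma> > 0" and s: "\<And>k::nat. 0 < s k" "\<And>k. s k < \<rho>"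
    and gap_s: "\<And>k. ev (s k) < \<Sigma> (s k) - \<gamma> * s k"
    and s0: "s \<longlonglongrightarrow> 0" "(\<lambda>k. \<Sigma> (s k) / s k) \<longlonglongrightarrow> \<sigma>" using slope_sequence by blast
  \<comment> \<open>Midway inside the gap: once \<Sigma>(s k)/s k < \<sigma> + \<gamma>/2, losing
    \<gamma> leaves ev below r s k, while r is still below \<sigma>.\<close>
  define r where "r = \<sigma> - \<gamma> / 2"
  have r: "r < \<sigma>" using \<gamma> by (simp add: r_def)
  have "\<exists>t x. 0 < t \<and> t < d \<and> eig t x \<and> Re (a1 x x) \<le> r + \<kappa> * t" if d: "d > 0" for d
  proof -
    have "\<forall>\<^sub>F k in sequentially. s k < d" using s0(1) d by (intro order_tendstoD(2))
    moreover have "\<forall>\<^sub>F k in sequentially. \<Sigma> (s k) / s k < \<sigma> + \<gamma> / 2"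
      using s0(2) \<gamma> by (intro order_tendstoD(2)) auto
    ultimately obtain k where k: "s k < d" "\<Sigma> (s k) / s k < \<sigma> + \<gamma> / 2"
      using eventually_happens[OF eventually_conj] by fastforce
    define q where "q = s k"
    have q: "0 < q" "q < d" "q < \<rho>" using s k by (auto simp: q_def)
    have "\<Sigma> q < (\<sigma> + \<gamma> / 2) * q" using k(2) q by (simp add: q_def pos_divide_less_eq)
    then have "ev q - r * q < 0" using gap_s[of k] by (simp add: q_def r_def algebra_simps)
    \<comment> \<open>Near 0 the function ev t - r t tends to 0 with unknown sign, so the level to
      be crossed must be strictly negative, here half the value at \<open>q\<close>.\<close>
    define \<eta> where "\<eta> = (ev q - r * q) / 2"
    have \<eta>: "\<eta> < 0" "ev q - r * q < \<eta>" using \<open>ev q - r * q < 0\<close> by (simp_all add: \<eta>_def field_simps)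
    have "((\<lambda>t. ev t - r * t) \<longlongrightarrow> 0 - r * 0) (at_right 0)" by (intro tendsto_intros lim)
    then have "\<forall>\<^sub>F t in at_right 0. \<eta> < ev t - r * t" using \<eta>(1) by (intro order_tendstoD(1)) auto
    moreover have "\<forall>\<^sub>F t in at_right 0. t \<in> {0<..<q}" using q(1) by (rule eventually_at_right_real)
    ultimately have "\<forall>\<^sub>F t in at_right 0. \<eta> < ev t - r * t \<and> t \<in> {0<..<q}" by (rule eventually_conj)
    from eventually_happens'[OF trivial_limit_at_right_real this]
    obtain p where "\<eta> < ev p - r * p \<and> p \<in> {0<..<q}" by blast
    then have p: "0 < p" "p < q" "\<eta> \<le> ev p - r * p" by simp_all
    obtain t x where "p \<le> t" "t < q" "eig t x" "Re (a1 x x) \<le> r + \<kappa> * t"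
      using crossing[OF p(1,2) q(3) p(3) \<eta>(2)] by blast
    then show ?thesis using p(1) q(2) by (intro exI[of _ t] exI[of _ x]) simp
  qed
  then obtain t x where t: "\<forall>n::nat. 0 < t n \<and> t n < \<rho> \<and> (eig (t n) (x n) \<and> Re (a1 (x n) (x n)) \<le> r + \<kappa> * t n)"
    and t0: "t \<longlonglongrightarrow> 0"
    using sequence_at_right[of "\<lambda>t x. eig t x \<and> Re (a1 x x) \<le> r + \<kappa> * t"] by blast
  have tn: "0 < t n" "t n < \<rho>" "eig (t n) (x n)" "Re (a1 (x n) (x n)) \<le> r + \<kappa> * t n" for n
    using t by blast+
  obtain R u \<nu> where R: "strict_mono (R::nat\<Rightarrow>nat)" and u: "u \<noteq> 0" "slope_vector \<nu> u" "\<nu> < \<sigma>"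
    and \<nu>: "(\<lambda>n. ev (t (R n)) / t (R n)) \<longlonglongrightarrow> \<nu>"
    using small_time_limit[OF s s0 r tn(1,2) t0 tn(3,4)] by blast
  have tR: "(\<lambda>n. t (R n)) \<longlonglongrightarrow> 0" using LIMSEQ_subseq_LIMSEQ[OF t0 R] by (simp add: o_def)
  have near: "\<exists>\<^sub>F t in at_right 0. \<bar>ev t / t - \<nu>\<bar> < d" if "d > 0" for d
    unfolding frequently_def
  proof
    assume "\<forall>\<^sub>F t in at_right 0. \<not> \<bar>ev t / t - \<nu>\<bar> < d"
    moreover have "filterlim (\<lambda>n. t (R n)) (at_right 0) sequentially"
      using tn(1) tR tn(1)[THEN less_imp_neq, symmetric] by (auto simp: filterlim_at intro!: always_eventually)
    ultimately have "\<forall>\<^sub>F n in sequentially. \<not> \<bar>ev (t (R n)) / t (R n) - \<nu>\<bar> < d"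
      by (rule eventually_compose_filterlim)
    moreover have "\<forall>\<^sub>F n in sequentially. \<bar>ev (t (R n)) / t (R n) - \<nu>\<bar> < d"
      using \<nu> that unfolding tendsto_iff dist_real_def by blast
    ultimately have "\<forall>\<^sub>F n in sequentially. False" by eventually_elim simp
    then show False by simp
  qed
  have "((\<lambda>t. ev t / t) \<longlongrightarrow> \<nu>) (at_right 0)"
  proof (rule ccontr)
    assume "\<not> ?thesis"
    then obtain d where d: "d > 0" "\<not> (\<forall>\<^sub>F t in at_right 0. dist (ev t / t) \<nu> < d)"
      unfolding tendsto_iff by blast
    from d(2) have "\<exists>\<^sub>F t in at_right 0. \<nu> + d \<le> ev t / t \<or> ev t / t \<le> \<nu> - d"
      unfolding not_eventually
    proof (rule frequently_elim1)
      fix t assume "\<not> dist (ev t / t) \<nu> < d"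
      then show "\<nu> + d \<le> ev t / t \<or> ev t / t \<le> \<nu> - d" unfolding dist_real_def by linarith
    qed
    then have "(\<exists>\<^sub>F t in at_right 0. \<nu> + d \<le> ev t / t) \<or> (\<exists>\<^sub>F t in at_right 0. ev t / t \<le> \<nu> - d)"
      by (simp only: frequently_disj_iff)
    then show False
    proof
      assume far: "\<exists>\<^sub>F t in at_right 0. \<nu> + d \<le> ev t / t"
      \<comment> \<open>Oscillation is excluded only at levels up to \<sigma>. Since \<nu> <
        \<sigma>, truncating still leaves an interval above \<nu>, and \<alpha> is its
        midpoint.\<close>
      define \<beta> where "\<beta> = min (\<nu> + d) \<sigma>"
      define \<alpha> where "\<alpha> = (\<nu> + \<beta>) / 2"
      have \<beta>: "\<nu> < \<beta>" "\<beta> \<le> \<sigma>" "\<beta> \<le> \<nu> + d" using d u by (auto simp: \<beta>_def)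
      have \<alpha>: "\<nu> < \<alpha>" "\<alpha> < \<beta>" using \<beta> by (auto simp: \<alpha>_def)
      have "\<exists>\<^sub>F t in at_right 0. ev t / t \<le> \<alpha>"
        by (rule frequently_elim1[OF near[of "\<alpha> - \<nu>"]]) (use \<alpha> in auto)
      moreover have "\<exists>\<^sub>F t in at_right 0. \<beta> \<le> ev t / t"
        by (rule frequently_elim1[OF far]) (use \<beta> in auto)
      ultimately show False by (rule slope_not_oscillating[OF s s0 \<alpha>(2) \<beta>(2)])
    next
      assume far: "\<exists>\<^sub>F t in at_right 0. ev t / t \<le> \<nu> - d"
      \<comment> \<open>Below \<nu> the levels between \<nu> - d and \<nu> - d/2 lie under \<sigma>
        already.\<close>
      have "\<exists>\<^sub>F t in at_right 0. \<nu> - d / 2 \<le> ev t / t"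
      proof (rule frequently_elim1[OF near[of "d / 2"]])
        fix t assume "\<bar>ev t / t - \<nu>\<bar> < d / 2"
        then show "\<nu> - d / 2 \<le> ev t / t" by linarith
      qed (use d in simp)
      then show False using slope_not_oscillating[OF s s0 _ _ far, of "\<nu> - d / 2"] d u by simp
    qed
  qed
  then show ?thesis using u by blast
qed

end

section \<open>Projections and Taylor bounds\<close>

lemma cinner_eqI: "(\<And>z. cinner x z = cinner y z) \<Longrightarrow> x = (y :: 'a::complex_hilbert_space)"
proof -
  assume "\<And>z. cinner x z = cinner y z"
  then have "cinner (x - y) (x - y) = 0" by simp
  then show "x = y" by (simp add: cinner_self del: cinner.diff_left cinner.diff_right)
qed

locale closed_subspace =
  fixes V :: "'a::complex_hilbert_space set"
  assumes csub: "csubspace V" and closed: "cinner.nrm_closed V"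
begin

lemma orth_proj_eqI:
  assumes "p \<in> V" "\<And>v. v \<in> V \<Longrightarrow> cinner (x - p) v = 0"
  shows "orth_proj V x = p"
  unfolding orth_proj_def
proof (rule the_equality)
  fix q assume q: "q \<in> V \<and> (\<forall>v\<in>V. cinner (x - q) v = 0)"
  have "p - q \<in> V" using csubspace_diff[OF csub] assms(1) q by blast
  then have "cinner (x - q) (p - q) = 0" "cinner (x - p) (p - q) = 0" using q assms(2) by blast+
  moreover have "cinner (p - q) (p - q) = cinner (x - q) (p - q) - cinner (x - p) (p - q)"
    by (simp add: algebra_simps)
  ultimately have "cinner (p - q) (p - q) = 0" by (simp only: diff_self)
  then show "q = p" by (simp add: cinner_self del: cinner.diff_left cinner.diff_right)
qed (use assms in blast)

lemma orth_proj: "orth_proj V x \<in> V" "v \<in> V \<Longrightarrow> cinner (x - orth_proj V x) v = 0"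
proof -
  obtain p where p: "p \<in> V" "\<And>v. v \<in> V \<Longrightarrow> cinner (x - p) v = 0"
    using cinner.projection[OF csub _ closed] by blast
  have "orth_proj V x = p" by (rule orth_proj_eqI[OF p])
  then show "orth_proj V x \<in> V" "v \<in> V \<Longrightarrow> cinner (x - orth_proj V x) v = 0" using p by simp_all
qed

lemma orth_proj_add: "orth_proj V (x + y) = orth_proj V x + orth_proj V y"
proof (rule orth_proj_eqI)
  show "orth_proj V x + orth_proj V y \<in> V" using csub orth_proj(1) unfolding csubspace_def by blast
  fix v assume "v \<in> V"
  then show "cinner (x + y - (orth_proj V x + orth_proj V y)) v = 0"
    using orth_proj(2)[of v x] orth_proj(2)[of v y] by simp
qed

lemma orth_proj_scaleC: "orth_proj V (c *\<^sub>C x) = c *\<^sub>C orth_proj V x"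
proof (rule orth_proj_eqI)
  show "c *\<^sub>C orth_proj V x \<in> V" using csub orth_proj(1) unfolding csubspace_def by blast
  fix v assume "v \<in> V"
  then show "cinner (c *\<^sub>C x - c *\<^sub>C orth_proj V x) v = 0" using orth_proj(2)[of v x] by simp
qed

lemma orth_proj_id: "v \<in> V \<Longrightarrow> orth_proj V v = v"
  by (rule orth_proj_eqI) auto

lemma norm_orth_proj: "norm (orth_proj V x) \<le> norm x"
proof -
  let ?p = "orth_proj V x"
  have "cinner x ?p = cinner ?p ?p" using orth_proj(2)[OF orth_proj(1), of x] by simp
  then have "norm ?p * norm ?p \<le> norm x * norm ?p"
    using cinner_le[of x ?p] by (simp add: cinner_self norm_power power2_eq_square norm_mult)
  then show ?thesis by (cases "norm ?p = 0") (auto simp: mult_le_cancel_right)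
qed

lemma cinner_orth_proj: "v \<in> V \<Longrightarrow> cinner v (orth_proj V x) = cinner v x"
  using orth_proj(2)[of v x] cinner_commute[of v x] cinner_commute[of v "orth_proj V x"] by simp

end

lemma bounded_form_operator:
  fixes q :: "'a::complex_hilbert_space \<Rightarrow> 'a \<Rightarrow> complex"
  assumes "symmetric_sesquilinear UNIV q" and bdd: "\<And>x y. cmod (q x y) \<le> C * norm x * norm y"
  shows "\<exists>B. bounded_self_adjoint B \<and> (\<forall>x y. cinner (B x) y = q x y)"
proof -
  interpret q: symmetric_sesquilinear UNIV q by fact
  have "\<exists>w\<in>UNIV. \<forall>y\<in>UNIV. q y x = cinner y w" for x
  proof (rule cinner.Riesz)
    show "cmod (q y x) \<le> C * norm x * cinner.nrm y" for y
      using bdd[of y x] by (simp add: mult_ac)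
  qed simp_all
  then obtain B where B: "\<And>x y. q y x = cinner y (B x)" by (metis UNIV_I)
  have Bq: "cinner (B x) y = q x y" for x y
    using B[of y x] q.swap[of y x] cinner_commute[of "B x" y] by simp
  have "bounded_self_adjoint B" unfolding bounded_self_adjoint_def self_adjoint_def linear_operator_def
  proof (intro conjI ballI allI)
    show "B (x + y) = B x + B y" for x y by (rule cinner_eqI) (simp add: Bq)
    show "B (c *\<^sub>C x) = c *\<^sub>C B x" for c x by (rule cinner_eqI) (simp add: Bq)
    show "adjoint_graph UNIV B = {(y, B y) |y. y \<in> UNIV}"
    proof (rule set_eqI, clarify)
      fix y z
      have "(y, z) \<in> adjoint_graph UNIV B \<longleftrightarrow> (\<forall>x. cinner x (B y) = cinner x z)"
        by (simp add: adjoint_graph_def Bq B)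
      also have "\<dots> \<longleftrightarrow> z = B y" using cinner_eqI[of z "B y"] by (metis cinner_commute)
      finally show "(y, z) \<in> adjoint_graph UNIV B \<longleftrightarrow> (y, z) \<in> {(y, B y) |y. y \<in> UNIV}" by auto
    qed
    have "norm (B x) \<le> C * norm x" for x
    proof -
      have "norm (B x) * norm (B x) = cmod (q x (B x))"
        by (simp add: Bq[symmetric] cinner_self norm_power power2_eq_square norm_mult)
      also have "\<dots> \<le> C * norm x * norm (B x)" by (rule bdd)
      finally show ?thesis
      proof (cases "norm (B x) = 0")
        case True
        \<comment> \<open>The norm of \<open>B x\<close> cannot be cancelled when it is 0; the sign
          of C |x| comes from the bound at (x, x) instead.\<close>
        have "0 \<le> C * norm x * norm x" using bdd[of x x] norm_ge_zero order_trans by blast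
        then have "0 \<le> C * norm x" by (cases "x = 0") (auto simp: zero_le_mult_iff)
        then show ?thesis using True by simp
      qed (auto simp: mult_le_cancel_right)
    qed
    then show "\<exists>K. \<forall>x. norm (B x) \<le> K * norm x" by blast
  qed (simp_all add: csubspace_UNIV)
  then show ?thesis using Bq by blast
qed

text \<open>Serves to make \<open>a1\<close> a symmetric form as the pointwise limit of real
  difference quotients.\<close>

lemma symmetric_sesquilinear_limit:
  assumes q: "\<And>n::nat. symmetric_sesquilinear D (q n)"
    and lim: "\<And>x y. x \<in> D \<Longrightarrow> y \<in> D \<Longrightarrow> (\<lambda>n. q n x y) \<longlonglongrightarrow> l x y"
  shows "symmetric_sesquilinear D l"
proof -
  interpret q: symmetric_sesquilinear D "q n" for n using q .
  have add: "l (x + y) z = l x z + l y z" "l z (x + y) = l z x + l z y"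
    if D: "x \<in> D" "y \<in> D" "z \<in> D" for x y z
  proof -
    have "(\<lambda>n. q n (x + y) z) \<longlonglongrightarrow> l x z + l y z"
      using tendsto_add[OF lim[OF D(1,3)] lim[OF D(2,3)]] D by simp
    from LIMSEQ_unique[OF lim this] show "l (x + y) z = l x z + l y z" using D by simp
    have "(\<lambda>n. q n z (x + y)) \<longlonglongrightarrow> l z x + l z y"
      using tendsto_add[OF lim[OF D(3,1)] lim[OF D(3,2)]] D by simp
    from LIMSEQ_unique[OF lim this] show "l z (x + y) = l z x + l z y" using D by simp
  qed
  have scale: "l (c *\<^sub>C x) y = c * l x y" "l x (c *\<^sub>C y) = cnj c * l x y"
    if D: "x \<in> D" "y \<in> D" for c x y
  proof -
    have "(\<lambda>n. q n (c *\<^sub>C x) y) \<longlonglongrightarrow> c * l x y"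
      using tendsto_mult_left[OF lim[OF D], of c] D by simp
    from LIMSEQ_unique[OF lim this] show "l (c *\<^sub>C x) y = c * l x y" using D by simp
    have "(\<lambda>n. q n x (c *\<^sub>C y)) \<longlonglongrightarrow> cnj c * l x y"
      using tendsto_mult_left[OF lim[OF D], of "cnj c"] D by simp
    from LIMSEQ_unique[OF lim this] show "l x (c *\<^sub>C y) = cnj c * l x y" using D by simp
  qed
  have sym: "l x y = cnj (l y x)" if "x \<in> D" "y \<in> D" for x y
  proof -
    have "(\<lambda>n. cnj (q n y x)) \<longlonglongrightarrow> cnj (l y x)" using lim that by (intro tendsto_cnj)
    moreover have "cnj (q n y x) = q n x y" for n using q.swap[OF that(2,1)] by simp
    ultimately show ?thesis using LIMSEQ_unique[OF lim[OF that]] by simp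
  qed
  show ?thesis
  proof
    show "sesquilinear_on D l" unfolding sesquilinear_on_def using q.csub add scale by blast
    show "symmetric_form D l" unfolding symmetric_form_def using sym by blast
  qed
qed

text \<open>Two mean value estimates: bounded second derivative gives |f'(z) - f'(0)| = O(|z|), and
  on the ball of radius max s t this is O(s + t), which bounds the increment of f minus its linear
  part.\<close>

lemma holomorphic_taylor_bound:
  assumes f: "f holomorphic_on U" "open U" and \<rho>: "cball 0 \<rho> \<subseteq> U" "0 < \<rho>"
  shows "\<exists>K\<ge>0. \<forall>s t. 0 \<le> s \<longrightarrow> s \<le> \<rho> \<longrightarrow> 0 \<le> t \<longrightarrow> t \<le> \<rho> \<longrightarrow>
    cmod (f (of_real s) - f (of_real t) - of_real (s - t) * deriv f 0) \<le> K * \<bar>s - t\<bar> * (s + t)"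
proof -
  have f': "deriv f holomorphic_on U" and f'': "deriv (deriv f) holomorphic_on U"
    using f by (auto intro: holomorphic_deriv)
  have "compact (deriv (deriv f) ` cball 0 \<rho>)"
    by (intro compact_continuous_image holomorphic_on_imp_continuous_on
        holomorphic_on_subset[OF f'' \<rho>(1)] compact_cball)
  then obtain K where "\<And>z. z \<in> cball 0 \<rho> \<Longrightarrow> cmod (deriv (deriv f) z) \<le> K"
    using bounded_iff compact_imp_bounded by (metis (no_types, lifting) image_eqI)
  then have K: "\<And>z. z \<in> cball 0 \<rho> \<Longrightarrow> cmod (deriv (deriv f) z) \<le> \<bar>K\<bar>" by (meson abs_ge_self order_trans)
  have d1: "cmod (deriv f z - deriv f 0) \<le> \<bar>K\<bar> * cmod z" if z: "z \<in> cball 0 \<rho>" for z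
  proof -
    have "cmod (deriv f z - deriv f 0) \<le> \<bar>K\<bar> * cmod (z - 0)"
    proof (rule field_differentiable_bound[OF convex_cball _ K])
      show "(deriv f has_field_derivative deriv (deriv f) w) (at w within cball 0 \<rho>)" if "w \<in> cball 0 \<rho>" for w
        using holomorphic_derivI[OF f' f(2)] that \<rho>(1) has_field_derivative_at_within by blast
    qed (use z \<rho> in auto)
    then show ?thesis by simp
  qed
  have "cmod (f (of_real s) - f (of_real t) - of_real (s - t) * deriv f 0) \<le> \<bar>K\<bar> * \<bar>s - t\<bar> * (s + t)"
    if st: "0 \<le> s" "s \<le> \<rho>" "0 \<le> t" "t \<le> \<rho>" for s t
  proof -
    define S where "S = cball (0::complex) (max s t)"
    have S: "S \<subseteq> cball 0 \<rho>" using st by (auto simp: S_def)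
    define g where "g z = f z - z * deriv f 0" for z
    have "cmod (g (of_real s) - g (of_real t)) \<le> \<bar>K\<bar> * (s + t) * cmod (of_real s - of_real t)"
    proof (rule field_differentiable_bound)
      show "convex S" unfolding S_def by (rule convex_cball)
      fix w assume w: "w \<in> S"
      then have wU: "w \<in> U" using S \<rho>(1) by blast
      have "(g has_field_derivative deriv f w - deriv f 0) (at w)"
        unfolding g_def by (auto intro!: derivative_eq_intros holomorphic_derivI[OF f wU])
      then show "(g has_field_derivative deriv f w - deriv f 0) (at w within S)"
        by (rule has_field_derivative_at_within)
      have "cmod w \<le> s + t" using w st by (auto simp: S_def)
      then show "cmod (deriv f w - deriv f 0) \<le> \<bar>K\<bar> * (s + t)"
        using d1[of w] w S mult_left_mono[of "cmod w" "s + t" "\<bar>K\<bar>"] by (meson abs_ge_zero order_trans subsetD)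
    qed (use st in \<open>auto simp: S_def\<close>)
    moreover have "g (of_real s) - g (of_real t) = f (of_real s) - f (of_real t) - of_real (s - t) * deriv f 0"
      by (simp add: g_def algebra_simps)
    moreover have "cmod (of_real s - of_real t) = \<bar>s - t\<bar>"
      by (metis norm_of_real of_real_diff)
    ultimately show ?thesis by (simp add: mult_ac)
  qed
  then show ?thesis by (intro exI[of _ "\<bar>K\<bar>"]) auto
qed

lemma form_coeff_1: "form_coeff a 1 x y = deriv (\<lambda>t. a t x y) 0"
  by (simp add: form_coeff_def fps_expansion_def)

text \<open>A real number strictly between a frequently attained upper bound of the quotient and 0
  serves as -\<gamma>.\<close>

lemma Liminf_negative_frequently:
  assumes "Liminf (at_right 0) (\<lambda>t. ereal ((ev t - \<Sigma> t) / t)) < 0"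
  shows "\<exists>\<gamma>>0. \<exists>\<^sub>F t in at_right (0::real). ev t < \<Sigma> t - \<gamma> * t"
proof -
  have "\<not> 0 \<le> Liminf (at_right 0) (\<lambda>t. ereal ((ev t - \<Sigma> t) / t))" using assms by simp
  then obtain y :: ereal where y: "y < 0" "\<not> (\<forall>\<^sub>F t in at_right 0. y < ereal ((ev t - \<Sigma> t) / t))"
    unfolding le_Liminf_iff by blast
  obtain z where z: "y < ereal z" "ereal z < 0" using ereal_dense2[OF y(1)] by blast
  have "\<exists>\<^sub>F t in at_right 0. ereal ((ev t - \<Sigma> t) / t) \<le> y" using y(2) by (simp add: not_eventually not_less)
  moreover have "\<forall>\<^sub>F t in at_right 0. t \<in> {0<..<1::real}" by (rule eventually_at_right_real) simp
  ultimately have "\<exists>\<^sub>F t in at_right 0. ereal ((ev t - \<Sigma> t) / t) \<le> y \<and> t \<in> {0<..<1}"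
    by (rule frequently_eventually_frequently)
  then have "\<exists>\<^sub>F t in at_right 0. ev t < \<Sigma> t - (- z) * t"
  proof (rule frequently_elim1)
    fix t assume t: "ereal ((ev t - \<Sigma> t) / t) \<le> y \<and> t \<in> {0<..<1}"
    then have "ereal ((ev t - \<Sigma> t) / t) < ereal z" using z(1) by (meson order_le_less_trans)
    then show "ev t < \<Sigma> t - (- z) * t" using t by (simp add: pos_divide_less_eq)
  qed
  then show ?thesis using z(2) by (intro exI[of _ "- z"]) auto
qed

section \<open>Type (B) families\<close>

text \<open>One shape covers both families needed later: difference quotients, with \<beta> = 0, and
  scaled Taylor remainders.\<close>

lemma symmetric_sesquilinear_combination:
  assumes "symmetric_sesquilinear D f" "symmetric_sesquilinear D g" "symmetric_sesquilinear D h"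
  shows "symmetric_sesquilinear D (\<lambda>x y. of_real \<alpha> * (f x y - g x y - of_real \<beta> * h x y))"
proof -
  interpret f: symmetric_sesquilinear D f by fact
  interpret g: symmetric_sesquilinear D g by fact
  interpret h: symmetric_sesquilinear D h by fact
  show ?thesis
  proof
    show "sesquilinear_on D (\<lambda>x y. of_real \<alpha> * (f x y - g x y - of_real \<beta> * h x y))"
      unfolding sesquilinear_on_def using f.csub by (simp add: algebra_simps)
    show "symmetric_form D (\<lambda>x y. of_real \<alpha> * (f x y - g x y - of_real \<beta> * h x y))"
      unfolding symmetric_form_def
    proof (intro ballI)
      fix x y assume "x \<in> D" "y \<in> D"
      then show "of_real \<alpha> * (f x y - g x y - of_real \<beta> * h x y)
          = cnj (of_real \<alpha> * (f y x - g y x - of_real \<beta> * h y x))"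
        using f.swap[of x y] g.swap[of x y] h.swap[of x y] by simp
    qed
  qed
qed

context hilbert_form
begin

lemma bounded_combination:
  assumes "\<exists>C. \<forall>x\<in>D. \<forall>y\<in>D. cmod (f x y) \<le> C * nrm x * nrm y"
    and "\<exists>C. \<forall>x\<in>D. \<forall>y\<in>D. cmod (g x y) \<le> C * nrm x * nrm y"
    and "\<exists>C. \<forall>x\<in>D. \<forall>y\<in>D. cmod (h x y) \<le> C * nrm x * nrm y"
  shows "\<exists>C. \<forall>x\<in>D. \<forall>y\<in>D. cmod (of_real \<alpha> * (f x y - g x y - of_real \<beta> * h x y)) \<le> C * nrm x * nrm y"
proof -
  obtain C1 C2 C3 where C: "\<And>x y. x \<in> D \<Longrightarrow> y \<in> D \<Longrightarrow> cmod (f x y) \<le> C1 * nrm x * nrm y"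
    "\<And>x y. x \<in> D \<Longrightarrow> y \<in> D \<Longrightarrow> cmod (g x y) \<le> C2 * nrm x * nrm y"
    "\<And>x y. x \<in> D \<Longrightarrow> y \<in> D \<Longrightarrow> cmod (h x y) \<le> C3 * nrm x * nrm y"
    using assms by blast
  have "cmod (of_real \<alpha> * (f x y - g x y - of_real \<beta> * h x y))
      \<le> (\<bar>\<alpha>\<bar> * (C1 + C2 + \<bar>\<beta>\<bar> * C3)) * nrm x * nrm y" if D: "x \<in> D" "y \<in> D" for x y
  proof -
    have "cmod (f x y - g x y - of_real \<beta> * h x y) \<le> cmod (f x y) + cmod (g x y) + \<bar>\<beta>\<bar> * cmod (h x y)"
      using norm_triangle_ineq4[of "f x y - g x y" "of_real \<beta> * h x y"] norm_triangle_ineq4[of "f x y" "g x y"]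
      by (simp add: norm_mult)
    also have "\<dots> \<le> C1 * nrm x * nrm y + C2 * nrm x * nrm y + \<bar>\<beta>\<bar> * (C3 * nrm x * nrm y)"
      using C[OF D] by (intro add_mono mult_left_mono) auto
    finally have "cmod (f x y - g x y - of_real \<beta> * h x y) \<le> (C1 + C2 + \<bar>\<beta>\<bar> * C3) * nrm x * nrm y"
      by (simp add: algebra_simps)
    from mult_left_mono[OF this, of "\<bar>\<alpha>\<bar>"] show ?thesis by (simp add: norm_mult mult.assoc)
  qed
  then show ?thesis by blast
qed

text \<open>
  Form boundedness is known for real parameters only, so the uniform boundedness principle is
  applied to real difference quotients.
\<close>

lemma uniform_taylor:
  fixes a :: "complex \<Rightarrow> 'a \<Rightarrow> 'a \<Rightarrow> complex"
  assumes U: "open U" "cball 0 \<rho> \<subseteq> U" "0 < \<rho>"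
    and sym: "\<And>t. 0 \<le> t \<Longrightarrow> t \<le> \<rho> \<Longrightarrow> symmetric_sesquilinear D (a (of_real t))"
    and bdd: "\<And>t. 0 \<le> t \<Longrightarrow> t \<le> \<rho> \<Longrightarrow> \<exists>C. \<forall>x\<in>D. \<forall>y\<in>D. cmod (a (of_real t) x y) \<le> C * nrm x * nrm y"
    and hol: "\<And>x y. x \<in> D \<Longrightarrow> y \<in> D \<Longrightarrow> (\<lambda>t. a t x y) holomorphic_on U"
  shows "symmetric_sesquilinear D (form_coeff a 1) \<and>
    (\<exists>K\<ge>0. (\<forall>x\<in>D. \<forall>y\<in>D. cmod (form_coeff a 1 x y) \<le> K * nrm x * nrm y) \<and>
      (\<forall>s t. 0 \<le> s \<longrightarrow> s \<le> \<rho> \<longrightarrow> 0 \<le> t \<longrightarrow> t \<le> \<rho> \<longrightarrow> (\<forall>x\<in>D. \<forall>y\<in>D.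
        cmod (a (of_real s) x y - a (of_real t) x y - of_real (s - t) * form_coeff a 1 x y)
          \<le> K * \<bar>s - t\<bar> * (s + t) * nrm x * nrm y)))"
proof -
  define a1 where "a1 = form_coeff a 1"
  have "\<exists>K\<ge>0. \<forall>s t. 0 \<le> s \<longrightarrow> s \<le> \<rho> \<longrightarrow> 0 \<le> t \<longrightarrow> t \<le> \<rho> \<longrightarrow>
      cmod (a (of_real s) x y - a (of_real t) x y - of_real (s - t) * a1 x y) \<le> K * \<bar>s - t\<bar> * (s + t)"
    if "x \<in> D" "y \<in> D" for x y
    using holomorphic_taylor_bound[OF hol[OF that] U] unfolding a1_def form_coeff_1 by simp
  then obtain \<C> where \<C>0: "\<And>x y. x \<in> D \<Longrightarrow> y \<in> D \<Longrightarrow> \<C> x y \<ge> 0"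
    and \<C>: "\<And>s t x y. 0 \<le> s \<Longrightarrow> s \<le> \<rho> \<Longrightarrow> 0 \<le> t \<Longrightarrow> t \<le> \<rho> \<Longrightarrow> x \<in> D \<Longrightarrow> y \<in> D \<Longrightarrow>
      cmod (a (of_real s) x y - a (of_real t) x y - of_real (s - t) * a1 x y) \<le> \<C> x y * \<bar>s - t\<bar> * (s + t)"
    by metis
  \<comment> \<open>Real difference quotients at 0. The last summand has coefficient 0 and only fits
    them to the combination lemmas.\<close>
  define q where "q t x y = of_real (1 / t) * (a (of_real t) x y - a (of_real 0) x y - of_real 0 * a (of_real 0) x y)"
    for t x y
  have q_sym: "symmetric_sesquilinear D (q t)" if "0 < t" "t \<le> \<rho>" for t
    unfolding q_def using that U(3) by (intro symmetric_sesquilinear_combination sym) auto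
  have q_a1: "cmod (q t x y - a1 x y) \<le> \<C> x y * t" if t: "0 < t" "t \<le> \<rho>" and xy: "x \<in> D" "y \<in> D" for t x y
  proof -
    have "t * cmod (q t x y - a1 x y) = cmod (of_real t * (q t x y - a1 x y))"
      using t by (simp add: norm_mult)
    also have "of_real t * (q t x y - a1 x y) = a (of_real t) x y - a (of_real 0) x y - of_real (t - 0) * a1 x y"
      using t by (simp add: q_def algebra_simps)
    also have "cmod \<dots> \<le> \<C> x y * \<bar>t - 0\<bar> * (t + 0)" using t xy by (intro \<C>) auto
    also have "\<dots> = t * (\<C> x y * t)" using t by simp
    finally show ?thesis using t by simp
  qed
  have "\<exists>K\<ge>0. \<forall>t\<in>{0<..\<rho>}. \<forall>x\<in>D. \<forall>y\<in>D. cmod (q t x y) \<le> K * nrm x * nrm y"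
  proof (rule uniform_boundedness_sesquilinear)
    fix t assume "t \<in> {0<..\<rho>}"
    then have t: "0 < t" "t \<le> \<rho>" by auto
    show "sesquilinear_on D (q t)" using q_sym[OF t] by (simp add: symmetric_sesquilinear_def sesquilinear_def)
    show "\<exists>C. \<forall>x\<in>D. \<forall>y\<in>D. cmod (q t x y) \<le> C * nrm x * nrm y"
      unfolding q_def using t U(3) by (intro bounded_combination bdd) auto
  next
    fix x y assume xy: "x \<in> D" "y \<in> D"
    have "cmod (q t x y) \<le> cmod (a1 x y) + \<C> x y * \<rho>" if "t \<in> {0<..\<rho>}" for t
    proof -
      have "cmod (q t x y - a1 x y) \<le> \<C> x y * t" using that xy by (intro q_a1) auto
      also have "\<dots> \<le> \<C> x y * \<rho>" using that \<C>0[OF xy] by (intro mult_left_mono) auto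
      finally show ?thesis using norm_triangle_ineq2[of "q t x y" "a1 x y"] by linarith
    qed
    then show "\<exists>B. \<forall>t\<in>{0<..\<rho>}. cmod (q t x y) \<le> B" by blast
  qed
  then obtain K1 where K1: "K1 \<ge> 0"
    and qK1: "\<And>t x y. 0 < t \<Longrightarrow> t \<le> \<rho> \<Longrightarrow> x \<in> D \<Longrightarrow> y \<in> D \<Longrightarrow> cmod (q t x y) \<le> K1 * nrm x * nrm y"
    by auto
  define \<tau> where "\<tau> n = \<rho> * (1 / real (Suc n))" for n
  have \<tau>: "0 < \<tau> n" "\<tau> n \<le> \<rho>" for n
    using U(3) by (auto simp: \<tau>_def divide_le_eq mult_le_cancel_left1)
  have "(\<lambda>n. \<rho> * (1 / real (Suc n))) \<longlonglongrightarrow> \<rho> * 0" by (intro tendsto_intros LIMSEQ_Suc[OF lim_1_over_n])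
  then have \<tau>0: "\<tau> \<longlonglongrightarrow> 0" by (simp add: \<tau>_def[abs_def])
  have q_lim: "(\<lambda>n. q (\<tau> n) x y) \<longlonglongrightarrow> a1 x y" if xy: "x \<in> D" "y \<in> D" for x y
  proof (rule LIM_zero_cancel)
    have "(\<lambda>n. \<C> x y * \<tau> n) \<longlonglongrightarrow> 0" by (rule tendsto_mult_right_zero[OF \<tau>0])
    then show "(\<lambda>n. q (\<tau> n) x y - a1 x y) \<longlonglongrightarrow> 0"
      by (rule Lim_null_comparison[rotated]) (intro always_eventually allI q_a1 \<tau> xy)
  qed
  have a1_sym: "symmetric_sesquilinear D a1"
    by (rule symmetric_sesquilinear_limit[OF q_sym[OF \<tau>] q_lim])
  have a1_bdd: "cmod (a1 x y) \<le> K1 * nrm x * nrm y" if "x \<in> D" "y \<in> D" for x y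
    using qK1[OF \<tau> that] by (intro LIMSEQ_le_const2[OF tendsto_norm[OF q_lim[OF that]]]) blast
  \<comment> \<open>Off the diagonal |s - t| (s + t) is positive on nonnegative times, so remainders
    can be divided by it.\<close>
  define I where "I = {(s, t). 0 \<le> s \<and> s \<le> \<rho> \<and> 0 \<le> t \<and> t \<le> \<rho> \<and> s \<noteq> t}"
  \<comment> \<open>The Taylor remainder divided by its expected order: for fixed x and y it is
    bounded by the scalar estimate, so uniform boundedness yields one constant for all pairs of
    times.\<close>
  define Q where "Q p x y = of_real (1 / (\<bar>fst p - snd p\<bar> * (fst p + snd p))) *
      (a (of_real (fst p)) x y - a (of_real (snd p)) x y - of_real (fst p - snd p) * a1 x y)" for p x y
  have "\<exists>K\<ge>0. \<forall>p\<in>I. \<forall>x\<in>D. \<forall>y\<in>D. cmod (Q p x y) \<le> K * nrm x * nrm y"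
  proof (rule uniform_boundedness_sesquilinear)
    fix p assume p: "p \<in> I"
    have "symmetric_sesquilinear D (Q p)"
      unfolding Q_def using p by (intro symmetric_sesquilinear_combination sym a1_sym) (auto simp: I_def)
    then show "sesquilinear_on D (Q p)" by (simp add: symmetric_sesquilinear_def sesquilinear_def)
    show "\<exists>C. \<forall>x\<in>D. \<forall>y\<in>D. cmod (Q p x y) \<le> C * nrm x * nrm y"
      unfolding Q_def using p a1_bdd by (intro bounded_combination bdd) (auto simp: I_def)
  next
    fix x y assume xy: "x \<in> D" "y \<in> D"
    have "cmod (Q p x y) \<le> \<C> x y" if p: "p \<in> I" for p
    proof -
      define d where "d = \<bar>fst p - snd p\<bar> * (fst p + snd p)"
      have "0 \<le> fst p" "0 \<le> snd p" "fst p \<noteq> snd p" using p by (auto simp: I_def)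
      then have "0 < fst p + snd p" by linarith
      then have d: "d > 0" using \<open>fst p \<noteq> snd p\<close> by (simp add: d_def)
      have "cmod (Q p x y) = cmod (a (of_real (fst p)) x y - a (of_real (snd p)) x y - of_real (fst p - snd p) * a1 x y) / d"
        unfolding Q_def d_def[symmetric] norm_mult norm_of_real using d by simp
      also have "\<dots> \<le> \<C> x y * \<bar>fst p - snd p\<bar> * (fst p + snd p) / d"
        using p d xy by (intro divide_right_mono \<C>) (auto simp: I_def)
      also have "\<dots> = \<C> x y * d / d" by (simp only: d_def mult.assoc)
      also have "\<dots> = \<C> x y" using d by simp
      finally show ?thesis .
    qed
    then show "\<exists>B. \<forall>p\<in>I. cmod (Q p x y) \<le> B" by blast
  qed
  then obtain K2 where K2: "K2 \<ge> 0"
    and QK2: "\<And>p x y. p \<in> I \<Longrightarrow> x \<in> D \<Longrightarrow> y \<in> D \<Longrightarrow> cmod (Q p x y) \<le> K2 * nrm x * nrm y" by auto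
  have T: "cmod (a (of_real s) x y - a (of_real t) x y - of_real (s - t) * a1 x y) \<le> K2 * \<bar>s - t\<bar> * (s + t) * nrm x * nrm y"
    if st: "0 \<le> s" "s \<le> \<rho>" "0 \<le> t" "t \<le> \<rho>" and xy: "x \<in> D" "y \<in> D" for s t x y
  proof (cases "s = t")
    case False
    define d where "d = \<bar>s - t\<bar> * (s + t)"
    have "0 < s + t" using st False by linarith
    then have d: "d > 0" using False by (simp add: d_def)
    have "(s, t) \<in> I" using st False by (simp add: I_def)
    from QK2[OF this xy]
    have "cmod (a (of_real s) x y - a (of_real t) x y - of_real (s - t) * a1 x y) / d \<le> K2 * nrm x * nrm y"
      unfolding Q_def fst_conv snd_conv d_def[symmetric] norm_mult norm_of_real using d by simp
    then have "cmod (a (of_real s) x y - a (of_real t) x y - of_real (s - t) * a1 x y) \<le> K2 * nrm x * nrm y * d"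
      using d by (simp add: pos_divide_le_eq)
    then show ?thesis by (simp add: d_def mult_ac)
  qed simp
  let ?K = "max K1 K2"
  have "cmod (a1 x y) \<le> ?K * nrm x * nrm y" if "x \<in> D" "y \<in> D" for x y
    by (rule order_trans[OF a1_bdd[OF that]]) (use that in \<open>intro mult_right_mono, auto\<close>)
  moreover have "cmod (a (of_real s) x y - a (of_real t) x y - of_real (s - t) * a1 x y) \<le> ?K * \<bar>s - t\<bar> * (s + t) * nrm x * nrm y"
    if st: "0 \<le> s" "s \<le> \<rho>" "0 \<le> t" "t \<le> \<rho>" and xy: "x \<in> D" "y \<in> D" for s t x y
    by (rule order_trans[OF T[OF that]]) (use that in \<open>intro mult_right_mono, auto\<close>)
  ultimately show ?thesis using a1_sym K1 unfolding a1_def[symmetric]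
    by (intro conjI exI[of _ ?K]) auto
qed

end

section \<open>Reduction to the abstract threshold family\<close>

theorem theorem4p1:
  fixes U :: "complex set"
    and D :: "'a::complex_hilbert_space set"
    and a :: "complex \<Rightarrow> 'a \<Rightarrow> 'a \<Rightarrow> complex"
    and DA :: "real \<Rightarrow> 'a set"
    and A :: "real \<Rightarrow> 'a \<Rightarrow> 'a"
    and \<Sigma> ev :: "real \<Rightarrow> real"
    and \<epsilon> :: real
  assumes family: "self_adjoint_type_B U D a DA A"
    and eps: "\<epsilon> > 0" "complex_of_real ` {0..<\<epsilon>} \<subseteq> U"
    and Sigma: "\<And>t. 0 \<le> t \<Longrightarrow> t < \<epsilon> \<Longrightarrow> is_min_essential_spectrum (DA t) (A t) (\<Sigma> t)"
    and Sigma_0: "\<Sigma> 0 = 0"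
    and eigenvalue: "\<And>t. 0 < t \<Longrightarrow> t < \<epsilon> \<Longrightarrow> is_eigenvalue (DA t) (A t) (complex_of_real (ev t))"
    and below: "\<And>t. 0 < t \<Longrightarrow> t < \<epsilon> \<Longrightarrow> ev t < \<Sigma> t"
    and cont: "continuous_on {0<..<\<epsilon>} ev"
    and lim: "(ev \<longlongrightarrow> 0) (at_right 0)"
    and liminf: "Liminf (at_right 0) (\<lambda>t. ereal ((ev t - \<Sigma> t) / t)) < 0"
  shows "is_eigenvalue (DA 0) (A 0) 0 \<and>
         (let P = orth_proj (op_kernel (DA 0) (A 0)) in
          \<exists>B\<^sub>0. bounded_self_adjoint B\<^sub>0 \<and>
               (\<forall>x y. cinner (B\<^sub>0 x) y = form_coeff a 1 (P x) (P y)) \<and>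
               (\<exists>L. ((\<lambda>t. ev t / t) \<longlongrightarrow> L) (at_right 0) \<and>
                    is_eigenvalue UNIV B\<^sub>0 (complex_of_real L)))"
proof -
  define b where "b t = a (complex_of_real t)" for t
  define a1 where "a1 = form_coeff a 1"
  have typeA: "holomorphic_type_a U D a" using family by (simp add: self_adjoint_type_B_def)
  have U: "open U" "0 \<in> U" using typeA by (auto simp: holomorphic_type_a_def)
  have hol: "(\<lambda>t. a t x y) holomorphic_on U" if "x \<in> D" "y \<in> D" for x y
    using typeA that by (simp add: holomorphic_type_a_def)
  have op: "form_operator D (b t) (DA t) (A t)" if "complex_of_real t \<in> U" for t
  proof -
    have "closed_sectorial_form D (b t)" "symmetric_form D (b t)" "associated_operator D (b t) (DA t) (A t)"
      using family typeA that unfolding self_adjoint_type_B_def holomorphic_type_a_def b_def by blast+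
    then show ?thesis by unfold_locales (auto simp: closed_sectorial_form_def)
  qed
  interpret A0: form_operator D "b 0" "DA 0" "A 0" using op U by simp
  obtain c where hilb: "hilbert_form D (form_shift (b 0) c)" using A0.shift_exists by blast
  interpret H: hilbert_form D "form_shift (b 0) c" by fact
  obtain \<rho>0 where \<rho>0: "\<rho>0 > 0" "cball 0 \<rho>0 \<subseteq> U" using U open_contains_cball by blast
  have mem: "complex_of_real t \<in> U" if "0 \<le> t" "t \<le> \<rho>0" for t
    using that \<rho>0 by auto
  \<comment> \<open>Each form is bounded in its own shifted norm; comparing complete norms on the
    common domain moves this to the norm of time 0.\<close>
  have b_bdd: "\<exists>C. \<forall>x\<in>D. \<forall>y\<in>D. cmod (b t x y) \<le> C * H.nrm x * H.nrm y" if t: "complex_of_real t \<in> U" for t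
  proof -
    interpret At: form_operator D "b t" "DA t" "A t" using op t .
    obtain c' where "hilbert_form D (form_shift (b t) c')" using At.shift_exists by blast
    then interpret Ht: hilbert_form D "form_shift (b t) c'" .
    obtain C where C: "\<And>x. x \<in> D \<Longrightarrow> Ht.nrm x \<le> C * H.nrm x"
      using H.nrm_dominates[OF Ht.hilbert_form_axioms] by blast
    have "cmod (b t x y) \<le> ((1 + \<bar>c'\<bar>) * (C * C)) * H.nrm x * H.nrm y" if D: "x \<in> D" "y \<in> D" for x y
    proof -
      have "(1 + \<bar>c'\<bar>) * (Ht.nrm x * Ht.nrm y) \<le> (1 + \<bar>c'\<bar>) * ((C * H.nrm x) * (C * H.nrm y))"
        using D C order_trans[OF Ht.nrm_nonneg C] by (intro mult_left_mono mult_mono) auto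
      with form_bound[OF Ht.hilbert_form_axioms D] show ?thesis by (simp add: mult_ac)
    qed
    then show ?thesis by blast
  qed
  have b_sym: "symmetric_sesquilinear D (b t)" if "complex_of_real t \<in> U" for t
    using op[OF that] by (simp add: form_operator_def)
  have sym': "symmetric_sesquilinear D (a (complex_of_real t))" if "0 \<le> t" "t \<le> \<rho>0" for t
    using b_sym[OF mem[OF that]] by (simp add: b_def)
  have bdd': "\<exists>C. \<forall>x\<in>D. \<forall>y\<in>D. cmod (a (complex_of_real t) x y) \<le> C * H.nrm x * H.nrm y"
    if "0 \<le> t" "t \<le> \<rho>0" for t
    unfolding b_def[symmetric] by (rule b_bdd[OF mem[OF that]])
  have a1_sym: "symmetric_sesquilinear D a1" and "\<exists>K\<ge>0. (\<forall>x\<in>D. \<forall>y\<in>D. cmod (a1 x y) \<le> K * H.nrm x * H.nrm y) \<and>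
      (\<forall>s t. 0 \<le> s \<longrightarrow> s \<le> \<rho>0 \<longrightarrow> 0 \<le> t \<longrightarrow> t \<le> \<rho>0 \<longrightarrow> (\<forall>x\<in>D. \<forall>y\<in>D.
        cmod (b s x y - b t x y - of_real (s - t) * a1 x y) \<le> K * \<bar>s - t\<bar> * (s + t) * H.nrm x * H.nrm y))"
    using H.uniform_taylor[of U \<rho>0 a, OF U(1) \<rho>0(2,1) sym' bdd' hol]
    unfolding a1_def b_def by blast+
  then obtain K where K: "K \<ge> 0" and a1_bdd: "\<And>x y. x \<in> D \<Longrightarrow> y \<in> D \<Longrightarrow> cmod (a1 x y) \<le> K * H.nrm x * H.nrm y"
    and taylor: "\<And>s t x y. 0 \<le> s \<Longrightarrow> s \<le> \<rho>0 \<Longrightarrow> 0 \<le> t \<Longrightarrow> t \<le> \<rho>0 \<Longrightarrow> x \<in> D \<Longrightarrow> y \<in> D \<Longrightarrow>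
        cmod (b s x y - b t x y - of_real (s - t) * a1 x y) \<le> K * \<bar>s - t\<bar> * (s + t) * H.nrm x * H.nrm y"
    by blast
  have "\<forall>\<^sub>F t in at_right 0. ev t < 1" using lim by (intro order_tendstoD(2)) auto
  then obtain d where d: "d > 0" "\<And>t. 0 < t \<Longrightarrow> t < d \<Longrightarrow> ev t < 1"
    unfolding eventually_at_right_field by auto
  \<comment> \<open>The perturbation of the shifted form is at most t K (1 + t) times the squared
    form norm; it is at most half of that square once t L <= 1.\<close>
  define L where "L = 2 * K * (1 + \<rho>0)"
  have L: "L \<ge> 0" using K \<rho>0 by (simp add: L_def)
  \<comment> \<open>The four limits secure the Taylor expansion, the hypotheses on \<open>ev\<close>
    and \<Sigma>, ev < 1, and coercivity.\<close>
  define \<rho> where "\<rho> = Min {\<rho>0, \<epsilon>, d, 1 / (L + 1)}"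
  have \<rho>: "0 < \<rho>" "\<rho> \<le> \<rho>0" "\<rho> \<le> \<epsilon>" "\<rho> \<le> d" "\<rho> \<le> 1 / (L + 1)"
    using \<rho>0 eps d L by (auto simp: \<rho>_def)
  have memU: "complex_of_real t \<in> U" if "0 \<le> t" "t < \<rho>" for t using mem that \<rho> by simp
  have coercive: "(H.nrm x)\<^sup>2 / 2 \<le> Re (b t x x) + c * (norm x)\<^sup>2" if t: "0 \<le> t" "t < \<rho>" and x: "x \<in> D" for t x
  proof -
    have "cmod (b t x x - b 0 x x - of_real (t - 0) * a1 x x) \<le> K * \<bar>t - 0\<bar> * (t + 0) * H.nrm x * H.nrm x"
      using t \<rho> x by (intro taylor) auto
    then have "\<bar>Re (b t x x) - Re (b 0 x x) - t * Re (a1 x x)\<bar> \<le> K * t * t * (H.nrm x)\<^sup>2"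
      using abs_Re_le_cmod[of "b t x x - b 0 x x - of_real (t - 0) * a1 x x"] t
      by (simp add: power2_eq_square mult.assoc)
    moreover have "t * \<bar>Re (a1 x x)\<bar> \<le> t * (K * (H.nrm x)\<^sup>2)"
      using a1_bdd[OF x x] abs_Re_le_cmod[of "a1 x x"] t
      by (intro mult_left_mono) (auto simp: power2_eq_square mult.assoc)
    moreover have "- (t * \<bar>Re (a1 x x)\<bar>) \<le> t * Re (a1 x x)"
      using t by (metis abs_ge_minus_self abs_mult abs_of_nonneg minus_le_iff)
    ultimately have "Re (b 0 x x) - (K * t * t * (H.nrm x)\<^sup>2 + t * (K * (H.nrm x)\<^sup>2)) \<le> Re (b t x x)"
      by linarith
    moreover have "K * t * t * (H.nrm x)\<^sup>2 + t * (K * (H.nrm x)\<^sup>2) \<le> (H.nrm x)\<^sup>2 / 2"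
    proof -
      have "t \<le> 1 / (L + 1)" using t \<rho>(5) by linarith
      then have "t * (L + 1) \<le> 1" using L by (simp add: pos_le_divide_eq)
      moreover have "t * (K * (1 + t)) \<le> t * (K * (1 + \<rho>0))"
        using t \<rho> K by (intro mult_left_mono) auto
      ultimately have "K * t * t + t * K \<le> 1 / 2" using t by (simp add: L_def algebra_simps)
      then have "(K * t * t + t * K) * (H.nrm x)\<^sup>2 \<le> 1 / 2 * (H.nrm x)\<^sup>2" by (intro mult_right_mono) auto
      then show ?thesis by (simp add: algebra_simps)
    qed
    moreover have "(H.nrm x)\<^sup>2 = Re (b 0 x x) + c * (norm x)\<^sup>2"
      using H.nrm_power2[OF x] by (simp add: Re_form_shift_diag)
    ultimately show ?thesis by linarith
  qed
  interpret T: threshold_family D b c a1 \<rho> K \<Sigma> ev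
  proof
    show "sesquilinear_on D (b t)" "symmetric_form D (b t)" if "0 \<le> t" "t < \<rho>" for t
      using b_sym[OF memU[OF that]]
      by (simp_all add: symmetric_sesquilinear_def sesquilinear_def symmetric_sesquilinear_axioms_def)
    show "sesquilinear_on D a1" "symmetric_form D a1"
      using a1_sym
      by (simp_all add: symmetric_sesquilinear_def sesquilinear_def symmetric_sesquilinear_axioms_def)
    show "cmod (b s x y - b t x y - of_real (s - t) * a1 x y) \<le> K * \<bar>s - t\<bar> * (s + t) * H.nrm x * H.nrm y"
      if "0 \<le> s" "s < \<rho>" "0 \<le> t" "t < \<rho>" "x \<in> D" "y \<in> D" for s t x y
      using taylor[of s t x y] that \<rho> by simp
    show "\<forall>\<^sub>F k in sequentially. \<Sigma> t * (norm (u k))\<^sup>2 - \<delta> \<le> Re (b t (u k) (u k))"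
      if "0 \<le> t" "t < \<rho>" "\<And>k::nat. u k \<in> D \<and> norm (u k) \<le> M \<and> Re (b t (u k) (u k)) \<le> M"
        "weakly_tendsto_0 u" "0 < \<delta>" for t u M \<delta>
    proof -
      interpret At: form_operator D "b t" "DA t" "A t" using op memU that by blast
      have "is_min_essential_spectrum (DA t) (A t) (\<Sigma> t)" using Sigma that \<rho> by simp
      from At.essential_spectrum_lower_bound[OF this] show ?thesis
        unfolding At.asymptotic_bound_def using that(3-5) by blast
    qed
    \<comment> \<open>Pairing the residual of a singular sequence with the sequence itself gives
      convergence of form values; dropping finitely many terms gives the bound \<Sigma> t + 1
      throughout.\<close>
    show "\<exists>z. (\<forall>n. z n \<in> D \<and> norm (z n) = 1 \<and> Re (b t (z n) (z n)) \<le> \<Sigma> t + 1) \<and>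
        weakly_tendsto_0 z \<and> (\<lambda>n. Re (b t (z n) (z n))) \<longlonglongrightarrow> \<Sigma> t" if t: "0 \<le> t" "t < \<rho>" for t
    proof -
      interpret At: form_operator D "b t" "DA t" "A t" using op memU t by blast
      have "complex_of_real (\<Sigma> t) \<in> essential_spectrum (DA t) (A t)"
        using Sigma t \<rho> by (simp add: is_min_essential_spectrum_def)
      then obtain x where x: "\<And>n. x n \<in> DA t" "\<And>n. norm (x n) = 1" "weakly_tendsto_0 x"
        and res: "(\<lambda>n. norm (A t (x n) - complex_of_real (\<Sigma> t) *\<^sub>C x n)) \<longlonglongrightarrow> 0"
        unfolding essential_spectrum_def by blast
      have xD: "x n \<in> D" for n using x(1) At.DT_subset by blast
      have "(\<lambda>n. Re (b t (x n) (x n)) - \<Sigma> t) \<longlonglongrightarrow> 0"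
      proof (rule Lim_null_comparison[OF _ res], intro always_eventually allI)
        fix n
        have "cinner (A t (x n) - complex_of_real (\<Sigma> t) *\<^sub>C x n) (x n) = b t (x n) (x n) - of_real (\<Sigma> t)"
          using At.operator_form[OF x(1) xD, of n n] x(2) by (simp add: cinner_self)
        then have "cmod (b t (x n) (x n) - of_real (\<Sigma> t)) \<le> norm (A t (x n) - complex_of_real (\<Sigma> t) *\<^sub>C x n)"
          using cinner_le[of "A t (x n) - complex_of_real (\<Sigma> t) *\<^sub>C x n" "x n"] x(2)[of n] by (simp del: cinner.diff_left)
        then show "norm (Re (b t (x n) (x n)) - \<Sigma> t) \<le> norm (A t (x n) - complex_of_real (\<Sigma> t) *\<^sub>C x n)"
          using abs_Re_le_cmod[of "b t (x n) (x n) - of_real (\<Sigma> t)"] by simp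
      qed
      then have limx: "(\<lambda>n. Re (b t (x n) (x n))) \<longlonglongrightarrow> \<Sigma> t" by (rule LIM_zero_cancel)
      have "\<forall>\<^sub>F n in sequentially. Re (b t (x n) (x n)) < \<Sigma> t + 1"
        using limx by (intro order_tendstoD(2)) auto
      then obtain N where N: "\<And>n. n \<ge> N \<Longrightarrow> Re (b t (x n) (x n)) < \<Sigma> t + 1"
        unfolding eventually_sequentially by blast
      have "weakly_tendsto_0 (\<lambda>n. x (n + N))"
        using x(3) unfolding weakly_tendsto_0_def
        by (intro allI LIMSEQ_ignore_initial_segment[of "\<lambda>n. cinner (x n) _"]) blast
      moreover have "(\<lambda>n. Re (b t (x (n + N)) (x (n + N)))) \<longlonglongrightarrow> \<Sigma> t"
        by (rule LIMSEQ_ignore_initial_segment[OF limx])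
      moreover have "Re (b t (x (n + N)) (x (n + N))) \<le> \<Sigma> t + 1" for n
        using N[of "n + N"] by simp
      ultimately show ?thesis using xD x(2)
        by (intro exI[of _ "\<lambda>n. x (n + N)"]) auto
    qed
    show "\<exists>x\<in>D. norm x = 1 \<and> (\<forall>y\<in>D. b t x y = of_real (ev t) * cinner x y)" if t: "0 < t" "t < \<rho>" for t
    proof -
      have "complex_of_real t \<in> U" using memU t by simp
      then interpret At: form_operator D "b t" "DA t" "A t" by (rule op)
      obtain x where x: "x \<in> DA t" "x \<noteq> 0" "A t x = complex_of_real (ev t) *\<^sub>C x"
        using eigenvalue[of t] t \<rho> unfolding is_eigenvalue_def by auto
      have xD: "x \<in> D" using x At.DT_subset by blast
      have "b t x y = of_real (ev t) * cinner x y" if "y \<in> D" for y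
        using At.operator_form[OF x(1) that] x(3) by simp
      then show ?thesis using x(2) xD by (intro bexI[of _ "(1 / norm x) *\<^sub>R x"]) auto
    qed
    show "continuous_on {0<..<\<rho>} ev" by (rule continuous_on_subset[OF cont]) (use \<rho> in auto)
    show "ev t \<le> 1" if "0 < t" "t < \<rho>" for t using d(2)[of t] that \<rho> by simp
    show "\<exists>\<gamma>>0. \<exists>\<^sub>F t in at_right 0. ev t < \<Sigma> t - \<gamma> * t" by (rule Liminf_negative_frequently[OF liminf])
  qed (use \<rho> K a1_bdd coercive Sigma_0 below lim in auto)
  define N where "N = op_kernel (DA 0) (A 0)"
  have N_T: "N = T.N" unfolding N_def T.N_def by (rule A0.kernel_iff)
  obtain \<nu> u where u0: "u \<noteq> 0" and u: "u \<in> N" "\<And>y. y \<in> N \<Longrightarrow> a1 u y = of_real \<nu> * cinner u y"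
    and lim_\<nu>: "((\<lambda>t. ev t / t) \<longlongrightarrow> \<nu>) (at_right 0)"
    using T.threshold_slope unfolding T.slope_vector_def N_T by blast
  have ND: "N \<subseteq> D" unfolding N_T T.N_def by blast
  \<comment> \<open>By self-adjointness the kernel is the orthogonal complement of the range, so its
    closedness follows from continuity of the inner product.\<close>
  have N_alt: "N = {y. \<forall>x\<in>DA 0. cinner (A 0 x) y = 0}"
    using A0.in_domain_iff[of _ 0] by (auto simp: N_def op_kernel_def)
  interpret P: closed_subspace N
  proof
    show "csubspace N" unfolding csubspace_def N_alt by simp
    show "cinner.nrm_closed N" unfolding cinner.nrm_closed_def
    proof (intro allI impI)
      fix x l assume x: "\<forall>n. x n \<in> N" and "(\<lambda>n. cinner.nrm (x n - l)) \<longlonglongrightarrow> 0"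
      then have nl: "(\<lambda>n. norm (x n - l)) \<longlonglongrightarrow> 0" by simp
      have "cinner (A 0 w) l = 0" if w: "w \<in> DA 0" for w
      proof -
        have "(\<lambda>n. 0) \<longlonglongrightarrow> cinner (A 0 w) l"
          using tendsto_cinner_right[OF nl, of "A 0 w"] x w by (simp add: N_alt)
        then show ?thesis by (simp add: LIMSEQ_const_iff)
      qed
      then show "l \<in> N" by (simp add: N_alt)
    qed
  qed
  define P where "P = orth_proj N"
  have PN: "P x \<in> N" and PD: "P x \<in> D" for x using P.orth_proj(1)[of x] ND by (auto simp: P_def)
  \<comment> \<open>The time-0 form vanishes on the kernel, so there the form norm is a multiple of
    the ambient one. Hence the form-bounded \<open>a1\<close> becomes bounded on the whole space
    after composing with \<open>P\<close>.\<close>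
  have nrm_P: "H.nrm (P x) \<le> sqrt \<bar>c\<bar> * norm x" for x
  proof -
    have "b 0 (P x) (P x) = 0" using PN[of x] PD[of x] unfolding N_T T.N_def by blast
    then have "H.nrm (P x) = sqrt (c * (norm (P x))\<^sup>2)" unfolding H.nrm_def Re_form_shift_diag by simp
    also have "\<dots> \<le> sqrt (\<bar>c\<bar> * (norm x)\<^sup>2)"
      using P.norm_orth_proj[of x] unfolding P_def by (intro real_sqrt_le_mono mult_mono power_mono) auto
    finally show ?thesis by (simp add: real_sqrt_mult)
  qed
  have "\<exists>B. bounded_self_adjoint B \<and> (\<forall>x y. cinner (B x) y = a1 (P x) (P y))"
  proof (rule bounded_form_operator)
    show "symmetric_sesquilinear UNIV (\<lambda>x y. a1 (P x) (P y))"
    proof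
      show "sesquilinear_on UNIV (\<lambda>x y. a1 (P x) (P y))"
        using PD unfolding sesquilinear_on_def P_def
        by (simp add: csubspace_UNIV P.orth_proj_add P.orth_proj_scaleC)
      show "symmetric_form UNIV (\<lambda>x y. a1 (P x) (P y))"
        unfolding symmetric_form_def using T.a1.swap[OF PD PD] by blast
    qed
    fix x y
    have "cmod (a1 (P x) (P y)) \<le> K * H.nrm (P x) * H.nrm (P y)" by (rule a1_bdd[OF PD PD])
    also have "\<dots> \<le> K * (sqrt \<bar>c\<bar> * norm x) * (sqrt \<bar>c\<bar> * norm y)"
      using K PD nrm_P by (intro mult_mono) auto
    finally show "cmod (a1 (P x) (P y)) \<le> (K * sqrt \<bar>c\<bar> * sqrt \<bar>c\<bar>) * norm x * norm y"
      by (simp add: mult_ac)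
  qed
  then obtain B where B: "bounded_self_adjoint B" and Bq: "\<And>x y. cinner (B x) y = a1 (P x) (P y)" by blast
  \<comment> \<open>\<open>B\<close> sees a test vector only through its projection, so the equation
    for \<open>u\<close> against kernel vectors extends to all vectors.\<close>
  have "B u = complex_of_real \<nu> *\<^sub>C u"
  proof (rule cinner_eqI)
    fix y
    have "cinner (B u) y = a1 u (P y)" using Bq[of u y] P.orth_proj_id[OF u(1)] by (simp add: P_def)
    also have "\<dots> = of_real \<nu> * cinner u (P y)" by (rule u(2)[OF PN])
    also have "cinner u (P y) = cinner u y" unfolding P_def by (rule P.cinner_orth_proj[OF u(1)])
    finally show "cinner (B u) y = cinner (complex_of_real \<nu> *\<^sub>C u) y" by simp
  qed
  then have "is_eigenvalue UNIV B (complex_of_real \<nu>)" using u0 unfolding is_eigenvalue_def by blast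
  moreover have "is_eigenvalue (DA 0) (A 0) 0"
    using u(1) u0 unfolding N_def op_kernel_def is_eigenvalue_def by auto
  ultimately show ?thesis
    unfolding Let_def N_def[symmetric] P_def[symmetric] a1_def[symmetric]
    using B Bq lim_\<nu> by blast
qed

end
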